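(* Let $T>0$, $\omega=\frac{2\pi}{T}$, $\mathbb{T}=\mathbb{R}/T\mathbb{Z}$. Let $f:\mathbb{R}\to\mathbb{R}$ be an increasing, odd homeomorphism such that $f^{-1}$ is $r$-Hölder continuous with some $r\in(0,1)$. Let $b>a>0$, $\theta\in(0,1)$, and let $V:\mathbb{R}\to\mathbb{R}$ be the $2\pi$-periodic step potential with $V(x)=a$ for $|x|<\pi\theta$ and $V(x)=b$ for $\theta\pi<|x|<\pi$, and assume $$4\sqrt a\,\theta\,\omega\in2\mathbb{N}_0+1\quad\text{and}\quad4\sqrt b\,(1-\theta)\,\omega\in2\mathbb{N}_0+1.$$ Let $u$ be a weak solution of $$\begin{cases}V(x)u_{tt}(x,t)-u_{xx}(x,t)=0,&x\in[0,\infty),\ t\in\mathbb{T},\\ u_x(0,t)=(f(u_t(0,t)))_t,&t\in\mathbb{T}.\end{cases}$$ Then $u$ is $\frac T2$-antiperiodic in $t$ (i.e. $u(x,t+\frac T2)=-u(x,t)$), $u$ lies in $C^{1,r}([0,\infty)\times\mathbb{T})$, and $u$ is a $C^1$-solution on $[0,\infty)\times[0,\infty)$ of the initial value problem $$\begin{cases} V(x)u_{tt}-u_{xx}=0, & x\in[0,\infty),\ t\in[0,\infty),\\ u_x(0,t)=(f(u_t(0,t)))_t, & t\in[0,\infty),\\ u(x,0)=u_0(x),\quad u_t(x,0)=u_1(x), & x\in[0,\infty)\end{cases}$$ with its own initial data $u_0(x)=u(x,0)$, $u_1(x)=u_t(x,0)$. In addition, there exists $C>0$ such that $|u(x,t)|\le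 Ce^{-\rho x}$ for all $x\ge0$ and $t\in\mathbb{T}$, where $\rho=\frac{\log(b)-\log(a)}{4\pi}$.
   Context: All solutions are real-valued. A weak solution of the time-periodic problem is a function $u\in H^1([0,\infty)\times\mathbb{T})$ whose trace satisfies $u(0,\cdot)\in W^{1,1}(\mathbb{T})$ and $f(u_t(0,\cdot))\in L^1(\mathbb{T})$, and such that $$\int_{[0,\infty)\times\mathbb{T}}\left(-V(x)u_t\varphi_t+u_x\varphi_x\right)\mathrm{d}(x,t)-\int_{\mathbb{T}}f(u_t(0,t))\varphi_t(0,t)\,\mathrm{d}t=0$$ for all $\varphi\in C_c^\infty([0,\infty)\times\mathbb{T})$. Put $c(x)=1/\sqrt{V(x)}$ and let $D(\phi)$ denote the set of discontinuities of a function $\phi$. A $C^1$-solution on $[0,\infty)^2$ of the initial value problem is a function $u\in C^1([0,\infty)\times[0,\infty))$ such that: (i) for all $(x,t)\in[0,\infty)^2$ with $x\notin D(c)\cup D(c')$, the directional derivative $(\partial_t-c(x)\partial_x)(u_t+c(x)u_x)(x,t)$ exists and equals $-c(x)c'(x)u_x(x,t)$ (at boundary points of the domain taken one-sidedly, along the part of the line lying in the domain); (ii) $t\mapsto f(u_t(0,t))$ is differentiable with $(f(u_t(0,t)))_t=u_x(0,t)$ for all $t\ge0$; (iii) $u(x,0)=u_0(x)$ and $u_t(x,0)=u_1(x)$ for all $x\ge0$. A function on $[0,\infty)\times\mathbb{T}$ is identified with a $T$-periodic function of $t$. *)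

theory Defs
  imports "HOL-Analysis.Analysis"
begin

section \<open>The half-cylinder, partial derivatives, test functions\<close>

text \<open>
  A function on the half-cylinder \<open>[0,\<infinity>) \<times> \<real>/T\<int>\<close> is a function of \<open>(x,t)\<close> that is
  \<open>T\<close>-periodic in \<open>t\<close> for \<open>x \<ge> 0\<close>; its values at \<open>x < 0\<close> are irrelevant. Integrals over the
  half-cylinder are integrals over the fundamental domain \<open>cyl T\<close>.
\<close>

definition cyl :: "real \<Rightarrow> (real \<times> real) set" where
  "cyl T = {0..} \<times> {0..<T}"

definition cyl_periodic :: "real \<Rightarrow> (real \<times> real \<Rightarrow> real) \<Rightarrow> bool" where
  "cyl_periodic T u \<longleftrightarrow> (\<forall>x\<ge>0. \<forall>t. u (x, t + T) = u (x, t))"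

definition pdx :: "(real \<times> real \<Rightarrow> real) \<Rightarrow> real \<times> real \<Rightarrow> real" where
  "pdx \<phi> = (\<lambda>(x, t). deriv (\<lambda>y. \<phi> (y, t)) x)"

definition pdt :: "(real \<times> real \<Rightarrow> real) \<Rightarrow> real \<times> real \<Rightarrow> real" where
  "pdt \<phi> = (\<lambda>(x, t). deriv (\<lambda>s. \<phi> (x, s)) t)"

text \<open>
  \<open>C\<^sup>\<infinity>\<close> on the plane. Total differentiability of all the derivatives below makes the mixed
  derivatives commute, so the other orders of differentiation need not be listed.
\<close>

definition smooth_plane :: "(real \<times> real \<Rightarrow> real) \<Rightarrow> bool" where
  "smooth_plane \<phi> \<longleftrightarrow> (\<forall>i j p. ((pdx ^^ i) ((pdt ^^ j) \<phi>)) differentiable (at p))"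

definition smooth_line :: "(real \<Rightarrow> real) \<Rightarrow> bool" where
  "smooth_line \<psi> \<longleftrightarrow> (\<forall>i t. ((deriv ^^ i) \<psi>) differentiable (at t))"

text \<open>
  \<open>C\<^sub>c\<^sup>\<infinity>([0,\<infinity>) \<times> \<real>/T\<int>)\<close> consists of the restrictions to \<open>x \<ge> 0\<close> of compactly supported smooth
  functions on the full cylinder \<open>\<real> \<times> \<real>/T\<int>\<close>; the members of \<open>test_fun\<close> are the unrestricted
  functions.
\<close>

definition test_fun :: "real \<Rightarrow> (real \<times> real \<Rightarrow> real) set" where
  "test_fun T = {\<phi>. smooth_plane \<phi> \<and> (\<forall>x t. \<phi> (x, t + T) = \<phi> (x, t)) \<and>
                    (\<exists>R. \<forall>x t. \<bar>x\<bar> > R \<longrightarrow> \<phi> (x, t) = 0)}"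

text \<open>\<open>C\<^sub>c\<^sup>\<infinity>((0,\<infinity>) \<times> \<real>/T\<int>)\<close>, the test functions for weak derivatives.\<close>

definition test_fun_interior :: "real \<Rightarrow> (real \<times> real \<Rightarrow> real) set" where
  "test_fun_interior T = {\<phi> \<in> test_fun T. \<exists>\<epsilon>>0. \<forall>x t. x < \<epsilon> \<longrightarrow> \<phi> (x, t) = 0}"

section \<open>Sobolev spaces and traces\<close>

definition L2_cyl :: "real \<Rightarrow> (real \<times> real \<Rightarrow> real) \<Rightarrow> bool" where
  "L2_cyl T u \<longleftrightarrow> cyl_periodic T u \<and> set_borel_measurable lborel (cyl T) u \<and>
                 set_integrable lborel (cyl T) (\<lambda>p. (u p)\<^sup>2)"

text \<open>\<open>u \<in> H\<^sup>1([0,\<infinity>) \<times> \<real>/T\<int>)\<close> with weak partial derivatives \<open>ux\<close>, \<open>ut\<close>.\<close>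

definition H1_cyl ::
  "real \<Rightarrow> (real \<times> real \<Rightarrow> real) \<Rightarrow> (real \<times> real \<Rightarrow> real) \<Rightarrow> (real \<times> real \<Rightarrow> real) \<Rightarrow> bool" where
  "H1_cyl T u ux ut \<longleftrightarrow> L2_cyl T u \<and> L2_cyl T ux \<and> L2_cyl T ut \<and>
     (\<forall>\<phi> \<in> test_fun_interior T.
        (LINT p:cyl T|lborel. u p * pdx \<phi> p) = - (LINT p:cyl T|lborel. ux p * \<phi> p) \<and>
        (LINT p:cyl T|lborel. u p * pdt \<phi> p) = - (LINT p:cyl T|lborel. ut p * \<phi> p))"

text \<open>
  The trace operator is the continuous extension of \<open>\<phi> \<mapsto> \<phi>(0,\<cdot>)\<close> from
  \<open>C\<^sub>c\<^sup>\<infinity>([0,\<infinity>) \<times> \<real>/T\<int>)\<close> to \<open>H\<^sup>1\<close>, with values in \<open>L\<^sup>2(\<real>/T\<int>)\<close>: some test functions \<open>\<phi> n\<close>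
  converge to \<open>u\<close> in \<open>H\<^sup>1\<close> while \<open>\<phi> n (0,\<cdot>)\<close> converges to \<open>g\<close> in \<open>L\<^sup>2\<close>.
\<close>

definition has_trace ::
  "real \<Rightarrow> (real \<times> real \<Rightarrow> real) \<Rightarrow> (real \<times> real \<Rightarrow> real) \<Rightarrow> (real \<times> real \<Rightarrow> real) \<Rightarrow>
   (real \<Rightarrow> real) \<Rightarrow> bool" where
  "has_trace T u ux ut g \<longleftrightarrow>
     (\<forall>t. g (t + T) = g t) \<and> set_borel_measurable lborel {0..<T} g \<and>
     set_integrable lborel {0..<T} (\<lambda>t. (g t)\<^sup>2) \<and>
     (\<exists>\<phi> :: nat \<Rightarrow> real \<times> real \<Rightarrow> real.
        (\<forall>n. \<phi> n \<in> test_fun T) \<and>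
        (\<lambda>n. LINT p:cyl T|lborel.
               (\<phi> n p - u p)\<^sup>2 + (pdx (\<phi> n) p - ux p)\<^sup>2 + (pdt (\<phi> n) p - ut p)\<^sup>2) \<longlonglongrightarrow> 0 \<and>
        (\<lambda>n. LINT t:{0..<T}|lborel. (\<phi> n (0, t) - g t)\<^sup>2) \<longlonglongrightarrow> 0)"

text \<open>\<open>g \<in> W\<^sup>1\<^sup>,\<^sup>1(\<real>/T\<int>)\<close> with weak derivative \<open>g'\<close>.\<close>

definition W11_circle :: "real \<Rightarrow> (real \<Rightarrow> real) \<Rightarrow> (real \<Rightarrow> real) \<Rightarrow> bool" where
  "W11_circle T g g' \<longleftrightarrow>
     (\<forall>t. g (t + T) = g t) \<and> (\<forall>t. g' (t + T) = g' t) \<and>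
     set_integrable lborel {0..<T} g \<and> set_integrable lborel {0..<T} g' \<and>
     (\<forall>\<psi>. smooth_line \<psi> \<and> (\<forall>t. \<psi> (t + T) = \<psi> t) \<longrightarrow>
        (LINT t:{0..<T}|lborel. g t * deriv \<psi> t) = - (LINT t:{0..<T}|lborel. g' t * \<psi> t))"

section \<open>Weak solutions of the time-periodic problem\<close>

text \<open>Here \<open>g\<close> is the trace \<open>u(0,\<cdot>)\<close> and \<open>g'\<close> its weak derivative, i.e. \<open>u\<^sub>t(0,\<cdot>)\<close>.\<close>

definition weak_solution ::
  "real \<Rightarrow> (real \<Rightarrow> real) \<Rightarrow> (real \<Rightarrow> real) \<Rightarrow> (real \<times> real \<Rightarrow> real) \<Rightarrow> bool" where
  "weak_solution T V f u \<longleftrightarrow>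
     (\<exists>ux ut g g'. H1_cyl T u ux ut \<and> has_trace T u ux ut g \<and> W11_circle T g g' \<and>
        set_integrable lborel {0..<T} (\<lambda>t. f (g' t)) \<and>
        (\<forall>\<phi> \<in> test_fun T.
           (LINT p:cyl T|lborel. - V (fst p) * ut p * pdt \<phi> p + ux p * pdx \<phi> p)
           - (LINT t:{0..<T}|lborel. f (g' t) * pdt \<phi> (0, t)) = 0))"

section \<open>Classical regularity and the initial value problem\<close>

text \<open>
  \<open>u \<in> C\<^sup>1(S)\<close> with partial derivatives \<open>ux\<close>, \<open>ut\<close>, one-sided at boundary points of \<open>S\<close>. On the
  closed sets \<open>S\<close> used below (half-plane and quadrant) \<open>ux\<close> and \<open>ut\<close> are uniquely determined
  by \<open>u\<close>.
\<close>

definition C1_on ::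
  "(real \<times> real) set \<Rightarrow> (real \<times> real \<Rightarrow> real) \<Rightarrow> (real \<times> real \<Rightarrow> real) \<Rightarrow>
   (real \<times> real \<Rightarrow> real) \<Rightarrow> bool" where
  "C1_on S u ux ut \<longleftrightarrow> continuous_on S ux \<and> continuous_on S ut \<and>
     (\<forall>p\<in>S. (u has_derivative (\<lambda>(h, k). ux p * h + ut p * k)) (at p within S))"

definition holder_on :: "real \<Rightarrow> 'a::metric_space set \<Rightarrow> ('a \<Rightarrow> real) \<Rightarrow> bool" where
  "holder_on r S g \<longleftrightarrow> (\<exists>L. \<forall>x\<in>S. \<forall>y\<in>S. \<bar>g x - g y\<bar> \<le> L * dist x y powr r)"

text \<open>
  \<open>u \<in> C\<^sup>1\<^sup>,\<^sup>r([0,\<infinity>) \<times> \<real>/T\<int>)\<close>, i.e. with finite \<open>C\<^sup>1\<^sup>,\<^sup>r\<close>-norm. For periodic functions the Hoelder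
  condition on \<open>[0,\<infinity>) \<times> \<real>\<close> is the one for the quotient metric on the cylinder.
\<close>

definition C1_holder_cyl ::
  "real \<Rightarrow> real \<Rightarrow> (real \<times> real \<Rightarrow> real) \<Rightarrow> (real \<times> real \<Rightarrow> real) \<Rightarrow>
   (real \<times> real \<Rightarrow> real) \<Rightarrow> bool" where
  "C1_holder_cyl T r u ux ut \<longleftrightarrow>
     (let S = {0..} \<times> UNIV in
        cyl_periodic T u \<and> C1_on S u ux ut \<and>
        bounded (u ` S) \<and> bounded (ux ` S) \<and> bounded (ut ` S) \<and>
        holder_on r S ux \<and> holder_on r S ut)"

definition speed :: "(real \<Rightarrow> real) \<Rightarrow> real \<Rightarrow> real" where
  "speed V x = 1 / sqrt (V x)"

definition discont :: "(real \<Rightarrow> real) \<Rightarrow> real set" where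
  "discont \<phi> = {x. \<not> isCont \<phi> x}"

text \<open>
  In the transport condition the directional derivative at \<open>(x,t)\<close> is the derivative at \<open>h = 0\<close>
  along \<open>h \<mapsto> (x - c(x) h, t + h)\<close>, restricted to the \<open>h\<close> for which this point lies in the quadrant.
  At the corner \<open>(0,0)\<close> that part of the line is a single point and the condition is void.
\<close>

definition C1_solution_ivp ::
  "(real \<Rightarrow> real) \<Rightarrow> (real \<Rightarrow> real) \<Rightarrow> (real \<Rightarrow> real) \<Rightarrow> (real \<Rightarrow> real) \<Rightarrow>
   (real \<times> real \<Rightarrow> real) \<Rightarrow> bool" where
  "C1_solution_ivp V f u0 u1 u \<longleftrightarrow>
     (\<exists>ux ut. C1_on ({0..} \<times> {0..}) u ux ut \<and>
        (let c = speed V in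
           \<forall>x\<ge>0. \<forall>t\<ge>0. x \<notin> discont c \<union> discont (deriv c) \<longrightarrow>
             ((\<lambda>h. ut (x - c x * h, t + h) + c (x - c x * h) * ux (x - c x * h, t + h))
                has_real_derivative - c x * deriv c x * ux (x, t))
               (at 0 within {h. x - c x * h \<ge> 0 \<and> t + h \<ge> 0})) \<and>
        (\<forall>t\<ge>0. ((\<lambda>s. f (ut (0, s))) has_real_derivative ux (0, t)) (at t within {0..})) \<and>
        (\<forall>x\<ge>0. u (x, 0) = u0 x \<and> ut (x, 0) = u1 x))"

text \<open>The values of the potential at the jumps (and at \<open>\<pi> + 2\<pi>\<int>\<close>) are left unspecified.\<close>

definition step_potential :: "real \<Rightarrow> real \<Rightarrow> real \<Rightarrow> (real \<Rightarrow> real) \<Rightarrow> bool" where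
  "step_potential a b \<theta> V \<longleftrightarrow>
     (\<forall>x. V (x + 2 * pi) = V x) \<and>
     (\<forall>x. \<bar>x\<bar> < pi * \<theta> \<longrightarrow> V x = a) \<and>
     (\<forall>x. \<theta> * pi < \<bar>x\<bar> \<and> \<bar>x\<bar> < pi \<longrightarrow> V x = b)"

end

theory Submission
  imports Defs "HOL-Computational_Algebra.Polynomial"
begin

text \<open>The time \<open>T\<close>-modes of a weak solution decouple, because the equation in the interior is linear
  with coefficients independent of \<open>t\<close>. Testing with \<open>\<zeta>(x) cos (l t + \<alpha>)\<close>, where \<open>l = 2 \<pi> k / T\<close>,
  shows that the mode \<open>U(x) = \<integral> u(x,t) cos (l t + \<alpha>) dt\<close> solves \<open>U'' = - l\<^sup>2 V U\<close> on the half-line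
  (\<open>mode_system\<close>). The initial value of \<open>U\<close> is a coefficient of the trace \<open>g\<close>; that of \<open>U'\<close> is a
  coefficient of the derivative of \<open>f(g')\<close>.

  The resonance conditions say that the travel time through each layer is an odd multiple of
  \<open>T / 4\<close>. For even \<open>k \<noteq> 0\<close> the pair \<open>(U, U')\<close> is then multiplied by \<open>\<plusminus>1\<close> in each layer, so all
  solutions are bounded and only the zero solution is square-integrable. For odd \<open>k\<close> a layer exchanges \<open>U\<close> and
  \<open>U'\<close>, and over a period one solution is multiplied by \<open>\<plusminus>\<kappa>\<close>, the other one by \<open>\<plusminus>1/\<kappa>\<close>, where
  \<open>\<kappa> = sqrt (a / b)\<close>. A Wronskian of a square-integrable solution with a bounded one is constant
  and square-integrable on the half-line, hence zero; this singles out the decaying solution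
  (\<open>odd_mode_decays\<close>, \<open>even_mode_vanishes\<close>).
  The vanishing of the even modes is the antiperiodicity of \<open>u\<close>.

  The decaying solutions fix the ratio of \<open>U'\<close> and \<open>U\<close> at \<open>x = 0\<close>. Under the resonance conditions
  this ratio is \<open>\<plusminus> l sqrt a\<close>, with exactly the signs that a time shift produces. Altogether the
  boundary condition becomes the delay equation \<open>f (G' t) = sqrt a * G (t + 2 h)\<close> for the continuous
  representative \<open>G\<close> of the trace, where \<open>2 h\<close> is the travel time through an \<open>a\<close>-layer
  (\<open>boundary_function\<close>). The equation gives \<open>G'\<close> as the image of a Lipschitz function under the
  \<open>r\<close>-Hoelder function \<open>inv f\<close>; this is the whole gain of regularity.

  Finally \<open>u\<close> is written down. With the travel time \<open>s x\<close> measured from the first interface, and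
  with \<open>n1 x\<close> counting periods, the function
  \<open>v(x,t) = \<kappa>\<^bsup>n1 x\<^esup> (Q (t + s x) - Q (t - s x))\<close> with \<open>Q t = \<kappa> / 2 * (G (t + h) - G (t - h))\<close>
  has the same modes as \<open>u\<close> (\<open>u_eq_v_on_cylinder\<close>), and Fourier coefficients determine a function.
  Regularity, transport equation, boundary condition and exponential decay are read off from this
  formula: the amplitude \<open>\<kappa>\<^bsup>n1 x\<^esup>\<close> jumps only where the bracket vanishes, since by antiperiodicity
  \<open>Q (t + s)\<close> and \<open>Q (t - s)\<close> agree up to sign at the interfaces.\<close>

section \<open>Smooth functions and test functions\<close>

text \<open>Smoothness is proved coinductively: every member of a class of functions that is closed under
  differentiation is smooth. The closure properties below differ in the choice of the class.\<close>
lemma smooth_line_coinduct: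
  assumes "f \<in> S" and step: "\<And>g. g \<in> S \<Longrightarrow> \<exists>g'\<in>S. \<forall>t. (g has_real_derivative g' t) (at t)"
  shows "smooth_line f"
proof -
  have "(deriv ^^ i) f \<in> S" for i
  proof (induction i)
    case (Suc i)
    then obtain g' where "g' \<in> S" "\<forall>t. ((deriv ^^ i) f has_real_derivative g' t) (at t)"
      using step by blast
    moreover from this have "deriv ((deriv ^^ i) f) = g'"
      using DERIV_imp_deriv by blast
    ultimately show ?case by simp
  qed (use assms in simp)
  then show ?thesis
    unfolding smooth_line_def using step real_differentiable_def by blast
qed

lemma smooth_line_deriv:
  assumes "smooth_line f" shows "smooth_line (deriv f)"
proof -
  have "((deriv ^^ i) (deriv f)) differentiable (at t)" for i t
    using assms unfolding smooth_line_def by (metis comp_apply funpow_Suc_right)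
  then show ?thesis by (simp add: smooth_line_def)
qed

lemma smooth_line_has_deriv:
  assumes "smooth_line f" shows "(f has_real_derivative deriv f t) (at t)"
proof -
  have "((deriv ^^ 0) f) differentiable (at t)" using assms unfolding smooth_line_def by blast
  then show ?thesis by (simp add: DERIV_deriv_iff_real_differentiable)
qed

lemma smooth_line_continuous:
  assumes "smooth_line f" shows "continuous_on S f"
  by (meson DERIV_continuous_on assms has_field_derivative_at_within smooth_line_has_deriv)

text \<open>The Leibniz rule leads out of the set of products, but not out of the set of sums of products.\<close>
inductive_set product_sums :: "(real \<Rightarrow> real) set" where
  prod: "smooth_line f \<Longrightarrow> smooth_line g \<Longrightarrow> (\<lambda>x. f x * g x) \<in> product_sums"
| add: "f \<in> product_sums \<Longrightarrow> g \<in> product_sums \<Longrightarrow> (\<lambda>x. f x + g x) \<in> product_sums"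

lemma smooth_line_mult:
  assumes "smooth_line f" "smooth_line g" shows "smooth_line (\<lambda>x. f x * g x)"
proof (rule smooth_line_coinduct)
  show "(\<lambda>x. f x * g x) \<in> product_sums" using assms by (rule product_sums.prod)
next
  fix h assume "h \<in> product_sums"
  then show "\<exists>h'\<in>product_sums. \<forall>t. (h has_real_derivative h' t) (at t)"
  proof induction
    case (prod f g)
    have "(\<lambda>x. deriv f x * g x + f x * deriv g x) \<in> product_sums"
      by (intro product_sums.intros prod smooth_line_deriv)
    moreover have "((\<lambda>x. f x * g x) has_real_derivative deriv f t * g t + f t * deriv g t) (at t)" for t
      using DERIV_mult[OF smooth_line_has_deriv[OF prod(1)] smooth_line_has_deriv[OF prod(2)]]
      by (simp add: algebra_simps)
    ultimately show ?case by (intro bexI[of _ "\<lambda>x. deriv f x * g x + f x * deriv g x"]) auto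
  next
    case (add f g)
    then obtain f' g' where "f' \<in> product_sums" "g' \<in> product_sums"
      "\<forall>t. (f has_real_derivative f' t) (at t)" "\<forall>t. (g has_real_derivative g' t) (at t)" by blast
    then show ?case
      by (intro bexI[of _ "\<lambda>x. f' x + g' x"] allI DERIV_add product_sums.add) auto
  qed
qed

lemma smooth_line_add:
  assumes "smooth_line f" "smooth_line g" shows "smooth_line (\<lambda>x. f x + g x)"
proof (rule smooth_line_coinduct[where S = "{\<lambda>x. f x + g x | f g. smooth_line f \<and> smooth_line g}"])
  fix h assume "h \<in> {\<lambda>x. f x + g x | f g. smooth_line f \<and> smooth_line g}"
  then obtain f g where h: "h = (\<lambda>x. f x + g x)" and fg: "smooth_line f" "smooth_line g" by blast
  then show "\<exists>h'\<in>{\<lambda>x. f x + g x | f g. smooth_line f \<and> smooth_line g}. \<forall>t. (h has_real_derivative h' t) (at t)"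
    by (intro bexI[of _ "\<lambda>x. deriv f x + deriv g x"] allI)
      (auto intro!: DERIV_add smooth_line_has_deriv smooth_line_deriv)
qed (use assms in blast)

lemma smooth_line_affine:
  assumes "smooth_line f" shows "smooth_line (\<lambda>x. c * f (m * x + d))"
proof (rule smooth_line_coinduct[where S = "{\<lambda>x. c * g (m * x + d) | c g. smooth_line g}"])
  show "(\<lambda>x. c * f (m * x + d)) \<in> {\<lambda>x. c * g (m * x + d) | c g. smooth_line g}"
    using assms by blast
next
  fix h assume "h \<in> {\<lambda>x. c * g (m * x + d) | c g. smooth_line g}"
  then obtain c g where h: "h = (\<lambda>x. c * g (m * x + d))" and g: "smooth_line g" by blast
  have "(h has_real_derivative (c * m) * deriv g (m * t + d)) (at t)" for t
    unfolding h
    by (rule derivative_eq_intros DERIV_chain2[OF smooth_line_has_deriv[OF g]] | simp)+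
  moreover have "(\<lambda>x. (c * m) * deriv g (m * x + d)) \<in> {\<lambda>x. c * g (m * x + d) | c g. smooth_line g}"
    using smooth_line_deriv[OF g] by blast
  ultimately show "\<exists>h'\<in>{\<lambda>x. c * g (m * x + d) | c g. smooth_line g}. \<forall>t. (h has_real_derivative h' t) (at t)"
    by (intro bexI[of _ "\<lambda>x. (c * m) * deriv g (m * x + d)"] allI)
qed

lemma smooth_line_antideriv:
  assumes "\<And>t. (F has_real_derivative f t) (at t)" "smooth_line f" shows "smooth_line F"
proof (rule smooth_line_coinduct[where S = "insert F {g. smooth_line g}"])
  show "\<exists>g'\<in>insert F {g. smooth_line g}. \<forall>t. (g has_real_derivative g' t) (at t)"
    if "g \<in> insert F {g. smooth_line g}" for g
    using that assms smooth_line_deriv smooth_line_has_deriv by blast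
qed simp

lemma smooth_line_cos: "smooth_line (\<lambda>t. c * cos (l * t + \<alpha>))"
proof (rule smooth_line_coinduct[where S = "{\<lambda>t. c * cos (l * t + \<alpha>) | c \<alpha>. True}"])
  fix g assume "g \<in> {\<lambda>t. c * cos (l * t + \<alpha>) | c \<alpha>. True}"
  then obtain c \<alpha> where g: "g = (\<lambda>t. c * cos (l * t + \<alpha>))" by blast
  have "(g has_real_derivative (c * l) * cos (l * t + (\<alpha> + pi / 2))) (at t)" for t
    unfolding g by (auto intro!: derivative_eq_intros simp: cos_add sin_add algebra_simps)
  then show "\<exists>g'\<in>{\<lambda>t. c * cos (l * t + \<alpha>) | c \<alpha>. True}. \<forall>t. (g has_real_derivative g' t) (at t)"
    by (intro bexI[of _ "\<lambda>t. (c * l) * cos (l * t + (\<alpha> + pi / 2))"] allI) blast+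
qed auto

text \<open>The classical smooth function that is flat at \<open>0\<close> without being analytic there.\<close>
definition bump_edge :: "real \<Rightarrow> real" where
  "bump_edge x = (if x > 0 then exp (- (1 / x)) else 0)"

lemma poly_exp_decay: "((\<lambda>y. poly p y * exp (- y)) \<longlongrightarrow> (0::real)) at_top"
proof -
  have "((\<lambda>y. \<Sum>i\<le>degree p. coeff p i * (y ^ i / exp y)) \<longlongrightarrow> (\<Sum>i\<le>degree p. coeff p i * 0)) at_top"
    by (intro tendsto_intros tendsto_power_div_exp_0)
  then show ?thesis
    by (simp add: poly_altdef sum_distrib_right sum_divide_distrib exp_minus divide_inverse mult.assoc)
qed

lemma poly_bump_tendsto:
  "((\<lambda>x. if x > 0 then poly p (1 / x) * exp (- (1 / x)) else 0) \<longlongrightarrow> (0::real)) (at 0)"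
proof -
  have "((\<lambda>x. if x > 0 then poly p (1 / x) * exp (- (1 / x)) else 0) \<longlongrightarrow> (0::real)) (at_right 0)"
  proof (rule tendsto_cong[THEN iffD2])
    show "\<forall>\<^sub>F x in at_right 0. (if x > 0 then poly p (1 / x) * exp (- (1 / x)) else 0)
       = (\<lambda>y. poly p y * exp (- y)) (inverse x)"
      by (auto simp: eventually_at_filter inverse_eq_divide)
    show "((\<lambda>x. (\<lambda>y. poly p y * exp (- y)) (inverse x)) \<longlongrightarrow> 0) (at_right 0)"
      by (rule filterlim_compose[OF poly_exp_decay filterlim_inverse_at_top_right])
  qed
  moreover have "((\<lambda>x. if x > 0 then poly p (1 / x) * exp (- (1 / x)) else 0) \<longlongrightarrow> (0::real)) (at_left 0)"
    by (rule tendsto_eventually) (auto simp: eventually_at_filter)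
  ultimately show ?thesis by (simp add: filterlim_split_at)
qed

text \<open>All derivatives have the form \<open>p (1 / x) exp (- 1 / x)\<close> with a polynomial \<open>p\<close>. At \<open>0\<close> the
  exponential beats every such polynomial, so this class is closed under differentiation.\<close>
lemma smooth_bump_edge: "smooth_line bump_edge"
proof (rule smooth_line_coinduct)
  let ?B = "\<lambda>p x. if x > 0 then poly p (1 / x) * exp (- (1 / x)) else (0::real)"
  show "bump_edge \<in> range ?B"
    by (rule image_eqI[of _ _ "[:1:]"]) (auto simp: bump_edge_def)
  fix g assume "g \<in> range ?B"
  then obtain p where g: "g = ?B p" by blast
  let ?q = "[:0, 0, 1:] * (p - pderiv p)"
  have "(g has_real_derivative ?B ?q t) (at t)" for t
  proof (cases t "0::real" rule: linorder_cases)
    case greater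
    have "((\<lambda>x. poly p (1 / x) * exp (- (1 / x))) has_real_derivative ?B ?q t) (at t)"
      using greater
      by (auto intro!: derivative_eq_intros DERIV_chain2[OF poly_DERIV]
          simp: power2_eq_square field_simps)
    then show ?thesis unfolding g
      by (rule has_field_derivative_transform_within_open[where S = "{0<..}"]) (use greater in auto)
  next
    case less
    have "((\<lambda>x. 0) has_real_derivative ?B ?q t) (at t)" using less by simp
    then show ?thesis unfolding g
      by (rule has_field_derivative_transform_within_open[where S = "{..<0}"]) (use less in auto)
  next
    case equal
    have "((\<lambda>x. ?B (pCons 0 p) x) \<longlongrightarrow> 0) (at 0)" by (rule poly_bump_tendsto)
    then have "((\<lambda>x. (g x - g 0) / (x - 0)) \<longlongrightarrow> 0) (at 0)"
      by (rule Lim_transform_eventually) (auto simp: eventually_at_filter g)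
    then show ?thesis using equal by (simp add: has_field_derivative_iff)
  qed
  then show "\<exists>g'\<in>range ?B. \<forall>t. (g has_real_derivative g' t) (at t)"
    by (intro bexI[of _ "?B ?q"] allI) (auto intro: image_eqI)
qed

definition test_line :: "(real \<Rightarrow> real) \<Rightarrow> bool" where
  "test_line \<zeta> \<longleftrightarrow> smooth_line \<zeta> \<and> (\<exists>R. \<forall>x. \<bar>x\<bar> > R \<longrightarrow> \<zeta> x = 0)"

text \<open>Positive exactly on \<open>(a, b)\<close>, and increasing to the indicator of \<open>(a, b)\<close> as \<open>n\<close> grows.\<close>
definition bump :: "real \<Rightarrow> real \<Rightarrow> real \<Rightarrow> real \<Rightarrow> real" where
  "bump n a b x = bump_edge (n * (x - a)) * bump_edge (n * (b - x))"

lemma bump_edge_bounds: "0 \<le> bump_edge x" "bump_edge x \<le> 1"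
  by (auto simp: bump_edge_def)

lemma bump_bounds: "0 \<le> bump n a b x" "bump n a b x \<le> 1"
  using bump_edge_bounds by (auto simp: bump_def intro: mult_le_one)

lemma smooth_bump: "smooth_line (bump n a b)"
proof -
  have "smooth_line (\<lambda>x. (1 * bump_edge (n * x + (- n * a))) * (1 * bump_edge ((-n) * x + n * b)))"
    by (intro smooth_line_mult smooth_line_affine smooth_bump_edge)
  then show ?thesis by (simp add: bump_def[abs_def] algebra_simps)
qed

lemma bump_outside: "n > 0 \<Longrightarrow> x \<notin> {a<..<b} \<Longrightarrow> bump n a b x = 0"
  by (auto simp: bump_def bump_edge_def zero_less_mult_iff)

lemma bump_inside: "n > 0 \<Longrightarrow> x \<in> {a<..<b} \<Longrightarrow> bump n a b x > 0"
  by (auto simp: bump_def bump_edge_def zero_less_mult_iff)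

lemma bump_test: "n > 0 \<Longrightarrow> test_line (bump n a b)"
  unfolding test_line_def
  by (intro conjI smooth_bump exI[of _ "\<bar>a\<bar> + \<bar>b\<bar>"] allI impI bump_outside) auto

lemma bump_tendsto_indicator:
  "(\<lambda>n. bump (real (Suc n)) a b x) \<longlonglongrightarrow> indicator {a<..<b} x"
proof (cases "x \<in> {a<..<b}")
  case True
  have inv: "(\<lambda>n. 1 / (real (Suc n) * y)) \<longlonglongrightarrow> 0" if "y > 0" for y :: real
  proof -
    have "(\<lambda>n. inverse y * inverse (real (Suc n))) \<longlonglongrightarrow> inverse y * 0"
      by (intro tendsto_intros LIMSEQ_inverse_real_of_nat)
    then show ?thesis by (simp add: field_simps)
  qed
  have "(\<lambda>n. exp (- (1 / (real (Suc n) * (x - a)))) * exp (- (1 / (real (Suc n) * (b - x))))) \<longlonglongrightarrow> exp (- 0) * exp (- 0)"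
    using True by (intro tendsto_intros inv) auto
  moreover have "bump (real (Suc n)) a b x = exp (- (1 / (real (Suc n) * (x - a)))) * exp (- (1 / (real (Suc n) * (b - x))))" for n
    unfolding bump_def bump_edge_def using True by (simp add: zero_less_mult_iff)
  ultimately show ?thesis using True by simp
qed (simp add: bump_outside)

lemma test_line_bounds:
  assumes "test_line \<zeta>"
  obtains R M0 M1 where "\<And>x. \<bar>x\<bar> > R \<Longrightarrow> \<zeta> x = 0" "\<And>x. \<bar>x\<bar> > R \<Longrightarrow> deriv \<zeta> x = 0"
    "\<And>x. \<bar>deriv \<zeta> x\<bar> \<le> M0" "\<And>x. \<bar>\<zeta> x\<bar> \<le> M1"
proof -
  have sm: "smooth_line \<zeta>" using assms by (simp add: test_line_def)
  obtain R where R: "\<And>x. \<bar>x\<bar> > R \<Longrightarrow> \<zeta> x = 0" using assms unfolding test_line_def by blast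
  have R': "deriv \<zeta> x = 0" if "\<bar>x\<bar> > R" for x
  proof (rule DERIV_imp_deriv, rule has_field_derivative_transform_within_open[where S = "{y. \<bar>y\<bar> > R}"])
    show "((\<lambda>y. 0) has_real_derivative 0) (at x)" by simp
  qed (use that R in \<open>auto intro!: open_Collect_less continuous_intros\<close>)
  have bdd: "\<exists>M. \<forall>x. \<bar>z x\<bar> \<le> M" if c: "continuous_on UNIV z" and s: "\<And>x. \<bar>x\<bar> > R \<Longrightarrow> z x = 0" for z :: "real \<Rightarrow> real"
  proof -
    obtain M where M: "\<And>x. x \<in> {-R..R} \<Longrightarrow> \<bar>z x\<bar> \<le> M"
      using compact_imp_bounded[OF compact_continuous_image[OF continuous_on_subset[OF c] compact_Icc]]
      by (fastforce simp: bounded_iff)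
    have "\<bar>z x\<bar> \<le> max M 0" for x using M[of x] s[of x] by (cases "\<bar>x\<bar> > R") force+
    then show ?thesis by blast
  qed
  obtain M0 M1 where "\<And>x. \<bar>deriv \<zeta> x\<bar> \<le> M0" "\<And>x. \<bar>\<zeta> x\<bar> \<le> M1"
    using bdd[OF smooth_line_continuous[OF sm] R] bdd[OF smooth_line_continuous[OF smooth_line_deriv[OF sm]] R'] by blast
  with R R' show ?thesis by (intro that)
qed

lemma pdx_tensor:
  assumes "smooth_line \<zeta>"
  shows "pdx (\<lambda>p. \<zeta> (fst p) * \<eta> (snd p)) = (\<lambda>p. deriv \<zeta> (fst p) * \<eta> (snd p))"
proof -
  have "deriv (\<lambda>y. \<zeta> y * \<eta> t) x = deriv \<zeta> x * \<eta> t" for x t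
    by (intro DERIV_imp_deriv DERIV_cmult_right smooth_line_has_deriv assms)
  then show ?thesis by (auto simp: pdx_def)
qed

lemma pdt_tensor:
  assumes "smooth_line \<eta>"
  shows "pdt (\<lambda>p. \<zeta> (fst p) * \<eta> (snd p)) = (\<lambda>p. \<zeta> (fst p) * deriv \<eta> (snd p))"
proof -
  have "deriv (\<lambda>s. \<zeta> x * \<eta> s) t = \<zeta> x * deriv \<eta> t" for x t
    by (intro DERIV_imp_deriv DERIV_cmult smooth_line_has_deriv assms)
  then show ?thesis by (auto simp: pdt_def)
qed

lemma smooth_line_funpow: "smooth_line f \<Longrightarrow> smooth_line ((deriv ^^ i) f)"
  by (induction i) (auto intro: smooth_line_deriv)

text \<open>Products of a function of \<open>x\<close> and a function of \<open>t\<close> are the only test functions that are used: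
  with a trigonometric factor in \<open>t\<close> they reduce the problem to ordinary differential equations
  in \<open>x\<close>.\<close>
lemma smooth_plane_tensor:
  assumes "smooth_line \<zeta>" "smooth_line \<eta>"
  shows "smooth_plane (\<lambda>p. \<zeta> (fst p) * \<eta> (snd p))"
proof -
  have t: "(pdt ^^ j) (\<lambda>p. \<zeta> (fst p) * \<eta> (snd p)) = (\<lambda>p. \<zeta> (fst p) * (deriv ^^ j) \<eta> (snd p))" for j
    by (induction j) (use assms smooth_line_funpow in \<open>auto simp: pdt_tensor\<close>)
  have x: "(pdx ^^ i) (\<lambda>p. \<zeta> (fst p) * \<xi> (snd p)) = (\<lambda>p. (deriv ^^ i) \<zeta> (fst p) * \<xi> (snd p))" for i \<xi>
    by (induction i) (use assms smooth_line_funpow in \<open>auto simp: pdx_tensor\<close>)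
  have d: "(\<lambda>p. f (fst p) * g (snd p)) differentiable (at p)"
    if "smooth_line f" "smooth_line g" for f g :: "real \<Rightarrow> real" and p :: "real \<times> real"
  proof -
    have "(\<lambda>p. f (fst p)) differentiable (at p)" "(\<lambda>p. g (snd p)) differentiable (at p)"
      using that[THEN smooth_line_has_deriv, THEN DERIV_deriv_iff_real_differentiable[THEN iffD1]]
      by (auto intro!: differentiable_compose[of f fst p] differentiable_compose[of g snd p]
          bounded_linear_imp_differentiable[OF bounded_linear_fst] bounded_linear_imp_differentiable[OF bounded_linear_snd])
    then show ?thesis by (rule differentiable_mult)
  qed
  show ?thesis unfolding smooth_plane_def t x
    by (intro allI d smooth_line_funpow assms)
qed

lemma tensor_test_fun:
  assumes "test_line \<zeta>" "smooth_line \<eta>" "\<And>t. \<eta> (t + T) = \<eta> t"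
  shows "(\<lambda>p. \<zeta> (fst p) * \<eta> (snd p)) \<in> test_fun T"
  using assms unfolding test_fun_def test_line_def
  by (auto intro!: smooth_plane_tensor)

lemma tensor_test_fun_interior:
  assumes "test_line \<zeta>" "smooth_line \<eta>" "\<And>t. \<eta> (t + T) = \<eta> t" "\<epsilon> > 0" "\<And>x. x < \<epsilon> \<Longrightarrow> \<zeta> x = 0"
  shows "(\<lambda>p. \<zeta> (fst p) * \<eta> (snd p)) \<in> test_fun_interior T"
  using tensor_test_fun[OF assms(1-3)] assms(4,5) unfolding test_fun_interior_def by auto

section \<open>Integrable functions determined by tests with bumps\<close>

text \<open>The open intervals form an intersection-stable generator of the Borel sets, so the integral of
  \<open>D\<close> vanishes over every Borel set.\<close>
lemma AE_zero_if_interval_integrals_zero: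
  fixes D :: "real \<Rightarrow> real"
  assumes int: "set_integrable lborel {c<..<d} D"
    and zero: "\<And>a b. c \<le> a \<Longrightarrow> a < b \<Longrightarrow> b \<le> d \<Longrightarrow> (LINT x:{a<..<b}|lborel. D x) = 0"
  shows "AE x in lborel. x \<in> {c<..<d} \<longrightarrow> D x = 0"
proof -
  define f where "f x = indicator {c<..<d} x *\<^sub>R D x" for x
  have f: "integrable lborel f" using int by (simp add: set_integrable_def f_def[abs_def])
  have fA: "set_integrable lborel A f" if "A \<in> sets borel" for A
    using f that by (simp add: set_integrable_def integrable_mult_indicator del: real_scaleR_def)
  have basic: "(LINT x:{a<..<b}|lborel. f x) = 0" for a b
  proof -
    have "(LINT x:{a<..<b}|lborel. f x) = (LINT x:{max a c<..<min b d}|lborel. D x)"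
      unfolding set_lebesgue_integral_def f_def
      by (rule Bochner_Integration.integral_cong) (auto simp: indicator_def)
    also have "\<dots> = 0"
      by (cases "max a c < min b d") (use zero in \<open>auto simp: set_lebesgue_integral_def\<close>)
    finally show ?thesis .
  qed
  have "(LINT x|lborel. f x) = (LINT x:{c<..<d}|lborel. f x)"
    unfolding set_lebesgue_integral_def
    by (rule Bochner_Integration.integral_cong) (auto simp: f_def indicator_def)
  then have tot: "(LINT x|lborel. f x) = 0" by (simp add: basic)
  let ?G = "range (\<lambda>(a, b). {a<..<b::real})"
  have G: "?G = range (\<lambda>(a, b). box a b)" by (auto simp: box_real)
  have "(LINT x:A|lborel. f x) = 0" if "A \<in> sets borel" for A
  proof -
    have A: "A \<in> sigma_sets UNIV ?G"
      using that unfolding G by (subst (asm) borel_eq_box) simp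
    have meas: "B \<in> sets borel" if "B \<in> sigma_sets UNIV ?G" for B
      using that unfolding G by (subst borel_eq_box) simp
    have "Int_stable ?G"
      by (auto simp: Int_stable_def intro!: image_eqI[of _ _ "(max _ _, min _ _)"])
    moreover have "?G \<subseteq> Pow UNIV" by simp
    ultimately show ?thesis using A
    proof (induction rule: sigma_sets_induct_disjoint)
      case (basic A) then show ?case using \<open>\<And>a b. (LINT x:{a<..<b}|lborel. f x) = 0\<close> by auto
    next
      case empty then show ?case by (simp add: set_lebesgue_integral_def)
    next
      case (compl A)
      have "(LINT x:A|lborel. f x) + (LINT x:UNIV - A|lborel. f x) = (LINT x:A \<union> (UNIV - A)|lborel. f x)"
        using meas[OF compl(1)] by (subst set_integral_Un) (auto intro!: fA)
      then show ?case using compl tot by (simp add: set_lebesgue_integral_def)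
    next
      case (union A)
      have "(LINT x:(\<Union>i. A i)|lborel. f x) = (\<Sum>i. LINT x:A i|lborel. f x)"
        by (rule lebesgue_integral_countable_add)
          (use union meas in \<open>auto simp: disjoint_family_on_def range_subsetD intro!: fA meas sigma_sets.Union\<close>)
      then show ?case using union by simp
    qed
  qed
  then have "AE x in lborel. f x = 0"
    by (intro sigma_finite_measure.density_zero[OF sigma_finite_lborel f]) simp
  then show ?thesis by (rule AE_mp) (auto simp: f_def)
qed

lemma AE_zero_if_bump_integrals_zero:
  fixes K :: "real \<Rightarrow> real"
  assumes int: "set_integrable lborel {c<..<d} K"
    and zero: "\<And>n a b. n > 0 \<Longrightarrow> c \<le> a \<Longrightarrow> a < b \<Longrightarrow> b \<le> d \<Longrightarrow>
       (LINT x:{c<..<d}|lborel. K x * bump n a b x) = 0"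
  shows "AE x in lborel. x \<in> {c<..<d} \<longrightarrow> K x = 0"
proof (rule AE_zero_if_interval_integrals_zero[OF int])
  fix a b assume ab: "c \<le> a" "a < b" "b \<le> d"
  have "(\<lambda>n. LINT x|lborel. indicator {c<..<d} x *\<^sub>R (K x * bump (real (Suc n)) a b x))
      \<longlonglongrightarrow> (LINT x|lborel. indicator {a<..<b} x *\<^sub>R K x)"
  proof (rule integral_dominated_convergence)
    have m: "(\<lambda>x. indicator {c<..<d} x *\<^sub>R K x) \<in> borel_measurable lborel"
      using int by (simp add: set_integrable_def borel_measurable_integrable)
    have ind: "indicator {a<..<b} x *\<^sub>R K x = indicator {a<..<b} x *\<^sub>R (indicator {c<..<d} x *\<^sub>R K x)" for x
      using ab by (auto simp: indicator_def)
    show "(\<lambda>x. indicator {a<..<b} x *\<^sub>R K x) \<in> borel_measurable lborel"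
      unfolding ind by (intro borel_measurable_scaleR m) simp
    have "bump n a b \<in> borel_measurable borel" for n
      by (intro borel_measurable_continuous_onI smooth_line_continuous smooth_bump)
    then show "(\<lambda>x. indicator {c<..<d} x *\<^sub>R (K x * bump (real (Suc i)) a b x)) \<in> borel_measurable lborel" for i
      using borel_measurable_times[OF m, of "bump (real (Suc i)) a b"] by (simp add: mult.assoc)
    show "integrable lborel (\<lambda>x. \<bar>indicator {c<..<d} x *\<^sub>R K x\<bar>)"
      using int unfolding set_integrable_def by (rule integrable_abs)
    show "AE x in lborel. (\<lambda>i. indicator {c<..<d} x *\<^sub>R (K x * bump (real (Suc i)) a b x)) \<longlonglongrightarrow> indicator {a<..<b} x *\<^sub>R K x"
    proof (rule AE_I2)
      fix x
      have "(\<lambda>i. indicator {c<..<d} x *\<^sub>R (K x * bump (real (Suc i)) a b x)) \<longlonglongrightarrow> indicator {c<..<d} x *\<^sub>R (K x * indicator {a<..<b} x)"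
        by (intro tendsto_intros bump_tendsto_indicator)
      also have "indicator {c<..<d} x *\<^sub>R (K x * indicator {a<..<b} x) = indicator {a<..<b} x *\<^sub>R K x"
        using ab by (auto simp: indicator_def)
      finally show "(\<lambda>i. indicator {c<..<d} x *\<^sub>R (K x * bump (real (Suc i)) a b x)) \<longlonglongrightarrow> indicator {a<..<b} x *\<^sub>R K x" .
    qed
    show "AE x in lborel. norm (indicator {c<..<d} x *\<^sub>R (K x * bump (real (Suc i)) a b x))
        \<le> \<bar>indicator {c<..<d} x *\<^sub>R K x\<bar>" for i
      by (rule AE_I2) (auto simp: indicator_def abs_mult bump_bounds mult_left_le)
  qed
  moreover have "(LINT x|lborel. indicator {c<..<d} x *\<^sub>R (K x * bump (real (Suc n)) a b x)) = 0" for n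
    using zero[of "real (Suc n)" a b] ab by (simp add: set_lebesgue_integral_def)
  ultimately show "(LINT x:{a<..<b}|lborel. K x) = 0"
    unfolding set_lebesgue_integral_def by (simp only: LIMSEQ_const_iff)
qed

lemma primitive_continuous:
  fixes B :: "real \<Rightarrow> real"
  assumes "set_integrable lborel {c..d} B"
  shows "continuous_on {c..d} (\<lambda>x. LINT y:{c..x}|lborel. B y)"
proof -
  have "B integrable_on {c..d}" using assms set_borel_integral_eq_integral(1) by blast
  then have "continuous_on {c..d} (\<lambda>x. integral {c..x} B)" by (rule indefinite_integral_continuous_1)
  moreover have "integral {c..x} B = (LINT y:{c..x}|lborel. B y)" if "x \<in> {c..d}" for x
    using that by (intro set_borel_integral_eq_integral(2)[symmetric] set_integrable_subset[OF assms]) auto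
  ultimately show ?thesis by (rule continuous_on_eq)
qed

lemma set_integrable_continuous_mult:
  fixes B :: "real \<Rightarrow> real"
  assumes B: "set_integrable lborel {c..d} B" and g: "continuous_on {c..d} g"
  shows "set_integrable lborel {c..d} (\<lambda>x. B x * g x)"
proof -
  obtain M where M: "\<And>x. x \<in> {c..d} \<Longrightarrow> \<bar>g x\<bar> \<le> M"
    using compact_imp_bounded[OF compact_continuous_image[OF g compact_Icc]]
    by (fastforce simp: bounded_iff)
  have "set_integrable lborel {c..d} (\<lambda>x. B x * M)" using B by simp
  moreover have "set_borel_measurable lborel {c..d} (\<lambda>x. B x * g x)"
  proof -
    have 1: "(\<lambda>x. indicator {c..d} x *\<^sub>R B x) \<in> borel_measurable lborel"
      using B unfolding set_integrable_def by (rule borel_measurable_integrable)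
    have 2: "(\<lambda>x. indicator {c..d} x *\<^sub>R g x) \<in> borel_measurable lborel"
      using borel_measurable_continuous_on_indicator[OF _ g] by simp
    show ?thesis unfolding set_borel_measurable_def
      by (rule measurable_cong[THEN iffD1, OF _ borel_measurable_times[OF 1 2]]) (auto simp: indicator_def)
  qed
  ultimately show ?thesis
  proof (rule set_integrable_bound)
    show "AE x in lborel. x \<in> {c..d} \<longrightarrow> norm (B x * g x) \<le> norm (B x * M)"
      using M by (intro AE_I2) (auto simp: abs_mult intro!: mult_left_mono order_trans[OF M])
  qed
qed

text \<open>Since \<open>B\<close> is merely integrable, its primitive need not be differentiable everywhere, and the
  formula is proved by Fubini's theorem on the triangle \<open>c \<le> y \<le> x \<le> d\<close> instead of the product
  rule.\<close>
lemma integral_by_parts_primitive: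
  fixes B \<zeta> \<zeta>' :: "real \<Rightarrow> real"
  assumes cd: "c \<le> d" and B: "set_integrable lborel {c..d} B"
    and d: "\<And>x. (\<zeta> has_real_derivative \<zeta>' x) (at x)" and c: "continuous_on UNIV \<zeta>'"
  shows "(LINT x:{c..d}|lborel. (LINT y:{c..x}|lborel. B y) * \<zeta>' x)
     = \<zeta> d * (LINT y:{c..d}|lborel. B y) - (LINT y:{c..d}|lborel. B y * \<zeta> y)"
proof -
  define b where "b y = indicator {c..d} y *\<^sub>R B y" for y
  define z where "z x = indicator {c..d} x *\<^sub>R \<zeta>' x" for x
  define F where "F x y = (if y \<le> x then z x * b y else 0)" for x y
  have bi: "integrable lborel b" using B by (simp add: b_def[abs_def] set_integrable_def)
  have zi: "integrable lborel z"
    using borel_integrable_atLeastAtMost'[OF continuous_on_subset[OF c]]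
    by (simp add: z_def[abs_def] set_integrable_def)
  have [measurable]: "b \<in> borel_measurable borel" "z \<in> borel_measurable borel"
    using bi zi by (auto dest: borel_measurable_integrable)
  have meas: "case_prod F \<in> borel_measurable (lborel \<Otimes>\<^sub>M lborel)"
    unfolding F_def by measurable
  have int: "integrable (lborel \<Otimes>\<^sub>M lborel) (case_prod F)"
  proof (rule lborel_pair.Fubini_integrable[OF meas])
    have Fx: "integrable lborel (F x)" for x
      unfolding F_def by (rule Bochner_Integration.integrable_bound[of _ "\<lambda>y. z x * b y"]) (use bi in auto)
    then show "AE x in lborel. integrable lborel (\<lambda>y. case_prod F (x, y))" by simp
    show "integrable lborel (\<lambda>x. LINT y|lborel. norm (case_prod F (x, y)))"
    proof (rule Bochner_Integration.integrable_bound[of _ "\<lambda>x. \<bar>z x\<bar> * (LINT y|lborel. \<bar>b y\<bar>)"])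
      show "integrable lborel (\<lambda>x. \<bar>z x\<bar> * (LINT y|lborel. \<bar>b y\<bar>))"
        using zi by auto
      show "(\<lambda>x. LINT y|lborel. norm (case_prod F (x, y))) \<in> borel_measurable lborel"
        using meas by measurable
      show "AE x in lborel. norm (LINT y|lborel. norm (case_prod F (x, y))) \<le> norm (\<bar>z x\<bar> * (LINT y|lborel. \<bar>b y\<bar>))"
      proof (rule AE_I2)
        fix x
        have "(LINT y|lborel. \<bar>F x y\<bar>) \<le> (LINT y|lborel. \<bar>z x\<bar> * \<bar>b y\<bar>)"
          by (intro integral_mono integrable_abs Fx integrable_mult_right bi) (auto simp: F_def abs_mult)
        then show "norm (LINT y|lborel. norm (case_prod F (x, y))) \<le> norm (\<bar>z x\<bar> * (LINT y|lborel. \<bar>b y\<bar>))"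
          by (simp add: abs_mult)
      qed
    qed
  qed
  have Fy: "(LINT y|lborel. F x y) = indicator {c..d} x *\<^sub>R ((LINT y:{c..x}|lborel. B y) * \<zeta>' x)" for x
  proof -
    have "(LINT y|lborel. F x y) = (LINT y|lborel. (indicator {c..x} y *\<^sub>R B y) * z x)"
      by (rule Bochner_Integration.integral_cong) (auto simp: F_def b_def z_def indicator_def)
    then show ?thesis by (simp add: set_lebesgue_integral_def z_def)
  qed
  have Fx: "(LINT x|lborel. F x y) = indicator {c..d} y *\<^sub>R (\<zeta> d * B y - B y * \<zeta> y)" for y
  proof (cases "y \<in> {c..d}")
    case True
    have "(LINT x|lborel. F x y) = (LINT x|lborel. B y * (indicator {y..d} x *\<^sub>R \<zeta>' x))"
      using True by (intro Bochner_Integration.integral_cong) (auto simp: F_def b_def z_def indicator_def)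
    also have "\<dots> = B y * (LINT x:{y..d}|lborel. \<zeta>' x)" by (simp add: set_lebesgue_integral_def)
    also have "(LINT x:{y..d}|lborel. \<zeta>' x) = integral {y..d} \<zeta>'"
      by (intro set_borel_integral_eq_integral(2) borel_integrable_atLeastAtMost' continuous_on_subset[OF c]) auto
    also have "(\<zeta>' has_integral (\<zeta> d - \<zeta> y)) {y..d}"
      using True by (intro fundamental_theorem_of_calculus)
        (auto intro!: has_vector_derivative_at_within d[unfolded has_real_derivative_iff_has_vector_derivative])
    then have "integral {y..d} \<zeta>' = \<zeta> d - \<zeta> y" by (rule integral_unique)
    finally show ?thesis using True by (simp add: algebra_simps)
  next
    case False
    then have "F x y = 0" for x by (auto simp: F_def b_def)
    then show ?thesis using False by simp
  qed
  have "(LINT x:{c..d}|lborel. (LINT y:{c..x}|lborel. B y) * \<zeta>' x) = (LINT x|lborel. LINT y|lborel. F x y)"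
    by (simp only: Fy set_lebesgue_integral_def)
  also have "\<dots> = (LINT y|lborel. LINT x|lborel. F x y)"
    by (rule lborel_pair.Fubini_integral[OF int, symmetric])
  also have "\<dots> = (LINT y|lborel. indicator {c..d} y *\<^sub>R (\<zeta> d * B y - B y * \<zeta> y))"
    by (simp only: Fx)
  also have "(LINT y|lborel. indicator {c..d} y *\<^sub>R (\<zeta> d * B y - B y * \<zeta> y))
     = \<zeta> d * (LINT y:{c..d}|lborel. B y) - (LINT y:{c..d}|lborel. B y * \<zeta> y)"
  proof -
    have "continuous_on {c..d} \<zeta>"
      by (meson DERIV_continuous_on d has_field_derivative_at_within)
    from set_integrable_continuous_mult[OF B this] B show ?thesis
      by (subst set_lebesgue_integral_def[symmetric], subst set_integral_diff) auto
  qed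
  finally show ?thesis .
qed

lemma exists_antiderivative:
  fixes f :: "real \<Rightarrow> real"
  assumes "continuous_on UNIV f"
  obtains F where "\<And>x. (F has_real_derivative f x) (at x)"
proof -
  have "\<exists>F. \<forall>x::real. -\<infinity> < x \<longrightarrow> x < \<infinity> \<longrightarrow> (F has_vector_derivative f x) (at x)"
    by (rule einterval_antiderivative) (use assms in \<open>auto simp: continuous_on_eq_continuous_at\<close>)
  then show ?thesis using that by (auto simp: has_real_derivative_iff_has_vector_derivative)
qed

lemma primitive_eq_where_zero:
  fixes F f :: "real \<Rightarrow> real"
  assumes "\<And>x. (F has_real_derivative f x) (at x)" "\<And>x. x \<in> {p<..<q} \<Longrightarrow> f x = 0" "p \<le> q"
  shows "F p = F q"
proof (cases "p < q")
  case True
  from MVT2[OF this, of F f] assms show ?thesis by auto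
qed (use assms in auto)

text \<open>On the half-line every bump is the derivative of a test function. Its primitive is made to vanish
  on both sides by subtracting a multiple of a second bump, which is placed at negative arguments and
  therefore does not change the derivative on the half-line.\<close>
lemma test_line_with_derivative:
  assumes n: "n > 0" and ab: "0 \<le> a" "a < b"
  obtains \<zeta> where "test_line \<zeta>" "\<And>x. x \<ge> 0 \<Longrightarrow> deriv \<zeta> x = bump n a b x" "\<And>x. x \<ge> b \<Longrightarrow> \<zeta> x = 0"
proof -
  let ?\<psi> = "bump n a b" and ?\<beta> = "bump 1 (-2) (-1)"
  obtain F where F: "\<And>x. (F has_real_derivative ?\<psi> x) (at x)"
    using exists_antiderivative[OF smooth_line_continuous[OF smooth_bump[of n a b]]] by blast
  obtain G where G: "\<And>x. (G has_real_derivative ?\<beta> x) (at x)"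
    using exists_antiderivative[OF smooth_line_continuous[OF smooth_bump[of 1 "-2" "-1"]]] by blast
  obtain \<xi> where "- 2 < \<xi>" "\<xi> < -1" "G (-1) - G (-2) = (-1 - (-2)) * ?\<beta> \<xi>"
    using MVT2[of "-2" "-1" G ?\<beta>] G by auto
  then have G12: "G (-2) < G (-1)" using bump_inside[of 1 \<xi> "-2" "-1"] by auto
  have G1: "G (-1) = G b"
    by (rule primitive_eq_where_zero[OF G]) (use ab in \<open>auto intro: bump_outside\<close>)
  \<comment> \<open>With this multiple of the second bump the primitive returns to zero at \<open>b\<close>.\<close>
  define m where "m = (F b - F (-2)) / (G b - G (-2))"
  define \<zeta> where "\<zeta> x = (F x - F (-2)) - m * (G x - G (-2))" for x
  have dz: "(\<zeta> has_real_derivative (?\<psi> x - m * ?\<beta> x)) (at x)" for x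
    unfolding \<zeta>_def by (auto intro!: derivative_eq_intros F G)
  have "smooth_line (\<lambda>x. ?\<psi> x + (- m) * ?\<beta> (1 * x + 0))"
    by (intro smooth_line_add smooth_line_affine smooth_bump)
  then have sm: "smooth_line \<zeta>" by (intro smooth_line_antideriv[OF dz]) simp
  have right: "\<zeta> x = 0" if "x \<ge> b" for x
  proof -
    have "\<zeta> b = \<zeta> x"
      by (rule primitive_eq_where_zero[OF dz]) (use that ab n in \<open>auto simp: bump_outside\<close>)
    then show ?thesis using G12 G1 by (simp add: \<zeta>_def m_def)
  qed
  have left: "\<zeta> x = 0" if "x \<le> - 2" for x
  proof -
    have "\<zeta> x = \<zeta> (-2)"
      by (rule primitive_eq_where_zero[OF dz]) (use that ab n in \<open>auto simp: bump_outside\<close>)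
    then show ?thesis by (simp add: \<zeta>_def)
  qed
  show ?thesis
  proof (rule that)
    show "test_line \<zeta>" unfolding test_line_def
      using sm left right by (intro conjI exI[of _ "\<bar>b\<bar> + 2"] allI impI) (auto simp: abs_if split: if_splits)
    show "deriv \<zeta> x = bump n a b x" if "x \<ge> 0" for x
      using DERIV_imp_deriv[OF dz[of x]] that by (simp add: bump_outside)
  qed (rule right)
qed

text \<open>The test functions may be nonzero at \<open>0\<close>, so that the weak equation \<open>A' = B\<close> is recovered
  together with the initial value. The difference \<open>D\<close> of the two sides integrates to zero against
  all derivatives of test functions, hence against all bumps.\<close>
lemma du_Bois_Reymond_half_line:
  fixes A B :: "real \<Rightarrow> real"
  assumes A: "\<And>R. set_integrable lborel {0..R} A" and B: "\<And>R. set_integrable lborel {0..R} B"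
    and weak: "\<And>\<zeta>. test_line \<zeta> \<Longrightarrow>
       (LINT x:{0..}|lborel. A x * deriv \<zeta> x) + (LINT x:{0..}|lborel. B x * \<zeta> x) = - (\<zeta> 0 * m)"
  shows "AE x in lborel. x > 0 \<longrightarrow> A x = m + (LINT y:{0..x}|lborel. B y)"
proof -
  define D where "D x = A x - (m + (LINT y:{0..x}|lborel. B y))" for x
  have prim: "set_integrable lborel {0..R} (\<lambda>x. LINT y:{0..x}|lborel. B y)" for R
    by (intro borel_integrable_atLeastAtMost' primitive_continuous B)
  have D: "set_integrable lborel {0..R} D" for R
    unfolding D_def by (intro set_integral_diff set_integral_add A prim borel_integrable_atLeastAtMost' continuous_intros)
  have "AE x in lborel. x \<in> {0<..<real N} \<longrightarrow> D x = 0" for N :: nat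
  proof (rule AE_zero_if_bump_integrals_zero)
    show "set_integrable lborel {0<..<real N} D"
      by (rule set_integrable_subset[OF D[of "real N"]]) auto
    fix n a b :: real assume n: "n > 0" "0 \<le> a" "a < b" "b \<le> real N"
    obtain \<zeta> where \<zeta>: "test_line \<zeta>" "\<And>x. x \<ge> 0 \<Longrightarrow> deriv \<zeta> x = bump n a b x" "\<And>x. x \<ge> b \<Longrightarrow> \<zeta> x = 0"
      using test_line_with_derivative[OF n(1-3)] by metis
    have sm: "smooth_line \<zeta>" using \<zeta>(1) by (simp add: test_line_def)
    have bc: "continuous_on S (bump n a b)" for S by (intro smooth_line_continuous smooth_bump)
    let ?P = "\<lambda>x. LINT y:{0..x}|lborel. B y"
    have cut: "(LINT x:{0..real N}|lborel. g x) = (LINT x:{0..}|lborel. g x)"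
      if "\<And>x. x > real N \<Longrightarrow> g x = 0" for g :: "real \<Rightarrow> real"
      unfolding set_lebesgue_integral_def
      by (rule Bochner_Integration.integral_cong) (use that in \<open>auto simp: indicator_def\<close>)
    have 1: "(LINT x:{0..real N}|lborel. A x * bump n a b x) = (LINT x:{0..}|lborel. A x * deriv \<zeta> x)"
    proof -
      have "(LINT x:{0..real N}|lborel. A x * bump n a b x) = (LINT x:{0..}|lborel. A x * bump n a b x)"
        by (rule cut) (use n in \<open>simp add: bump_outside\<close>)
      also have "\<dots> = (LINT x:{0..}|lborel. A x * deriv \<zeta> x)"
        by (rule set_lebesgue_integral_cong) (use \<zeta>(2) in auto)
      finally show ?thesis .
    qed
    have 2: "(LINT x:{0..real N}|lborel. B x * \<zeta> x) = (LINT x:{0..}|lborel. B x * \<zeta> x)"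
      by (rule cut) (use n \<zeta>(3) in auto)
    have 3: "(LINT x:{0..real N}|lborel. ?P x * bump n a b x) = - (LINT x:{0..real N}|lborel. B x * \<zeta> x)"
    proof -
      have "(LINT x:{0..real N}|lborel. ?P x * deriv \<zeta> x) = \<zeta> (real N) * ?P (real N) - (LINT x:{0..real N}|lborel. B x * \<zeta> x)"
        by (rule integral_by_parts_primitive[OF _ B])
          (use sm in \<open>auto intro: smooth_line_has_deriv smooth_line_continuous smooth_line_deriv\<close>)
      moreover have "(LINT x:{0..real N}|lborel. ?P x * deriv \<zeta> x) = (LINT x:{0..real N}|lborel. ?P x * bump n a b x)"
        by (rule set_lebesgue_integral_cong) (use \<zeta>(2) in auto)
      ultimately show ?thesis using \<zeta>(3)[of "real N"] n by simp
    qed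
    have 4: "(LINT x:{0..real N}|lborel. bump n a b x) = - \<zeta> 0"
    proof -
      have "(LINT x:{0..real N}|lborel. bump n a b x) = integral {0..real N} (bump n a b)"
        by (intro set_borel_integral_eq_integral(2) borel_integrable_atLeastAtMost' bc)
      also have "(bump n a b has_integral (\<zeta> (real N) - \<zeta> 0)) {0..real N}"
      proof (rule fundamental_theorem_of_calculus)
        fix x assume "x \<in> {0..real N}"
        then show "(\<zeta> has_vector_derivative bump n a b x) (at x within {0..real N})"
          using smooth_line_has_deriv[OF sm, of x] \<zeta>(2)[of x]
          by (auto intro!: has_vector_derivative_at_within simp: has_real_derivative_iff_has_vector_derivative)
      qed simp
      then have "integral {0..real N} (bump n a b) = - \<zeta> 0"
        using \<zeta>(3)[of "real N"] n by (simp add: integral_unique)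
      finally show ?thesis .
    qed
    have "(LINT x:{0<..<real N}|lborel. D x * bump n a b x) = (LINT x:{0..real N}|lborel. D x * bump n a b x)"
      unfolding set_lebesgue_integral_def
      by (rule Bochner_Integration.integral_cong)
        (use n in \<open>auto simp: indicator_def not_less intro!: bump_outside\<close>)
    also have "\<dots> = (LINT x:{0..real N}|lborel. A x * bump n a b x - (m * bump n a b x + ?P x * bump n a b x))"
      by (simp add: D_def algebra_simps)
    also have "\<dots> = (LINT x:{0..real N}|lborel. A x * bump n a b x)
        - (m * (LINT x:{0..real N}|lborel. bump n a b x) + (LINT x:{0..real N}|lborel. ?P x * bump n a b x))"
    proof -
      have i: "set_integrable lborel {0..real N} (\<lambda>x. A x * bump n a b x)"
        "set_integrable lborel {0..real N} (\<lambda>x. ?P x * bump n a b x)"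
        "set_integrable lborel {0..real N} (\<lambda>x. m * bump n a b x)"
        by (rule set_integrable_continuous_mult[OF A bc] set_integrable_continuous_mult[OF prim bc]
            borel_integrable_atLeastAtMost'[OF continuous_on_mult[OF continuous_on_const bc]])+
      show ?thesis using i by (subst set_integral_diff; (subst set_integral_add)?) auto
    qed
    also have "\<dots> = 0" using weak[OF \<zeta>(1)] unfolding 1 2 3 4 by (simp add: algebra_simps)
    finally show "(LINT x:{0<..<real N}|lborel. D x * bump n a b x) = 0" .
  qed
  then have "AE x in lborel. \<forall>N::nat. x \<in> {0<..<real N} \<longrightarrow> D x = 0" by (simp only: AE_all_countable) simp
  then show ?thesis
  proof (rule AE_mp, intro AE_I2 impI)
    fix x :: real assume "\<forall>N::nat. x \<in> {0<..<real N} \<longrightarrow> D x = 0" "x > 0"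
    then show "A x = m + (LINT y:{0..x}|lborel. B y)"
      using reals_Archimedean2[of x] by (auto simp: D_def)
  qed
qed

section \<open>Uniqueness of Fourier coefficients\<close>

lemma set_integral_point: "(LINT y:{c..c}|lborel. F y) = (0::real)" for F :: "real \<Rightarrow> real"
proof -
  have "(LINT y:{c..c}|lborel. F y) = (LINT y::real|lborel. 0)"
    unfolding set_lebesgue_integral_def by (rule integral_discrete_difference[of "{c}"]) (auto simp: indicator_def)
  then show ?thesis by simp
qed

lemma set_integral_Ico_Icc:
  fixes f :: "real \<Rightarrow> real"
  shows "(LINT t:{c..<d}|lborel. f t) = (LINT t:{c..d}|lborel. f t)"
    and "set_integrable lborel {c..<d} f \<longleftrightarrow> set_integrable lborel {c..d} f"
  unfolding set_lebesgue_integral_def set_integrable_def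
  by (rule integral_discrete_difference[of "{d}"] integrable_discrete_difference[of "{d}"];
      auto simp: indicator_def)+

text \<open>The derivative of the integral over a period with respect to its starting point is zero.\<close>
lemma periodic_shift_integral:
  fixes F :: "real \<Rightarrow> real"
  assumes T: "T > 0" and c: "continuous_on UNIV F" and per: "\<And>t. F (t + T) = F t"
  shows "(LINT t:{0..<T}|lborel. F (t + c)) = (LINT t:{0..<T}|lborel. F t)"
proof -
  obtain G where G: "\<And>x. (G has_real_derivative F x) (at x)"
    using exists_antiderivative[OF c] by blast
  have int: "(LINT t:{0..<T}|lborel. F (t + d)) = G (T + d) - G (0 + d)" for d
  proof -
    have cd: "continuous_on {0..T} (\<lambda>t. F (t + d))"
      by (intro continuous_on_compose2[OF c] continuous_intros) auto
    have "((\<lambda>t. F (t + d)) has_integral (G (T + d) - G (0 + d))) {0..T}"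
    proof (rule fundamental_theorem_of_calculus)
      fix t
      have "((\<lambda>t. G (t + d)) has_real_derivative F (t + d) * 1) (at t)"
        by (rule DERIV_chain2[OF G]) (auto intro!: derivative_eq_intros)
      then show "((\<lambda>t. G (t + d)) has_vector_derivative F (t + d)) (at t within {0..T})"
        by (auto intro!: has_vector_derivative_at_within simp: has_real_derivative_iff_has_vector_derivative)
    qed (use T in simp)
    moreover have "(LINT t:{0..T}|lborel. F (t + d)) = integral {0..T} (\<lambda>t. F (t + d))"
      by (intro set_borel_integral_eq_integral(2) borel_integrable_atLeastAtMost' cd)
    ultimately show ?thesis by (simp add: set_integral_Ico_Icc integral_unique)
  qed
  have "((\<lambda>d. G (T + d) - G d) has_real_derivative 0) (at d)" for d
  proof -
    have "((\<lambda>d. G (T + d) - G d) has_real_derivative F (T + d) * 1 - F d) (at d)"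
      by (intro DERIV_diff G DERIV_chain2[OF G]) (auto intro!: derivative_eq_intros)
    then show ?thesis using per[of d] by (simp add: add.commute)
  qed
  then have "G (T + c) - G c = G (T + 0) - G 0"
    using DERIV_isconst_all[of "\<lambda>d. G (T + d) - G d"] by blast
  then show ?thesis using int[of c] int[of 0] by simp
qed

text \<open>An arc of the circle is cut out by a half-plane.\<close>
lemma cos_gt_iff_on_arc:
  assumes "0 < \<delta>" "\<delta> \<le> pi" "\<bar>x\<bar> \<le> 2 * pi - \<delta>"
  shows "cos x > cos \<delta> \<longleftrightarrow> \<bar>x\<bar> < \<delta>"
proof (cases "\<bar>x\<bar> < \<delta>")
  case True
  then have "cos \<bar>x\<bar> > cos \<delta>" by (intro cos_monotone_0_pi) (use assms in auto)
  then show ?thesis using True by simp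
next
  case False
  have "cos x \<le> cos \<delta>"
  proof (cases "\<bar>x\<bar> \<le> pi")
    case True
    then have "cos \<bar>x\<bar> \<le> cos \<delta>" by (intro cos_monotone_0_pi_le) (use assms False in auto)
    then show ?thesis by simp
  next
    case far: False
    have "cos x = cos (2 * pi - \<bar>x\<bar>)" by (simp add: cos_diff)
    also have "\<dots> \<le> cos \<delta>" by (intro cos_monotone_0_pi_le) (use assms far in auto)
    finally show ?thesis .
  qed
  then show ?thesis using False by simp
qed

text \<open>If all coefficients of \<open>D h\<close> vanish, then so do those of \<open>D h cos\<close> and \<open>D h sin\<close>, by the
  product-to-sum formulas. Hence \<open>D\<close> is orthogonal to all polynomials in
  \<open>(cos, sin)\<close>, and by the Stone-Weierstrass theorem to \<open>F (cos, sin)\<close> for every continuous \<open>F\<close> on the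
  plane. Indicators of arcs are bounded limits of such functions, because an arc is the part of the
  circle in a half-plane.\<close>
lemma Fourier_uniqueness:
  fixes D :: "real \<Rightarrow> real"
  assumes T: "T > 0" and D: "set_integrable lborel {0..<T} D"
    and cs: "\<And>k::int. (LINT t:{0..<T}|lborel. D t * cos (of_int k * (2 * pi / T) * t)) = 0"
    and sn: "\<And>k::int. (LINT t:{0..<T}|lborel. D t * sin (of_int k * (2 * pi / T) * t)) = 0"
  shows "AE t in lborel. t \<in> {0<..<T} \<longrightarrow> D t = 0"
proof -
  define w where "w = 2 * pi / T"
  define q where "q t = (cos (w * t), sin (w * t))" for t
  have D': "set_integrable lborel {0..T} D" using D by (simp add: set_integral_Ico_Icc)
  have qc: "continuous_on S q" for S unfolding q_def by (intro continuous_intros)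
  define I where "I h = (LINT t:{0..T}|lborel. D t * h t)" for h
  have Iadd: "I (\<lambda>t. c * g t + d * h t) = c * I g + d * I h"
    if "continuous_on UNIV g" "continuous_on UNIV h" for c d g h
  proof -
    have i: "set_integrable lborel {0..T} (\<lambda>t. D t * g t)" "set_integrable lborel {0..T} (\<lambda>t. D t * h t)"
      by (intro set_integrable_continuous_mult D' continuous_on_subset[OF that(1)] continuous_on_subset[OF that(2)]; simp)+
    have "I (\<lambda>t. c * g t + d * h t) = (LINT t:{0..T}|lborel. c * (D t * g t) + d * (D t * h t))"
      by (simp add: I_def algebra_simps)
    also have "\<dots> = c * I g + d * I h"
      using i by (subst set_integral_add) (auto simp: I_def)
    finally show ?thesis .
  qed
  define M where "M h \<longleftrightarrow> continuous_on UNIV h \<and>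
    (\<forall>k::int. I (\<lambda>t. h t * cos (of_int k * w * t)) = 0 \<and> I (\<lambda>t. h t * sin (of_int k * w * t)) = 0)" for h
  have M1: "M (\<lambda>_. 1)" using cs sn by (simp add: M_def I_def w_def set_integral_Ico_Icc)
  have Madd: "M (\<lambda>t. c * g t + d * h t)" if g: "M g" and h: "M h" for c d g h
  proof -
    have gh: "continuous_on UNIV g" "continuous_on UNIV h" using g h by (auto simp: M_def)
    have "I (\<lambda>t. (c * g t + d * h t) * e t) = c * I (\<lambda>t. g t * e t) + d * I (\<lambda>t. h t * e t)"
      if "continuous_on UNIV e" for e
      using Iadd[of "\<lambda>t. g t * e t" "\<lambda>t. h t * e t" c d] gh that
      by (auto intro!: continuous_intros simp: algebra_simps)
    from this[of "\<lambda>t. cos (of_int k * w * t)" for k] this[of "\<lambda>t. sin (of_int k * w * t)" for k]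
    show ?thesis using g h unfolding M_def by (simp add: continuous_intros)
  qed
  have Mtrig: "M (\<lambda>t. h t * cos (w * t)) \<and> M (\<lambda>t. h t * sin (w * t))" if h: "M h" for h
  proof -
    have hc: "continuous_on UNIV h" using h by (simp add: M_def)
    have z: "I (\<lambda>t. h t * cos (of_int k * w * t)) = 0" "I (\<lambda>t. h t * sin (of_int k * w * t)) = 0" for k :: int
      using h by (auto simp: M_def)
    have cts: "continuous_on UNIV (\<lambda>t. h t * cos (of_int k * w * t))"
      "continuous_on UNIV (\<lambda>t. h t * sin (of_int k * w * t))" for k :: int
      by (intro continuous_intros hc)+
    have comb: "I (\<lambda>t. c * (h t * cos (of_int k * w * t)) + d * (h t * cos (of_int l * w * t))) = 0"
      "I (\<lambda>t. c * (h t * sin (of_int k * w * t)) + d * (h t * sin (of_int l * w * t))) = 0" for c d k l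
      by (subst Iadd; (rule cts)?; simp add: z)+
    \<comment> \<open>The product-to-sum formulas lead to the frequencies \<open>k + 1\<close> and \<open>k - 1\<close>.\<close>
    have e: "of_int (k + 1) * w * t = of_int k * w * t + w * t" "of_int (k - 1) * w * t = of_int k * w * t - w * t"
      for k :: int and t by (auto simp: algebra_simps)
    have "I (\<lambda>t. h t * cos (w * t) * cos (of_int k * w * t)) = 0" for k :: int
    proof -
      have prod: "(\<lambda>t. h t * cos (w * t) * cos (of_int k * w * t)) =
          (\<lambda>t. (1/2) * (h t * cos (of_int (k + 1) * w * t)) + (1/2) * (h t * cos (of_int (k - 1) * w * t)))"
        unfolding e cos_add cos_diff by (auto simp: algebra_simps)
      show ?thesis unfolding prod by (rule comb)
    qed
    moreover have "I (\<lambda>t. h t * cos (w * t) * sin (of_int k * w * t)) = 0" for k :: int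
    proof -
      have prod: "(\<lambda>t. h t * cos (w * t) * sin (of_int k * w * t)) =
          (\<lambda>t. (1/2) * (h t * sin (of_int (k + 1) * w * t)) + (1/2) * (h t * sin (of_int (k - 1) * w * t)))"
        unfolding e sin_add sin_diff by (auto simp: algebra_simps)
      show ?thesis unfolding prod by (rule comb)
    qed
    moreover have "I (\<lambda>t. h t * sin (w * t) * cos (of_int k * w * t)) = 0" for k :: int
    proof -
      have prod: "(\<lambda>t. h t * sin (w * t) * cos (of_int k * w * t)) =
          (\<lambda>t. (1/2) * (h t * sin (of_int (k + 1) * w * t)) + (-1/2) * (h t * sin (of_int (k - 1) * w * t)))"
        unfolding e sin_add sin_diff by (auto simp: algebra_simps)
      show ?thesis unfolding prod by (rule comb)
    qed
    moreover have "I (\<lambda>t. h t * sin (w * t) * sin (of_int k * w * t)) = 0" for k :: int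
    proof -
      have prod: "(\<lambda>t. h t * sin (w * t) * sin (of_int k * w * t)) =
          (\<lambda>t. (1/2) * (h t * cos (of_int (k - 1) * w * t)) + (-1/2) * (h t * cos (of_int (k + 1) * w * t)))"
        unfolding e cos_add cos_diff by (auto simp: algebra_simps)
      show ?thesis unfolding prod by (rule comb)
    qed
    moreover have "continuous_on UNIV (\<lambda>t. h t * cos (w * t))" "continuous_on UNIV (\<lambda>t. h t * sin (w * t))"
      by (intro continuous_intros hc)+
    ultimately show ?thesis unfolding M_def by blast
  qed
  have Mpoly: "M (\<lambda>t. h t * p (q t))" if "real_polynomial_function p" "M h" for p h
    using that
  proof (induction arbitrary: h)
    case (linear p)
    interpret bounded_linear p by fact
    have lin: "p (x, y) = p (1, 0) * x + p (0, 1) * y" for x y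
    proof -
      have "(x, y) = x *\<^sub>R (1, 0) + y *\<^sub>R (0, 1)" by simp
      then have "p (x, y) = x *\<^sub>R p (1, 0) + y *\<^sub>R p (0, 1)" by (simp only: add scaleR)
      then show ?thesis by simp
    qed
    have hp: "h t * p (q t) = p (1, 0) * (h t * cos (w * t)) + p (0, 1) * (h t * sin (w * t))" for t
      unfolding q_def using lin[of "cos (w * t)" "sin (w * t)"] by (simp only: algebra_simps)
    show ?case unfolding hp by (rule Madd; simp only: Mtrig[OF \<open>M h\<close>])
  next
    case (const c)
    then show ?case using Madd[OF const.prems const.prems, of c 0] by (simp add: mult.commute)
  next
    case (add f g)
    show ?case using Madd[OF add.IH(1)[OF add.prems] add.IH(2)[OF add.prems], of 1 1] by (simp add: algebra_simps)
  next
    case (mult f g)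
    show ?case using mult.IH(2)[OF mult.IH(1)[OF mult.prems]] by (simp add: algebra_simps)
  qed
  have Ipoly: "I (\<lambda>t. p (q t)) = 0" if "real_polynomial_function p" for p
    using Mpoly[OF that M1] unfolding M_def by (auto dest!: spec[of _ 0])
  have Icont: "I (\<lambda>t. F (q t)) = 0" if F: "continuous_on UNIV F" for F :: "real \<times> real \<Rightarrow> real"
  proof -
    define J where "J = (LINT t:{0..T}|lborel. \<bar>D t\<bar>)"
    have eJ: "\<bar>I (\<lambda>t. F (q t))\<bar> \<le> e * J" if "e > 0" for e
    proof -
      have "compact (q ` {0..T})" by (intro compact_continuous_image qc) simp
      then obtain p where p: "real_polynomial_function p" "\<And>x. x \<in> q ` {0..T} \<Longrightarrow> \<bar>F x - p x\<bar> < e"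
        using Stone_Weierstrass_real_polynomial_function[OF _ continuous_on_subset[OF F] \<open>e > 0\<close>, of "q ` {0..T}"] by auto
      have pc: "continuous_on S p" for S using p(1) continuous_on_polymonial_function real_polynomial_function_eq by blast
      have Fq: "continuous_on S (\<lambda>t. F (q t))" for S by (rule continuous_on_compose2[OF F qc]) simp
      have pq: "continuous_on S (\<lambda>t. p (q t))" for S by (rule continuous_on_compose2[OF pc[of UNIV] qc]) simp
      have "I (\<lambda>t. F (q t)) = I (\<lambda>t. 1 * F (q t) + (-1) * p (q t))"
        using Ipoly[OF p(1)] by (subst Iadd) (auto intro: Fq pq)
      also have "\<bar>\<dots>\<bar> \<le> (LINT t:{0..T}|lborel. \<bar>D t * (1 * F (q t) + (-1) * p (q t))\<bar>)"
        unfolding I_def set_lebesgue_integral_def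
        by (rule order_trans[OF integral_abs_bound]) (simp add: abs_mult)
      also have "\<dots> \<le> (LINT t:{0..T}|lborel. \<bar>D t\<bar> * e)"
      proof (rule set_integral_mono)
        show "set_integrable lborel {0..T} (\<lambda>t. \<bar>D t * (1 * F (q t) + (-1) * p (q t))\<bar>)"
          by (intro set_integrable_abs set_integrable_continuous_mult D' continuous_on_add continuous_on_mult continuous_on_const Fq pq)
        show "set_integrable lborel {0..T} (\<lambda>t. \<bar>D t\<bar> * e)"
          by (intro set_integrable_mult_left impI set_integrable_abs D')
        show "\<bar>D t * (1 * F (q t) + (-1) * p (q t))\<bar> \<le> \<bar>D t\<bar> * e" if "t \<in> {0..T}" for t
          using p(2)[of "q t"] that by (auto simp: abs_mult intro!: mult_left_mono)
      qed
      finally show ?thesis by (simp add: J_def mult.commute)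
    qed
    have J: "J \<ge> 0" unfolding J_def set_lebesgue_integral_def by (rule integral_nonneg_AE) simp
    show ?thesis
    proof (rule ccontr)
      assume nz: "I (\<lambda>t. F (q t)) \<noteq> 0"
      define x where "x = \<bar>I (\<lambda>t. F (q t))\<bar>"
      have x: "x > 0" using nz by (simp add: x_def)
      have "x \<le> x / (J + 1) * J" using eJ[of "x / (J + 1)"] x J by (simp add: x_def)
      then show False using x J by (simp add: field_simps)
    qed
  qed
  show ?thesis
  proof (rule AE_zero_if_interval_integrals_zero)
    show "set_integrable lborel {0<..<T} D" by (rule set_integrable_subset[OF D]) auto
    fix a b assume ab: "0 \<le> a" "a < b" "b \<le> T"
    \<comment> \<open>The arc over \<open>(a, b)\<close> is the part of the circle in the half-plane where \<open>l\<close> is positive.\<close>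
    define m where "m = w * (a + b) / 2"
    define \<delta> where "\<delta> = w * (b - a) / 2"
    define l where "l z = cos m * fst z + sin m * snd z - cos \<delta>" for z :: "real \<times> real"
    define F where "F n z = min 1 (real n * max 0 (l z))" for n z
    have w: "w > 0" "w * T = 2 * pi" using T by (auto simp: w_def)
    have lq: "l (q t) > 0 \<longleftrightarrow> t \<in> {a<..<b}" if "t \<in> {0..T}" for t
    proof -
      have wt: "0 \<le> w * t" "w * t \<le> 2 * pi" "0 \<le> w * a" "w * b \<le> 2 * pi" "w * a < w * b"
        using that ab w mult_left_mono[of t T w] mult_left_mono[of b T w] by auto
      have md: "m = (w * a + w * b) / 2" "\<delta> = (w * b - w * a) / 2"
        by (auto simp: m_def \<delta>_def algebra_simps)
      have "l (q t) = cos (w * t - m) - cos \<delta>" by (simp add: l_def q_def cos_diff mult.commute)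
      moreover have "cos (w * t - m) > cos \<delta> \<longleftrightarrow> \<bar>w * t - m\<bar> < \<delta>"
      proof (rule cos_gt_iff_on_arc)
        have "0 < (B - A) / 2 \<and> (B - A) / 2 \<le> pi \<and> \<bar>x - (A + B) / 2\<bar> \<le> 2 * pi - (B - A) / 2"
          if "0 \<le> x" "x \<le> 2 * pi" "0 \<le> A" "B \<le> 2 * pi" "A < B" for x A B :: real
          using that unfolding abs_le_iff by (simp add: field_simps)
        from this[OF wt] show "0 < \<delta>" "\<delta> \<le> pi" "\<bar>w * t - m\<bar> \<le> 2 * pi - \<delta>"
          unfolding md by blast+
      qed
      moreover have "\<bar>w * t - m\<bar> < \<delta> \<longleftrightarrow> w * a < w * t \<and> w * t < w * b"
        by (auto simp: \<delta>_def m_def abs_less_iff field_simps)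
      ultimately show ?thesis using w by (simp add: mult_less_cancel_left_pos)
    qed
    have Fc: "continuous_on UNIV (F n)" for n
      unfolding F_def l_def by (intro continuous_intros)
    have Fqc: "continuous_on UNIV (\<lambda>t. F n (q t))" for n
      by (rule continuous_on_compose2[OF Fc qc]) auto
    have "(\<lambda>n. LINT t|lborel. indicator {0..T} t *\<^sub>R (D t * F n (q t)))
        \<longlonglongrightarrow> (LINT t|lborel. indicator {a<..<b} t *\<^sub>R D t)"
    proof (rule integral_dominated_convergence)
      have mD: "(\<lambda>t. indicator {0..T} t *\<^sub>R D t) \<in> borel_measurable lborel"
        using D' by (simp add: set_integrable_def borel_measurable_integrable)
      have ind: "indicator {a<..<b} t *\<^sub>R D t = indicator {a<..<b} t *\<^sub>R (indicator {0..T} t *\<^sub>R D t)" for t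
        using ab by (auto simp: indicator_def)
      show "(\<lambda>t. indicator {a<..<b} t *\<^sub>R D t) \<in> borel_measurable lborel"
        unfolding ind by (intro borel_measurable_scaleR mD) simp
      have "(\<lambda>t. F i (q t)) \<in> borel_measurable lborel" for i
        using borel_measurable_continuous_onI[OF Fqc] by simp
      then show "(\<lambda>t. indicator {0..T} t *\<^sub>R (D t * F i (q t))) \<in> borel_measurable lborel" for i
        using borel_measurable_times[OF mD, of "\<lambda>t. F i (q t)"] by (simp add: mult.assoc)
      show "integrable lborel (\<lambda>t. \<bar>indicator {0..T} t *\<^sub>R D t\<bar>)"
        using D' unfolding set_integrable_def by (rule integrable_abs)
      show "AE t in lborel. (\<lambda>i. indicator {0..T} t *\<^sub>R (D t * F i (q t))) \<longlonglongrightarrow> indicator {a<..<b} t *\<^sub>R D t"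
      proof (rule AE_I2)
        fix t
        show "(\<lambda>i. indicator {0..T} t *\<^sub>R (D t * F i (q t))) \<longlonglongrightarrow> indicator {a<..<b} t *\<^sub>R D t"
        proof (cases "t \<in> {0..T}")
          case True
          have "(\<lambda>i. F i (q t)) \<longlonglongrightarrow> indicator {a<..<b} t"
          proof (cases "t \<in> {a<..<b}")
            case in_arc: True
            then have pos: "l (q t) > 0" using lq[OF True] by simp
            obtain N :: nat where N: "1 / l (q t) < real N" using reals_Archimedean2 by blast
            have "F i (q t) = 1" if "i \<ge> N" for i
            proof -
              have "1 / l (q t) < real i" using N that by linarith
              then show ?thesis using pos by (simp add: F_def field_simps)
            qed
            then have "\<forall>\<^sub>F i in sequentially. F i (q t) = indicator {a<..<b} t"
              using in_arc by (auto simp: eventually_sequentially)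
            then show ?thesis by (rule tendsto_eventually)
          next
            case False
            then have "max 0 (l (q t)) = 0" using lq[OF True] False by (intro max_absorb1) (meson not_less)
            then have "F i (q t) = 0" for i by (simp add: F_def)
            then show ?thesis using False by simp
          qed
          then have "(\<lambda>i. indicator {0..T} t *\<^sub>R (D t * F i (q t))) \<longlonglongrightarrow> indicator {0..T} t *\<^sub>R (D t * indicator {a<..<b} t)"
            by (intro tendsto_intros)
          then show ?thesis using True by (simp add: mult.commute)
        qed (use ab in auto)
      qed
      show "AE t in lborel. norm (indicator {0..T} t *\<^sub>R (D t * F i (q t))) \<le> \<bar>indicator {0..T} t *\<^sub>R D t\<bar>" for i
      proof (rule AE_I2)
        fix t
        have "\<bar>F i (q t)\<bar> \<le> 1" by (auto simp: F_def)
        then show "norm (indicator {0..T} t *\<^sub>R (D t * F i (q t))) \<le> \<bar>indicator {0..T} t *\<^sub>R D t\<bar>"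
          by (auto simp: indicator_def abs_mult mult_left_le)
      qed
    qed
    moreover have "(LINT t|lborel. indicator {0..T} t *\<^sub>R (D t * F n (q t))) = 0" for n
      using Icont[OF Fc, of n] by (simp add: I_def set_lebesgue_integral_def)
    ultimately show "(LINT t:{a<..<b}|lborel. D t) = 0"
      unfolding set_lebesgue_integral_def by (simp only: LIMSEQ_const_iff)
  qed
qed

section \<open>Modes of square-integrable functions on the half-cylinder\<close>

text \<open>The inequality says that the integral of the square of \<open>h\<close> minus its mean is nonnegative.\<close>
lemma square_integrable_on_interval:
  fixes h :: "real \<Rightarrow> real"
  assumes T: "T > 0" and m: "set_borel_measurable lborel {0..<T} h"
    and sq: "set_integrable lborel {0..<T} (\<lambda>t. (h t)\<^sup>2)"
  shows "set_integrable lborel {0..<T} h"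
    and "(LINT t:{0..<T}|lborel. h t)\<^sup>2 \<le> T * (LINT t:{0..<T}|lborel. (h t)\<^sup>2)"
proof -
  have const: "set_integrable lborel {0..<T} (\<lambda>t. c)" for c :: real
    by (simp add: set_integral_Ico_Icc borel_integrable_atLeastAtMost')
  have "set_integrable lborel {0..<T} (\<lambda>t. 1 + (h t)\<^sup>2)"
    by (intro set_integral_add const sq)
  then show int: "set_integrable lborel {0..<T} h"
  proof (rule set_integrable_bound[OF _ m])
    have "\<bar>y\<bar> \<le> \<bar>1 + y\<^sup>2\<bar>" for y :: real
      using sum_squares_bound[of 1 "\<bar>y\<bar>"] by simp
    then show "AE t in lborel. t \<in> {0..<T} \<longrightarrow> norm (h t) \<le> norm (1 + (h t)\<^sup>2)" by simp
  qed
  define I where "I = (LINT t:{0..<T}|lborel. h t)"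
  have cT: "(LINT t:{0..<T}|lborel. c) = c * T" for c :: real
    using T by (simp add: set_lebesgue_integral_def)
  have "0 \<le> (LINT t:{0..<T}|lborel. (h t - I / T)\<^sup>2)"
    unfolding set_lebesgue_integral_def by (rule integral_nonneg_AE) simp
  also have "\<dots> = (LINT t:{0..<T}|lborel. ((h t)\<^sup>2 + (I / T)\<^sup>2) - (2 * I / T) * h t)"
    by (simp add: power2_diff algebra_simps)
  also have "\<dots> = (LINT t:{0..<T}|lborel. (h t)\<^sup>2) + (I / T)\<^sup>2 * T - (2 * I / T) * I"
    using int sq const by (subst set_integral_diff; (subst set_integral_add)?) (auto simp: I_def cT)
  finally have "0 \<le> T * ((LINT t:{0..<T}|lborel. (h t)\<^sup>2) + (I / T)\<^sup>2 * T - (2 * I / T) * I)"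
    using T by simp
  also have "\<dots> = T * (LINT t:{0..<T}|lborel. (h t)\<^sup>2) - I\<^sup>2"
    using T by (simp add: field_simps power2_eq_square)
  finally show "(LINT t:{0..<T}|lborel. h t)\<^sup>2 \<le> T * (LINT t:{0..<T}|lborel. (h t)\<^sup>2)"
    by (simp add: I_def)
qed

text \<open>For trigonometric \<open>\<eta>\<close> a Fourier coefficient of \<open>w(x, \<cdot>)\<close>, up to normalization.\<close>
definition mode :: "real \<Rightarrow> (real \<Rightarrow> real) \<Rightarrow> (real \<times> real \<Rightarrow> real) \<Rightarrow> real \<Rightarrow> real" where
  "mode T \<eta> w x = (LINT t:{0..<T}|lborel. w (x, t) * \<eta> t)"

lemma cyl_borel: "cyl T \<in> sets borel"
proof -
  have "({0..} :: real set) \<times> {0..<T} \<in> sets (borel \<Otimes>\<^sub>M borel)" by (intro pair_measureI) auto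
  then show ?thesis unfolding cyl_def borel_prod .
qed

lemma indicator_cyl: "indicator (cyl T) (x, t) = (indicator {0..} x * indicator {0..<T} t :: real)"
  by (auto simp: cyl_def indicator_def)

lemma L2_cyl_measurable:
  assumes "L2_cyl T w"
  shows "(\<lambda>p. indicator (cyl T) p * w p) \<in> borel_measurable (lborel \<Otimes>\<^sub>M lborel)"
  using assms by (simp add: L2_cyl_def set_borel_measurable_def lborel_prod)

lemma L2_cyl_square_integrable:
  assumes "L2_cyl T w"
  shows "integrable (lborel \<Otimes>\<^sub>M lborel) (\<lambda>p. (indicator (cyl T) p * w p)\<^sup>2)"
proof -
  have "integrable lborel (\<lambda>p. indicator (cyl T) p *\<^sub>R (w p)\<^sup>2)"
    using assms by (simp add: L2_cyl_def set_integrable_def)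
  moreover have "indicator (cyl T) p *\<^sub>R (w p)\<^sup>2 = (indicator (cyl T) p * w p)\<^sup>2" for p
    by (auto simp: indicator_def)
  ultimately show ?thesis by (simp add: lborel_prod)
qed

lemma L2_cyl_slice:
  assumes w: "L2_cyl T w"
  shows "AE x in lborel. x \<ge> 0 \<longrightarrow> set_borel_measurable lborel {0..<T} (\<lambda>t. w (x, t)) \<and>
      set_integrable lborel {0..<T} (\<lambda>t. (w (x, t))\<^sup>2)"
proof -
  have "AE x in lborel. integrable lborel (\<lambda>t. (indicator (cyl T) (x, t) * w (x, t))\<^sup>2)"
    using lborel_pair.AE_integrable_fst'[OF L2_cyl_square_integrable[OF w]] by simp
  then show ?thesis
  proof (rule AE_mp, intro AE_I2 impI)
    fix x :: real assume *: "integrable lborel (\<lambda>t. (indicator (cyl T) (x, t) * w (x, t))\<^sup>2)" and x: "x \<ge> 0"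
    have "(\<lambda>t. indicator (cyl T) (x, t) * w (x, t)) \<in> borel_measurable lborel"
      using measurable_compose_Pair1[OF _ L2_cyl_measurable[OF w], of x] by simp
    moreover have "(indicator (cyl T) (x, t) * w (x, t))\<^sup>2 = indicator {0..<T} t *\<^sub>R (w (x, t))\<^sup>2" for t
      using x by (auto simp: indicator_def cyl_def)
    ultimately show "set_borel_measurable lborel {0..<T} (\<lambda>t. w (x, t)) \<and> set_integrable lborel {0..<T} (\<lambda>t. (w (x, t))\<^sup>2)"
      using * x by (simp add: set_borel_measurable_def set_integrable_def indicator_cyl)
  qed
qed

context
  fixes T :: real and w :: "real \<times> real \<Rightarrow> real" and \<eta> :: "real \<Rightarrow> real"
  assumes T: "T > 0" and w: "L2_cyl T w"
    and \<eta>: "continuous_on UNIV \<eta>" "\<And>t. \<bar>\<eta> t\<bar> \<le> 1"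
begin

lemma eta_measurable: "\<eta> \<in> borel_measurable borel"
  using \<eta>(1) by (rule borel_measurable_continuous_onI)

lemma mode_eq:
  "(LINT t|lborel. (indicator (cyl T) (x, t) * w (x, t)) * \<eta> t) = indicator {0..} x * mode T \<eta> w x"
  by (cases "x \<ge> 0") (simp_all add: mode_def set_lebesgue_integral_def indicator_cyl mult.assoc)

lemma mode_measurable: "(\<lambda>x. indicator {0..} x * mode T \<eta> w x) \<in> borel_measurable borel"
proof -
  have [measurable]: "(\<lambda>p. indicator (cyl T) p * w p) \<in> borel_measurable (lborel \<Otimes>\<^sub>M lborel)"
    by (rule L2_cyl_measurable[OF w])
  note [measurable] = eta_measurable
  have "(\<lambda>x. LINT t|lborel. (\<lambda>p. (indicator (cyl T) p * w p) * \<eta> (snd p)) (x, t)) \<in> borel_measurable lborel"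
    by (rule lborel.borel_measurable_lebesgue_integral) measurable
  then show ?thesis by (simp add: mode_eq)
qed

lemma mode_square_bound:
  "AE x in lborel. x \<ge> 0 \<longrightarrow> (mode T \<eta> w x)\<^sup>2 \<le> T * (LINT t|lborel. (indicator (cyl T) (x, t) * w (x, t))\<^sup>2)"
  using L2_cyl_slice[OF w]
proof (rule AE_mp, intro AE_I2 impI)
  fix x :: real assume x: "x \<ge> 0" and "x \<ge> 0 \<longrightarrow> set_borel_measurable lborel {0..<T} (\<lambda>t. w (x, t)) \<and>
      set_integrable lborel {0..<T} (\<lambda>t. (w (x, t))\<^sup>2)"
  then have m: "set_borel_measurable lborel {0..<T} (\<lambda>t. w (x, t))"
    and sq: "set_integrable lborel {0..<T} (\<lambda>t. (w (x, t))\<^sup>2)" by auto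
  have m': "set_borel_measurable lborel {0..<T} (\<lambda>t. w (x, t) * \<eta> t)"
    using borel_measurable_times[OF m[unfolded set_borel_measurable_def], of \<eta>] eta_measurable
    by (simp add: set_borel_measurable_def mult.assoc)
  have le: "(w (x, t) * \<eta> t)\<^sup>2 \<le> (w (x, t))\<^sup>2" for t
  proof -
    have "(\<eta> t)\<^sup>2 \<le> 1" using \<eta>(2)[of t] by (simp add: abs_square_le_1)
    then show ?thesis by (simp add: power_mult_distrib mult_left_le)
  qed
  have sq': "set_integrable lborel {0..<T} (\<lambda>t. (w (x, t) * \<eta> t)\<^sup>2)"
  proof (rule set_integrable_bound[OF sq])
    show "set_borel_measurable lborel {0..<T} (\<lambda>t. (w (x, t) * \<eta> t)\<^sup>2)"
      using borel_measurable_times[OF m'[unfolded set_borel_measurable_def] m'[unfolded set_borel_measurable_def]]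
      unfolding set_borel_measurable_def
      by (rule measurable_cong[THEN iffD1, rotated]) (auto simp: indicator_def power2_eq_square)
  qed (use le in auto)
  have "(mode T \<eta> w x)\<^sup>2 \<le> T * (LINT t:{0..<T}|lborel. (w (x, t) * \<eta> t)\<^sup>2)"
    unfolding mode_def by (rule square_integrable_on_interval(2)[OF T m' sq'])
  also have "\<dots> \<le> T * (LINT t:{0..<T}|lborel. (w (x, t))\<^sup>2)"
    using T by (intro mult_left_mono set_integral_mono sq sq' le) auto
  also have "(LINT t:{0..<T}|lborel. (w (x, t))\<^sup>2) = (LINT t|lborel. (indicator (cyl T) (x, t) * w (x, t))\<^sup>2)"
    unfolding set_lebesgue_integral_def
    by (rule Bochner_Integration.integral_cong) (use x in \<open>auto simp: indicator_def cyl_def\<close>)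
  finally show "(mode T \<eta> w x)\<^sup>2 \<le> T * (LINT t|lborel. (indicator (cyl T) (x, t) * w (x, t))\<^sup>2)" .
qed

text \<open>Square-integrability of the modes is the only form in which the behaviour of the weak solution at
  infinity enters.\<close>
lemma mode_square_integrable: "set_integrable lborel {0..} (\<lambda>x. (mode T \<eta> w x)\<^sup>2)"
proof -
  have "integrable lborel (\<lambda>x. T * (LINT t|lborel. (indicator (cyl T) (x, t) * w (x, t))\<^sup>2))"
    using lborel_pair.integrable_fst'[OF L2_cyl_square_integrable[OF w]] by simp
  then have "integrable lborel (\<lambda>x. (indicator {0..} x * mode T \<eta> w x)\<^sup>2)"
  proof (rule Bochner_Integration.integrable_bound)
    show "(\<lambda>x. (indicator {0..} x * mode T \<eta> w x)\<^sup>2) \<in> borel_measurable lborel"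
      using mode_measurable by measurable
    show "AE x in lborel. norm ((indicator {0..} x * mode T \<eta> w x)\<^sup>2)
        \<le> norm (T * (LINT t|lborel. (indicator (cyl T) (x, t) * w (x, t))\<^sup>2))"
      using mode_square_bound
    proof (rule AE_mp, intro AE_I2 impI)
      fix x :: real assume "x \<ge> 0 \<longrightarrow> (mode T \<eta> w x)\<^sup>2 \<le> T * (LINT t|lborel. (indicator (cyl T) (x, t) * w (x, t))\<^sup>2)"
      then show "norm ((indicator {0..} x * mode T \<eta> w x)\<^sup>2)
        \<le> norm (T * (LINT t|lborel. (indicator (cyl T) (x, t) * w (x, t))\<^sup>2))"
        by (cases "x \<ge> 0") (auto intro: order_trans[OF _ abs_ge_self])
    qed
  qed
  moreover have "(indicator {0..} x * mode T \<eta> w x)\<^sup>2 = indicator {0..} x *\<^sub>R (mode T \<eta> w x)\<^sup>2" for x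
    by (auto simp: indicator_def)
  ultimately show ?thesis by (simp add: set_integrable_def)
qed

lemma mode_set_integrable: "set_integrable lborel {0..R} (mode T \<eta> w)"
proof (cases "R > 0")
  case True
  have "set_integrable lborel {0..<R} (mode T \<eta> w)"
  proof (rule square_integrable_on_interval(1)[OF True])
    show "set_integrable lborel {0..<R} (\<lambda>t. (mode T \<eta> w t)\<^sup>2)"
      by (rule set_integrable_subset[OF mode_square_integrable]) auto
    have "(\<lambda>x. indicator {0..<R} x * (indicator {0..} x * mode T \<eta> w x)) \<in> borel_measurable borel"
      using mode_measurable by measurable
    moreover have "indicator {0..<R} x * (indicator {0..} x * mode T \<eta> w x) = indicator {0..<R} x *\<^sub>R mode T \<eta> w x" for x
      by (auto simp: indicator_def)
    ultimately show "set_borel_measurable lborel {0..<R} (mode T \<eta> w)"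
      by (simp add: set_borel_measurable_def)
  qed
  then show ?thesis by (simp add: set_integral_Ico_Icc)
next
  case False
  then have "{0..R} \<subseteq> {0}" by auto
  then have "set_integrable lborel {0..R} (mode T \<eta> w) \<longleftrightarrow> set_integrable lborel {0..R} (\<lambda>_. 0::real)"
    unfolding set_integrable_def
    by (intro integrable_discrete_difference[of "{0}"]) (auto simp: indicator_def)
  then show ?thesis by (simp add: set_integrable_def)
qed

text \<open>Fubini's theorem; the factor \<open>\<zeta>\<close> need only be measurable, which admits products of a smooth
  function and a discontinuous potential.\<close>
lemma mode_integral:
  fixes \<zeta> :: "real \<Rightarrow> real"
  assumes m: "\<zeta> \<in> borel_measurable borel" and b: "\<And>x. \<bar>\<zeta> x\<bar> \<le> M" and s: "\<And>x. \<bar>x\<bar> > R \<Longrightarrow> \<zeta> x = 0"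
  shows "set_integrable lborel (cyl T) (\<lambda>p. w p * (\<zeta> (fst p) * \<eta> (snd p)))"
    and "(LINT p:cyl T|lborel. w p * (\<zeta> (fst p) * \<eta> (snd p))) = (LINT x:{0..}|lborel. mode T \<eta> w x * \<zeta> x)"
proof -
  define F where "F p = (indicator (cyl T) p * w p) * (\<zeta> (fst p) * \<eta> (snd p))" for p
  have [measurable]: "(\<lambda>p. indicator (cyl T) p * w p) \<in> borel_measurable (lborel \<Otimes>\<^sub>M lborel)"
    by (rule L2_cyl_measurable[OF w])
  note [measurable] = eta_measurable m
  have Fm: "F \<in> borel_measurable (lborel \<Otimes>\<^sub>M lborel)" unfolding F_def by measurable
  have box: "integrable (lborel \<Otimes>\<^sub>M lborel) (indicator ({-R..R} \<times> {0..<T}) :: real \<times> real \<Rightarrow> real)"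
  proof -
    have "emeasure (lborel \<Otimes>\<^sub>M lborel) ({-R..R} \<times> {0..<T}) = emeasure lborel {-R..R} * emeasure lborel {0..<T}"
      by (rule lborel.emeasure_pair_measure_Times) auto
    also have "\<dots> < \<infinity>" by (cases "R \<ge> 0") (use T in \<open>auto simp: ennreal_mult_less_top\<close>)
    finally show ?thesis by (intro integrable_real_indicator) auto
  qed
  have Fi: "integrable (lborel \<Otimes>\<^sub>M lborel) F"
  proof (rule Bochner_Integration.integrable_bound[OF Bochner_Integration.integrable_add[OF L2_cyl_square_integrable[OF w] integrable_mult_right[OF box, of "M\<^sup>2"]] Fm])
    show "AE p in lborel \<Otimes>\<^sub>M lborel. norm (F p)
       \<le> norm ((indicator (cyl T) p * w p)\<^sup>2 + M\<^sup>2 * indicator ({- R..R} \<times> {0..<T}) p)"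
    proof (rule AE_I2)
      fix p :: "real \<times> real"
      show "norm (F p) \<le> norm ((indicator (cyl T) p * w p)\<^sup>2 + M\<^sup>2 * indicator ({- R..R} \<times> {0..<T}) p)"
      proof (cases "p \<in> cyl T \<and> \<bar>fst p\<bar> \<le> R")
        case True
        have "\<bar>\<zeta> (fst p) * \<eta> (snd p)\<bar> \<le> M"
          unfolding abs_mult using mult_mono[OF b[of "fst p"] \<eta>(2)[of "snd p"]] b[of "fst p"] by simp
        then have "\<bar>w p\<bar> * \<bar>\<zeta> (fst p) * \<eta> (snd p)\<bar> \<le> \<bar>w p\<bar> * M" by (intro mult_left_mono) auto
        also have "\<dots> \<le> (w p)\<^sup>2 + M\<^sup>2"
        proof -
          have "0 \<le> \<bar>w p\<bar> * M" using b[of 0] by simp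
          moreover have "2 * (\<bar>w p\<bar> * M) \<le> (w p)\<^sup>2 + M\<^sup>2"
            using sum_squares_bound[of "\<bar>w p\<bar>" M] by simp
          ultimately show ?thesis by linarith
        qed
        finally have "\<bar>w p * (\<zeta> (fst p) * \<eta> (snd p))\<bar> \<le> (w p)\<^sup>2 + M\<^sup>2" by (simp add: abs_mult)
        moreover have "p \<in> {- R..R} \<times> {0..<T}" using True by (cases p) (auto simp: cyl_def)
        ultimately show ?thesis using True by (simp add: F_def)
      next
        case False
        then have "F p = 0" using s[of "fst p"] by (auto simp: F_def indicator_def)
        then show ?thesis by simp
      qed
    qed
  qed
  have Fcyl: "F p = indicator (cyl T) p *\<^sub>R (w p * (\<zeta> (fst p) * \<eta> (snd p)))" for p
    by (simp add: F_def)
  show "set_integrable lborel (cyl T) (\<lambda>p. w p * (\<zeta> (fst p) * \<eta> (snd p)))"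
    using Fi unfolding set_integrable_def by (simp add: Fcyl[abs_def] lborel_prod)
  have "(LINT p:cyl T|lborel. w p * (\<zeta> (fst p) * \<eta> (snd p))) = integral\<^sup>L (lborel \<Otimes>\<^sub>M lborel) F"
    by (simp add: set_lebesgue_integral_def lborel_prod Fcyl[abs_def])
  also have "\<dots> = (LINT x|lborel. LINT t|lborel. F (x, t))"
    by (rule lborel_pair.integral_fst'[OF Fi, symmetric])
  also have "(\<lambda>x. LINT t|lborel. F (x, t)) = (\<lambda>x. indicator {0..} x *\<^sub>R (mode T \<eta> w x * \<zeta> x))"
  proof
    fix x
    have "(LINT t|lborel. F (x, t)) = (LINT t|lborel. \<zeta> x * ((indicator (cyl T) (x, t) * w (x, t)) * \<eta> t))"
      by (simp add: F_def algebra_simps)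
    also have "\<dots> = \<zeta> x * (indicator {0..} x * mode T \<eta> w x)"
      by (simp only: integral_mult_right_zero mode_eq)
    finally show "(LINT t|lborel. F (x, t)) = indicator {0..} x *\<^sub>R (mode T \<eta> w x * \<zeta> x)"
      by (simp add: algebra_simps)
  qed
  finally show "(LINT p:cyl T|lborel. w p * (\<zeta> (fst p) * \<eta> (snd p))) = (LINT x:{0..}|lborel. mode T \<eta> w x * \<zeta> x)"
    by (simp add: set_lebesgue_integral_def)
qed

end

section \<open>Green's formula for test functions\<close>

text \<open>Young's inequality with a small parameter gives what is needed of the Cauchy-Schwarz inequality.\<close>
lemma L2_pairing_tendsto_zero:
  fixes d :: "nat \<Rightarrow> 'a \<Rightarrow> real"
  assumes d: "\<And>n. d n \<in> borel_measurable M" "\<And>n. integrable M (\<lambda>p. (d n p)\<^sup>2)"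
    and lim: "(\<lambda>n. LINT p|M. (d n p)\<^sup>2) \<longlonglongrightarrow> 0"
    and \<psi>: "\<psi> \<in> borel_measurable M" "integrable M (\<lambda>p. (\<psi> p)\<^sup>2)"
  shows "integrable M (\<lambda>p. d n p * \<psi> p)" and "(\<lambda>n. LINT p|M. d n p * \<psi> p) \<longlonglongrightarrow> 0"
proof -
  have young: "\<bar>x * y\<bar> \<le> (\<epsilon> * y\<^sup>2 + x\<^sup>2 / \<epsilon>) / 2" if "\<epsilon> > 0" for x y \<epsilon> :: real
  proof -
    have "0 \<le> (\<epsilon> * \<bar>y\<bar> - \<bar>x\<bar>)\<^sup>2" by simp
    also have "\<dots> = \<epsilon>\<^sup>2 * y\<^sup>2 + x\<^sup>2 - 2 * \<epsilon> * \<bar>x * y\<bar>"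
      by (simp add: power2_diff power_mult_distrib abs_mult)
    finally have "2 * \<epsilon> * \<bar>x * y\<bar> \<le> \<epsilon>\<^sup>2 * y\<^sup>2 + x\<^sup>2" by simp
    then show ?thesis using that by (simp add: field_simps power2_eq_square)
  qed
  show int: "integrable M (\<lambda>p. d n p * \<psi> p)" for n
  proof (rule Bochner_Integration.integrable_bound)
    show "integrable M (\<lambda>p. (1 * (\<psi> p)\<^sup>2 + (d n p)\<^sup>2 / 1) / 2)" using d \<psi> by simp
    show "(\<lambda>p. d n p * \<psi> p) \<in> borel_measurable M" using d \<psi> by simp
    show "AE p in M. norm (d n p * \<psi> p) \<le> norm ((1 * (\<psi> p)\<^sup>2 + (d n p)\<^sup>2 / 1) / 2)"
      using young[of 1] by (intro AE_I2) (auto intro: order_trans[OF _ abs_ge_self])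
  qed
  define K where "K = (LINT p|M. (\<psi> p)\<^sup>2)"
  have K: "K \<ge> 0" by (simp add: K_def)
  have bound: "\<bar>LINT p|M. d n p * \<psi> p\<bar> \<le> (\<epsilon> * K + (LINT p|M. (d n p)\<^sup>2) / \<epsilon>) / 2" if "\<epsilon> > 0" for \<epsilon> n
  proof -
    have "\<bar>LINT p|M. d n p * \<psi> p\<bar> \<le> (LINT p|M. \<bar>d n p * \<psi> p\<bar>)" by (rule integral_abs_bound)
    also have "\<dots> \<le> (LINT p|M. (\<epsilon> * (\<psi> p)\<^sup>2 + (d n p)\<^sup>2 / \<epsilon>) / 2)"
      using d \<psi> int by (intro integral_mono young that) auto
    also have "\<dots> = (\<epsilon> * K + (LINT p|M. (d n p)\<^sup>2) / \<epsilon>) / 2"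
      using d \<psi> by (simp add: K_def)
    finally show ?thesis .
  qed
  show "(\<lambda>n. LINT p|M. d n p * \<psi> p) \<longlonglongrightarrow> 0"
  proof (rule tendstoI)
    fix e :: real assume e: "e > 0"
    define \<epsilon> where "\<epsilon> = e / (K + 1)"
    have \<epsilon>: "\<epsilon> > 0" "\<epsilon> * (K + 1) = e" using e K by (auto simp: \<epsilon>_def)
    have "\<forall>\<^sub>F n in sequentially. dist (LINT p|M. (d n p)\<^sup>2) 0 < \<epsilon>\<^sup>2"
      using lim \<epsilon>(1) by (intro tendstoD) auto
    then show "\<forall>\<^sub>F n in sequentially. dist (LINT p|M. d n p * \<psi> p) 0 < e"
    proof eventually_elim
      case (elim n)
      then have "(LINT p|M. (d n p)\<^sup>2) / \<epsilon> < \<epsilon>" using \<epsilon> by (simp add: field_simps power2_eq_square)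
      then have "(\<epsilon> * K + (LINT p|M. (d n p)\<^sup>2) / \<epsilon>) / 2 < e" using \<epsilon> e by (simp add: distrib_left)
      then show ?case using bound[OF \<epsilon>(1), of n] by simp
    qed
  qed
qed

lemma smooth_plane_continuous:
  assumes "smooth_plane \<phi>"
  shows "continuous_on S \<phi>" "continuous_on S (pdx \<phi>)" "continuous_on S (pdt \<phi>)"
proof -
  have c: "continuous_on S ((pdx ^^ i) ((pdt ^^ j) \<phi>))" for i j
    using assms unfolding smooth_plane_def
    by (meson continuous_at_imp_continuous_on differentiable_imp_continuous_within)
  show "continuous_on S \<phi>" "continuous_on S (pdx \<phi>)" "continuous_on S (pdt \<phi>)"
    using c[of 0 0] c[of 1 0] c[of 0 1] by simp_all
qed

lemma smooth_plane_DERIV_x: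
  assumes "smooth_plane \<phi>"
  shows "((\<lambda>y. \<phi> (y, t)) has_real_derivative pdx \<phi> (x, t)) (at x)"
proof -
  have "((pdx ^^ 0) ((pdt ^^ 0) \<phi>)) differentiable (at (x, t))"
    using assms unfolding smooth_plane_def by blast
  then have "\<phi> differentiable (at (x, t))" by simp
  moreover have "(\<lambda>y. (y, t)) differentiable (at x)"
    by (auto intro!: derivative_eq_intros simp: differentiable_def)
  ultimately have "(\<lambda>y. \<phi> (y, t)) differentiable (at x)"
    by (intro differentiable_compose[of \<phi> "\<lambda>y. (y, t)"])
  then show ?thesis by (simp add: pdx_def DERIV_deriv_iff_real_differentiable)
qed

lemma test_fun_support:
  assumes "\<phi> \<in> test_fun T"
  obtains R where "R > 0" "\<And>x t. \<bar>x\<bar> > R \<Longrightarrow> \<phi> (x, t) = 0 \<and> pdx \<phi> (x, t) = 0 \<and> pdt \<phi> (x, t) = 0"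
proof -
  obtain R where R: "\<And>x t. \<bar>x\<bar> > R \<Longrightarrow> \<phi> (x, t) = 0"
    using assms unfolding test_fun_def by blast
  have "pdx \<phi> (x, t) = 0 \<and> pdt \<phi> (x, t) = 0" if "\<bar>x\<bar> > R" for x t
  proof
    have "((\<lambda>y. 0) has_real_derivative 0) (at x)" by simp
    then have "((\<lambda>y. \<phi> (y, t)) has_real_derivative 0) (at x)"
      by (rule has_field_derivative_transform_within_open[where S = "{y. \<bar>y\<bar> > R}"])
        (use that R in \<open>auto intro!: open_Collect_less continuous_intros\<close>)
    then show "pdx \<phi> (x, t) = 0" by (simp add: pdx_def DERIV_imp_deriv)
    have "(\<lambda>s. \<phi> (x, s)) = (\<lambda>s. 0)" using R that by auto
    then show "pdt \<phi> (x, t) = 0" by (simp add: pdt_def)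
  qed
  with R show ?thesis by (intro that[of "\<bar>R\<bar> + 1"]) auto
qed

lemma continuous_cyl_L2:
  fixes F :: "real \<times> real \<Rightarrow> real"
  assumes T: "T > 0" and c: "continuous_on UNIV F" and s: "\<And>x t. \<bar>x\<bar> > R \<Longrightarrow> F (x, t) = 0"
  shows "(\<lambda>p. indicator (cyl T) p * F p) \<in> borel_measurable lborel"
    and "integrable lborel (\<lambda>p. indicator (cyl T) p * F p)"
    and "integrable lborel (\<lambda>p. (indicator (cyl T) p * F p)\<^sup>2)"
proof -
  have m: "F \<in> borel_measurable lborel" using borel_measurable_continuous_onI[OF c] by simp
  show *: "(\<lambda>p. indicator (cyl T) p * F p) \<in> borel_measurable lborel"
    using m cyl_borel by simp
  define B where "B = {0..R} \<times> {0..T}"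
  have "compact B" unfolding B_def by (intro compact_Times compact_Icc)
  then obtain M where M: "\<And>p. p \<in> B \<Longrightarrow> \<bar>F p\<bar> \<le> M"
    using compact_imp_bounded[OF compact_continuous_image[OF continuous_on_subset[OF c]]]
    by (fastforce simp: bounded_iff)
  have B: "integrable lborel (\<lambda>p. indicator B p * K)" for K :: real
  proof -
    have "emeasure lborel B < \<infinity>" by (rule emeasure_compact_finite[OF \<open>compact B\<close>])
    then show ?thesis using \<open>compact B\<close> by (intro integrable_mult_left integrable_real_indicator) (auto intro: borel_compact)
  qed
  have le: "\<bar>indicator (cyl T) p * F p\<bar> \<le> indicator B p * M" for p
  proof (cases "p \<in> cyl T \<and> \<bar>fst p\<bar> \<le> R")
    case True then have "p \<in> B" by (cases p) (auto simp: cyl_def B_def)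
    then show ?thesis using True M by simp
  next
    case False
    then have "indicator (cyl T) p * F p = 0" using s[of "fst p" "snd p"] by (auto simp: indicator_def)
    moreover have "0 \<le> indicator B p * M" using M[of p] by (cases "p \<in> B") auto
    ultimately show ?thesis by (simp only: abs_zero)
  qed
  show "integrable lborel (\<lambda>p. indicator (cyl T) p * F p)"
    by (rule Bochner_Integration.integrable_bound[OF B[of M] *], rule AE_I2)
      (unfold real_norm_def, rule order_trans[OF le abs_ge_self])
  show "integrable lborel (\<lambda>p. (indicator (cyl T) p * F p)\<^sup>2)"
  proof (rule Bochner_Integration.integrable_bound[OF B[of "M\<^sup>2"]])
    show "(\<lambda>p. (indicator (cyl T) p * F p)\<^sup>2) \<in> borel_measurable lborel" using * by simp
    have le2: "(indicator (cyl T) p * F p)\<^sup>2 \<le> indicator B p * M\<^sup>2" for p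
    proof -
      have "\<bar>indicator (cyl T) p * F p\<bar>\<^sup>2 \<le> (indicator B p * M)\<^sup>2" by (rule power_mono[OF le]) simp
      then show ?thesis by (auto simp: indicator_def)
    qed
    have "norm ((indicator (cyl T) p * F p)\<^sup>2) \<le> norm (indicator B p * M\<^sup>2)" for p
      unfolding real_norm_def abs_power2 by (rule order_trans[OF le2 abs_ge_self])
    then show "AE p in lborel. norm ((indicator (cyl T) p * F p)\<^sup>2) \<le> norm (indicator B p * M\<^sup>2)"
      by (rule AE_I2)
  qed
qed

text \<open>Integration by parts in \<open>x\<close> for fixed \<open>t\<close>.\<close>
lemma test_fun_Green:
  assumes T: "T > 0" and \<phi>: "\<phi> \<in> test_fun T" and \<zeta>: "test_line \<zeta>" and \<eta>: "continuous_on UNIV \<eta>"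
  shows "(LINT p:cyl T|lborel. \<phi> p * (deriv \<zeta> (fst p) * \<eta> (snd p)))
      + (LINT p:cyl T|lborel. pdx \<phi> p * (\<zeta> (fst p) * \<eta> (snd p)))
      = - (\<zeta> 0 * (LINT t:{0..<T}|lborel. \<phi> (0, t) * \<eta> t))"
proof -
  obtain R where R: "R > 0" "\<And>x t. \<bar>x\<bar> > R \<Longrightarrow> \<phi> (x, t) = 0 \<and> pdx \<phi> (x, t) = 0 \<and> pdt \<phi> (x, t) = 0"
    using test_fun_support[OF \<phi>] by blast
  have sp: "smooth_plane \<phi>" using \<phi> by (simp add: test_fun_def)
  have sm: "smooth_line \<zeta>" using \<zeta> by (simp add: test_line_def)
  note c = smooth_plane_continuous[OF sp] smooth_line_continuous[OF sm] smooth_line_continuous[OF smooth_line_deriv[OF sm]]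
  define F1 where "F1 p = \<phi> p * (deriv \<zeta> (fst p) * \<eta> (snd p))" for p
  define F2 where "F2 p = pdx \<phi> p * (\<zeta> (fst p) * \<eta> (snd p))" for p
  have cs: "continuous_on UNIV (\<lambda>p. h (fst p))" "continuous_on UNIV (\<lambda>p. h (snd p))"
    if "continuous_on UNIV h" for h :: "real \<Rightarrow> real" and p :: "real \<times> real"
    by (rule continuous_on_compose2[OF that]; auto intro: continuous_intros)+
  have F1c: "continuous_on UNIV F1" and F2c: "continuous_on UNIV F2"
    unfolding F1_def F2_def by (intro continuous_on_mult cs c \<eta>)+
  have F1s: "F1 (x, t) = 0" and F2s: "F2 (x, t) = 0" if "\<bar>x\<bar> > R" for x t
    using R(2)[OF that] by (auto simp: F1_def F2_def)
  note i1 = continuous_cyl_L2(2)[OF T F1c F1s] and i2 = continuous_cyl_L2(2)[OF T F2c F2s]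
  define F where "F p = indicator (cyl T) p * F1 p + indicator (cyl T) p * F2 p" for p
  have Fi: "integrable (lborel \<Otimes>\<^sub>M lborel) (case_prod (\<lambda>x t. F (x, t)))"
  proof -
    have "case_prod (\<lambda>x t. F (x, t)) = F" by auto
    then show ?thesis using Bochner_Integration.integrable_add[OF i1 i2] by (simp add: F_def[abs_def] lborel_prod)
  qed
  have "(LINT p:cyl T|lborel. F1 p) + (LINT p:cyl T|lborel. F2 p) = integral\<^sup>L lborel F"
    using Bochner_Integration.integral_add[OF i1 i2] by (simp add: F_def[abs_def] set_lebesgue_integral_def)
  also have "\<dots> = integral\<^sup>L (lborel \<Otimes>\<^sub>M lborel) (case_prod (\<lambda>x t. F (x, t)))"
    by (simp add: lborel_prod)
  also have "\<dots> = (LINT t|lborel. LINT x|lborel. F (x, t))"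
    by (rule lborel_pair.integral_snd[OF Fi, symmetric])
  also have "(\<lambda>t. LINT x|lborel. F (x, t)) = (\<lambda>t. - \<zeta> 0 * (indicator {0..<T} t *\<^sub>R (\<phi> (0, t) * \<eta> t)))"
  proof
    fix t
    have d: "((\<lambda>x. \<phi> (x, t) * \<zeta> x) has_real_derivative (\<phi> (x, t) * deriv \<zeta> x + pdx \<phi> (x, t) * \<zeta> x)) (at x)" for x
      using DERIV_mult[OF smooth_plane_DERIV_x[OF sp, of t x] smooth_line_has_deriv[OF sm, of x]]
      by (simp add: algebra_simps)
    have ct: "continuous_on S (\<lambda>x. h (x, t))" if "continuous_on UNIV h" for h :: "real \<times> real \<Rightarrow> real" and S
      by (rule continuous_on_compose2[OF that]) (auto intro: continuous_intros)
    have "(LINT x|lborel. F (x, t)) = (LINT x|lborel. (indicator {0..<T} t * \<eta> t) *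
        (indicator {0..R+1} x *\<^sub>R (\<phi> (x, t) * deriv \<zeta> x + pdx \<phi> (x, t) * \<zeta> x)))"
      by (rule Bochner_Integration.integral_cong)
        (use R(2) in \<open>auto simp: F_def F1_def F2_def indicator_def cyl_def algebra_simps\<close>)
    also have "\<dots> = (indicator {0..<T} t * \<eta> t) * (LINT x:{0..R+1}|lborel. \<phi> (x, t) * deriv \<zeta> x + pdx \<phi> (x, t) * \<zeta> x)"
      by (simp add: set_lebesgue_integral_def)
    also have "(LINT x:{0..R+1}|lborel. \<phi> (x, t) * deriv \<zeta> x + pdx \<phi> (x, t) * \<zeta> x)
       = integral {0..R+1} (\<lambda>x. \<phi> (x, t) * deriv \<zeta> x + pdx \<phi> (x, t) * \<zeta> x)"
      by (intro set_borel_integral_eq_integral(2) borel_integrable_atLeastAtMost' continuous_on_add continuous_on_mult ct c)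
    also have "\<dots> = \<phi> (R + 1, t) * \<zeta> (R + 1) - \<phi> (0, t) * \<zeta> 0"
    proof (rule integral_unique, rule fundamental_theorem_of_calculus)
      show "((\<lambda>x. \<phi> (x, t) * \<zeta> x) has_vector_derivative \<phi> (x, t) * deriv \<zeta> x + pdx \<phi> (x, t) * \<zeta> x)
          (at x within {0..R + 1})" for x
        by (rule has_vector_derivative_at_within[OF d[unfolded has_real_derivative_iff_has_vector_derivative]])
    qed (use R(1) in simp)
    also have "\<phi> (R + 1, t) = 0" using R by simp
    finally show "(LINT x|lborel. F (x, t)) = - \<zeta> 0 * (indicator {0..<T} t *\<^sub>R (\<phi> (0, t) * \<eta> t))"
      by (simp add: algebra_simps)
  qed
  finally show ?thesis by (simp add: F1_def F2_def set_lebesgue_integral_def)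
qed

section \<open>Trigonometric modes and Green's formula for the trace\<close>

text \<open>With the phase as a parameter, sine and cosine belong to one family, and differentiation and
  translation in \<open>t\<close> are shifts of the phase.\<close>
definition wave :: "real \<Rightarrow> int \<Rightarrow> real \<Rightarrow> real \<Rightarrow> real" where
  "wave T k \<alpha> t = cos (of_int k * (2 * pi / T) * t + \<alpha>)"

lemma wave_bounded: "\<bar>wave T k \<alpha> t\<bar> \<le> 1" by (simp add: wave_def)

lemma wave_smooth: "smooth_line (wave T k \<alpha>)"
  using smooth_line_cos[of 1 "of_int k * (2 * pi / T)" \<alpha>] by (simp add: wave_def[abs_def])

lemma wave_continuous: "continuous_on S (wave T k \<alpha>)"
  by (rule smooth_line_continuous[OF wave_smooth])

lemma wave_deriv: "deriv (wave T k \<alpha>) = (\<lambda>t. (of_int k * (2 * pi / T)) * wave T k (\<alpha> + pi / 2) t)"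
proof
  fix t
  have "((\<lambda>t. cos (l * t + \<alpha>)) has_real_derivative l * cos (l * t + (\<alpha> + pi / 2))) (at t)" for l
    by (auto intro!: derivative_eq_intros simp: cos_add sin_add algebra_simps)
  then have "(wave T k \<alpha> has_real_derivative (of_int k * (2 * pi / T)) * wave T k (\<alpha> + pi / 2) t) (at t)"
    unfolding wave_def by blast
  then show "deriv (wave T k \<alpha>) t = (of_int k * (2 * pi / T)) * wave T k (\<alpha> + pi / 2) t"
    by (rule DERIV_imp_deriv)
qed

lemma wave_periodic: "T > 0 \<Longrightarrow> wave T k \<alpha> (t + T) = wave T k \<alpha> t"
proof -
  assume "T > 0"
  then have "of_int k * (2 * pi / T) * (t + T) + \<alpha> = (of_int k * (2 * pi / T) * t + \<alpha>) + 2 * pi * of_int k"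
    by (simp add: field_simps)
  then show ?thesis by (simp only: wave_def cos_add cos_int_2pin sin_int_2pin) simp
qed

lemma wave_shift_pi: "wave T k (\<alpha> + pi / 2 + pi / 2) = (\<lambda>t. - wave T k \<alpha> t)"
proof
  fix t
  have "of_int k * (2 * pi / T) * t + (\<alpha> + pi / 2 + pi / 2) = (of_int k * (2 * pi / T) * t + \<alpha>) + pi" by simp
  then show "wave T k (\<alpha> + pi / 2 + pi / 2) t = - wave T k \<alpha> t"
    unfolding wave_def by (simp only: cos_periodic_pi)
qed

lemma mode_uminus: "mode T (\<lambda>t. - \<eta> t) w x = - mode T \<eta> w x"
  by (simp add: mode_def set_lebesgue_integral_def)

text \<open>Green's formula holds for the test functions that approximate \<open>u\<close>, and all of its terms are
  continuous with respect to the convergence in the definition of the trace.\<close>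
lemma trace_Green:
  assumes T: "T > 0" and L2: "L2_cyl T u" "L2_cyl T ux" "L2_cyl T ut" and tr: "has_trace T u ux ut g"
    and \<zeta>: "test_line \<zeta>" and \<eta>: "continuous_on UNIV \<eta>" "\<And>t. \<bar>\<eta> t\<bar> \<le> 1"
  shows "(LINT x:{0..}|lborel. mode T \<eta> u x * deriv \<zeta> x) + (LINT x:{0..}|lborel. mode T \<eta> ux x * \<zeta> x)
     = - (\<zeta> 0 * (LINT t:{0..<T}|lborel. g t * \<eta> t))"
proof -
  obtain \<phi> where \<phi>: "\<And>n. \<phi> n \<in> test_fun T"
    and H1: "(\<lambda>n. LINT p:cyl T|lborel. (\<phi> n p - u p)\<^sup>2 + (pdx (\<phi> n) p - ux p)\<^sup>2 + (pdt (\<phi> n) p - ut p)\<^sup>2) \<longlonglongrightarrow> 0"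
    and tr0: "(\<lambda>n. LINT t:{0..<T}|lborel. (\<phi> n (0, t) - g t)\<^sup>2) \<longlonglongrightarrow> 0"
    using tr unfolding has_trace_def by blast
  have gm: "set_borel_measurable lborel {0..<T} g" and g2: "set_integrable lborel {0..<T} (\<lambda>t. (g t)\<^sup>2)"
    using tr unfolding has_trace_def by auto
  let ?i = "indicator (cyl T) :: real \<times> real \<Rightarrow> real"
  have sm: "smooth_line \<zeta>" using \<zeta> by (simp add: test_line_def)
  obtain R M0 M1 where R: "\<And>x. \<bar>x\<bar> > R \<Longrightarrow> \<zeta> x = 0" and R': "\<And>x. \<bar>x\<bar> > R \<Longrightarrow> deriv \<zeta> x = 0"
    and M: "\<And>x. \<bar>deriv \<zeta> x\<bar> \<le> M0" "\<And>x. \<bar>\<zeta> x\<bar> \<le> M1"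
    by (rule test_line_bounds[OF \<zeta>]) blast
  have zc: "continuous_on UNIV \<zeta>" "continuous_on UNIV (deriv \<zeta>)"
    by (intro smooth_line_continuous smooth_line_deriv sm)+
  have L2': "(\<lambda>p. ?i p * w p) \<in> borel_measurable lborel" "integrable lborel (\<lambda>p. (?i p * w p)\<^sup>2)"
    if "L2_cyl T w" for w
    using L2_cyl_measurable[OF that] L2_cyl_square_integrable[OF that] by (simp_all add: lborel_prod)
  have sp: "smooth_plane (\<phi> n)" for n using \<phi> by (simp add: test_fun_def)
  have \<phi>L2: "(\<lambda>p. ?i p * F p) \<in> borel_measurable lborel" "integrable lborel (\<lambda>p. (?i p * F p)\<^sup>2)"
    "integrable lborel (\<lambda>p. ?i p * (F p * G p))"
    if "F = \<phi> n \<or> F = pdx (\<phi> n) \<or> F = pdt (\<phi> n)" "continuous_on UNIV G" for F G n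
  proof -
    obtain S where S: "\<And>x t. \<bar>x\<bar> > S \<Longrightarrow> \<phi> n (x, t) = 0 \<and> pdx (\<phi> n) (x, t) = 0 \<and> pdt (\<phi> n) (x, t) = 0"
      using test_fun_support[OF \<phi>] by metis
    have c: "continuous_on UNIV F" using that(1) smooth_plane_continuous[OF sp] by blast
    have s: "F (x, t) = 0" if "\<bar>x\<bar> > S" for x t using S[OF that] \<open>F = _ \<or> _\<close> by auto
    show "(\<lambda>p. ?i p * F p) \<in> borel_measurable lborel" "integrable lborel (\<lambda>p. (?i p * F p)\<^sup>2)"
      by (rule continuous_cyl_L2[OF T c s]; assumption)+
    show "integrable lborel (\<lambda>p. ?i p * (F p * G p))"
      by (rule continuous_cyl_L2(2)[OF T continuous_on_mult[OF c that(2)], of S]) (simp add: s)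
  qed
  define d0 where "d0 n p = ?i p * \<phi> n p - ?i p * u p" for n p
  define d1 where "d1 n p = ?i p * pdx (\<phi> n) p - ?i p * ux p" for n p
  define d2 where "d2 n p = ?i p * pdt (\<phi> n) p - ?i p * ut p" for n p
  have diff2: "integrable lborel (\<lambda>p. (A p - B p)\<^sup>2)"
    if "A \<in> borel_measurable lborel" "B \<in> borel_measurable lborel"
      "integrable lborel (\<lambda>p. (A p)\<^sup>2)" "integrable lborel (\<lambda>p. (B p)\<^sup>2)" for A B :: "'c::euclidean_space \<Rightarrow> real"
  proof (rule Bochner_Integration.integrable_bound)
    show "integrable lborel (\<lambda>p. 2 * (A p)\<^sup>2 + 2 * (B p)\<^sup>2)" using that by simp
    have "(x - y)\<^sup>2 \<le> 2 * x\<^sup>2 + 2 * y\<^sup>2" for x y :: real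
      using sum_squares_ge_zero[of "x + y" 0] by (simp add: power2_eq_square algebra_simps)
    then show "AE p in lborel. norm ((A p - B p)\<^sup>2) \<le> norm (2 * (A p)\<^sup>2 + 2 * (B p)\<^sup>2)"
      by (intro AE_I2) simp
  qed (use that in measurable)
  have dm: "d0 n \<in> borel_measurable lborel" "d1 n \<in> borel_measurable lborel" "d2 n \<in> borel_measurable lborel" for n
    unfolding d0_def d1_def d2_def
    by (intro borel_measurable_diff \<phi>L2(1)[of _ n "\<lambda>_. 1"] L2'(1) L2; simp)+
  have di: "integrable lborel (\<lambda>p. (d0 n p)\<^sup>2)" "integrable lborel (\<lambda>p. (d1 n p)\<^sup>2)" "integrable lborel (\<lambda>p. (d2 n p)\<^sup>2)" for n
    unfolding d0_def d1_def d2_def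
    by (intro diff2 \<phi>L2(1)[of _ n "\<lambda>_. 1"] \<phi>L2(2)[of _ n "\<lambda>_. 1"] L2' L2; simp)+
  have sum: "(LINT p:cyl T|lborel. (\<phi> n p - u p)\<^sup>2 + (pdx (\<phi> n) p - ux p)\<^sup>2 + (pdt (\<phi> n) p - ut p)\<^sup>2)
     = (LINT p|lborel. (d0 n p)\<^sup>2) + (LINT p|lborel. (d1 n p)\<^sup>2) + (LINT p|lborel. (d2 n p)\<^sup>2)" for n
  proof -
    have "(LINT p:cyl T|lborel. (\<phi> n p - u p)\<^sup>2 + (pdx (\<phi> n) p - ux p)\<^sup>2 + (pdt (\<phi> n) p - ut p)\<^sup>2)
      = (LINT p|lborel. (d0 n p)\<^sup>2 + (d1 n p)\<^sup>2 + (d2 n p)\<^sup>2)"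
      unfolding set_lebesgue_integral_def d0_def d1_def d2_def
      by (rule Bochner_Integration.integral_cong) (auto simp: indicator_def)
    then show ?thesis using di[of n] by simp
  qed
  have nn: "0 \<le> (LINT p|lborel. (d n p)\<^sup>2)" for d :: "nat \<Rightarrow> real \<times> real \<Rightarrow> real" and n by simp
  have lim: "(\<lambda>n. LINT p|lborel. (d0 n p)\<^sup>2) \<longlonglongrightarrow> 0" "(\<lambda>n. LINT p|lborel. (d1 n p)\<^sup>2) \<longlonglongrightarrow> 0"
    by (rule tendsto_sandwich[OF _ _ tendsto_const H1[unfolded sum]];
        intro always_eventually allI; use nn[of d0] nn[of d1] nn[of d2] in \<open>smt (verit)\<close>)+
  define \<psi>0 where "\<psi>0 p = ?i p * (deriv \<zeta> (fst p) * \<eta> (snd p))" for p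
  define \<psi>1 where "\<psi>1 p = ?i p * (\<zeta> (fst p) * \<eta> (snd p))" for p
  have cs: "continuous_on UNIV (\<lambda>p::real\<times>real. h (fst p))" "continuous_on UNIV (\<lambda>p::real\<times>real. h (snd p))"
    if "continuous_on UNIV h" for h :: "real \<Rightarrow> real"
    by (rule continuous_on_compose2[OF that]; auto intro: continuous_intros)+
  have tens: "continuous_on UNIV (\<lambda>p. deriv \<zeta> (fst p) * \<eta> (snd p))" "continuous_on UNIV (\<lambda>p. \<zeta> (fst p) * \<eta> (snd p))"
    by (intro continuous_on_mult cs zc \<eta>(1))+
  have \<psi>0: "\<psi>0 \<in> borel_measurable lborel" "integrable lborel (\<lambda>p. (\<psi>0 p)\<^sup>2)"
    unfolding \<psi>0_def by (rule continuous_cyl_L2[OF T tens(1), of R]; simp add: R')+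
  have \<psi>1: "\<psi>1 \<in> borel_measurable lborel" "integrable lborel (\<lambda>p. (\<psi>1 p)\<^sup>2)"
    unfolding \<psi>1_def by (rule continuous_cyl_L2[OF T tens(2), of R]; simp add: R)+
  have l0: "(\<lambda>n. LINT p|lborel. d0 n p * \<psi>0 p) \<longlonglongrightarrow> 0"
    by (rule L2_pairing_tendsto_zero(2)[OF dm(1) di(1) lim(1) \<psi>0])
  have l1: "(\<lambda>n. LINT p|lborel. d1 n p * \<psi>1 p) \<longlonglongrightarrow> 0"
    by (rule L2_pairing_tendsto_zero(2)[OF dm(2) di(2) lim(2) \<psi>1])
  have zm: "\<zeta> \<in> borel_measurable borel" "deriv \<zeta> \<in> borel_measurable borel"
    by (intro borel_measurable_continuous_onI zc)+
  note mu = mode_integral[OF T L2(1) \<eta> zm(2) M(1) R'] and mx = mode_integral[OF T L2(2) \<eta> zm(1) M(2) R]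
  have e0: "(LINT p|lborel. d0 n p * \<psi>0 p) = (LINT p:cyl T|lborel. \<phi> n p * (deriv \<zeta> (fst p) * \<eta> (snd p)))
      - (LINT x:{0..}|lborel. mode T \<eta> u x * deriv \<zeta> x)" for n
  proof -
    have "(LINT p|lborel. d0 n p * \<psi>0 p) = (LINT p|lborel. ?i p * (\<phi> n p * (deriv \<zeta> (fst p) * \<eta> (snd p)))
        - ?i p *\<^sub>R (u p * (deriv \<zeta> (fst p) * \<eta> (snd p))))"
      by (rule Bochner_Integration.integral_cong) (auto simp: d0_def \<psi>0_def indicator_def algebra_simps)
    also have "\<dots> = (LINT p|lborel. ?i p * (\<phi> n p * (deriv \<zeta> (fst p) * \<eta> (snd p))))
        - (LINT p|lborel. ?i p *\<^sub>R (u p * (deriv \<zeta> (fst p) * \<eta> (snd p))))"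
      by (rule Bochner_Integration.integral_diff[OF \<phi>L2(3)[OF _ tens(1)] mu(1)[unfolded set_integrable_def]]) blast
    finally show ?thesis using mu(2) by (simp add: set_lebesgue_integral_def)
  qed
  have e1: "(LINT p|lborel. d1 n p * \<psi>1 p) = (LINT p:cyl T|lborel. pdx (\<phi> n) p * (\<zeta> (fst p) * \<eta> (snd p)))
      - (LINT x:{0..}|lborel. mode T \<eta> ux x * \<zeta> x)" for n
  proof -
    have "(LINT p|lborel. d1 n p * \<psi>1 p) = (LINT p|lborel. ?i p * (pdx (\<phi> n) p * (\<zeta> (fst p) * \<eta> (snd p)))
        - ?i p *\<^sub>R (ux p * (\<zeta> (fst p) * \<eta> (snd p))))"
      by (rule Bochner_Integration.integral_cong) (auto simp: d1_def \<psi>1_def indicator_def algebra_simps)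
    also have "\<dots> = (LINT p|lborel. ?i p * (pdx (\<phi> n) p * (\<zeta> (fst p) * \<eta> (snd p))))
        - (LINT p|lborel. ?i p *\<^sub>R (ux p * (\<zeta> (fst p) * \<eta> (snd p))))"
      by (rule Bochner_Integration.integral_diff[OF \<phi>L2(3)[OF _ tens(2)] mx(1)[unfolded set_integrable_def]]) blast
    finally show ?thesis using mx(2) by (simp add: set_lebesgue_integral_def)
  qed
  let ?j = "indicator {0..<T} :: real \<Rightarrow> real"
  define \<delta> where "\<delta> n t = ?j t * \<phi> n (0, t) - ?j t * g t" for n t
  have bc: "continuous_on UNIV (\<lambda>t. \<phi> n (0, t))" for n
    by (rule continuous_on_compose2[OF smooth_plane_continuous(1)[OF sp, of UNIV n]]) (auto intro: continuous_intros)
  have jm: "(\<lambda>t. ?j t * h t) \<in> borel_measurable lborel" "integrable lborel (\<lambda>t. (?j t * h t)\<^sup>2)" "integrable lborel (\<lambda>t. ?j t * h t)"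
    if c: "continuous_on UNIV h" for h :: "real \<Rightarrow> real"
  proof -
    have "set_integrable lborel {0..<T} h" "set_integrable lborel {0..<T} (\<lambda>t. (h t)\<^sup>2)"
      unfolding set_integral_Ico_Icc
      by (intro borel_integrable_atLeastAtMost' continuous_on_power continuous_on_subset[OF c]; simp)+
    moreover have "?j t *\<^sub>R (h t)\<^sup>2 = (?j t * h t)\<^sup>2" for t by (auto simp: indicator_def)
    ultimately show "integrable lborel (\<lambda>t. (?j t * h t)\<^sup>2)" "integrable lborel (\<lambda>t. ?j t * h t)"
      by (simp_all add: set_integrable_def)
    then show "(\<lambda>t. ?j t * h t) \<in> borel_measurable lborel" by (blast dest: borel_measurable_integrable)
  qed
  have gm': "(\<lambda>t. ?j t * g t) \<in> borel_measurable lborel" using gm by (simp add: set_borel_measurable_def)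
  have gi': "integrable lborel (\<lambda>t. (?j t * g t)\<^sup>2)"
  proof -
    have "?j t *\<^sub>R (g t)\<^sup>2 = (?j t * g t)\<^sup>2" for t by (auto simp: indicator_def)
    then show ?thesis using g2 by (simp add: set_integrable_def)
  qed
  have \<delta>m: "\<delta> n \<in> borel_measurable lborel" for n unfolding \<delta>_def by (intro borel_measurable_diff jm(1) bc gm')
  have \<delta>i: "integrable lborel (\<lambda>t. (\<delta> n t)\<^sup>2)" for n unfolding \<delta>_def by (intro diff2 jm bc gm' gi')
  have \<delta>lim: "(\<lambda>n. LINT t|lborel. (\<delta> n t)\<^sup>2) \<longlonglongrightarrow> 0"
  proof -
    have "(LINT t:{0..<T}|lborel. (\<phi> n (0, t) - g t)\<^sup>2) = (LINT t|lborel. (\<delta> n t)\<^sup>2)" for n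
      unfolding set_lebesgue_integral_def \<delta>_def
      by (rule Bochner_Integration.integral_cong) (auto simp: indicator_def)
    then show ?thesis using tr0 by simp
  qed
  note l2 = L2_pairing_tendsto_zero(2)[OF \<delta>m \<delta>i \<delta>lim jm(1)[OF \<eta>(1)] jm(2)[OF \<eta>(1)]]
  have g1: "set_integrable lborel {0..<T} g" by (rule square_integrable_on_interval(1)[OF T gm g2])
  have g\<eta>: "set_integrable lborel {0..<T} (\<lambda>t. g t * \<eta> t)"
    using g1 unfolding set_integral_Ico_Icc by (intro set_integrable_continuous_mult continuous_on_subset[OF \<eta>(1)]) auto
  have e2: "(LINT t|lborel. \<delta> n t * (?j t * \<eta> t)) = (LINT t:{0..<T}|lborel. \<phi> n (0, t) * \<eta> t) - (LINT t:{0..<T}|lborel. g t * \<eta> t)" for n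
  proof -
    have "(LINT t|lborel. \<delta> n t * (?j t * \<eta> t)) = (LINT t|lborel. ?j t * (\<phi> n (0, t) * \<eta> t) - ?j t *\<^sub>R (g t * \<eta> t))"
      by (rule Bochner_Integration.integral_cong) (auto simp: \<delta>_def indicator_def algebra_simps)
    also have "\<dots> = (LINT t|lborel. ?j t * (\<phi> n (0, t) * \<eta> t)) - (LINT t|lborel. ?j t *\<^sub>R (g t * \<eta> t))"
      by (rule Bochner_Integration.integral_diff[OF jm(3)[OF continuous_on_mult[OF bc \<eta>(1)]] g\<eta>[unfolded set_integrable_def]])
    finally show ?thesis by (simp add: set_lebesgue_integral_def)
  qed
  define X where "X = (LINT x:{0..}|lborel. mode T \<eta> u x * deriv \<zeta> x)"
  define Y where "Y = (LINT x:{0..}|lborel. mode T \<eta> ux x * \<zeta> x)"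
  define Z where "Z = (LINT t:{0..<T}|lborel. g t * \<eta> t)"
  have "(\<lambda>n. (LINT p|lborel. d0 n p * \<psi>0 p) + (LINT p|lborel. d1 n p * \<psi>1 p) + \<zeta> 0 * (LINT t|lborel. \<delta> n t * (?j t * \<eta> t)))
      \<longlonglongrightarrow> 0 + 0 + \<zeta> 0 * 0"
    by (intro tendsto_intros l0 l1 l2)
  moreover have "(LINT p|lborel. d0 n p * \<psi>0 p) + (LINT p|lborel. d1 n p * \<psi>1 p) + \<zeta> 0 * (LINT t|lborel. \<delta> n t * (?j t * \<eta> t))
      = - X - Y - \<zeta> 0 * Z" for n
    using test_fun_Green[OF T \<phi>[of n] \<zeta> \<eta>(1)] unfolding e0 e1 e2 X_def[symmetric] Y_def[symmetric] Z_def[symmetric]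
    by (simp add: algebra_simps)
  ultimately have "- X - Y - \<zeta> 0 * Z = 0" by (simp add: LIMSEQ_const_iff)
  then show ?thesis by (simp add: X_def Y_def Z_def)
qed

section \<open>The mode equations of a weak solution\<close>

lemma continuous_on_half_line:
  fixes f :: "real \<Rightarrow> real"
  assumes "\<And>R. continuous_on {0..R} f" shows "continuous_on {0..} f"
  unfolding continuous_on_def
proof
  fix x :: real assume "x \<in> {0..}"
  then have "(f \<longlongrightarrow> f x) (at x within {0..x + 1})"
    using assms[of "x + 1"] unfolding continuous_on_def by auto
  moreover have "at x within {0..} = at x within {0..x + 1}"
    by (rule at_within_nhd[of x "{x - 1<..<x + 1}"]) auto
  ultimately show "(f \<longlongrightarrow> f x) (at x within {0..})" by simp
qed

text \<open>The weak equation contains \<open>V u\<^sub>t\<close>, while weak derivatives are only defined by smooth tests. The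
  derivative in \<open>t\<close> is therefore first transferred for almost every single \<open>x\<close>, and the
  discontinuous factor is multiplied afterwards.\<close>
lemma mode_weak_t_derivative:
  assumes T: "T > 0" and H1: "H1_cyl T u ux ut"
  shows "AE x in lborel. x > 0 \<longrightarrow>
    mode T (wave T k \<alpha>) ut x = - (of_int k * (2 * pi / T)) * mode T (wave T k (\<alpha> + pi / 2)) u x"
proof -
  let ?l = "of_int k * (2 * pi / T)" and ?e = "wave T k \<alpha>" and ?e2 = "wave T k (\<alpha> + pi / 2)"
  have L2: "L2_cyl T u" "L2_cyl T ut" using H1 by (auto simp: H1_cyl_def)
  define K where "K x = ?l * mode T ?e2 u x + mode T ?e ut x" for x
  note W = wave_continuous wave_bounded
  have iu: "set_integrable lborel {0..R} (mode T ?e2 u)" and iut: "set_integrable lborel {0..R} (mode T ?e ut)" for R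
    using mode_set_integrable[OF T L2(1) W] mode_set_integrable[OF T L2(2) W] by auto
  have K: "set_integrable lborel {0..R} K" for R
    unfolding K_def by (intro set_integral_add set_integrable_mult_right impI iu iut)
  have "AE x in lborel. x \<in> {1 / (real N + 1)<..<real N + 1} \<longrightarrow> K x = 0" for N :: nat
  proof (rule AE_zero_if_bump_integrals_zero)
    let ?c = "1 / (real N + 1)" and ?d = "real N + 1"
    have c: "?c > 0" by simp
    show "set_integrable lborel {?c<..<?d} K"
    proof (rule set_integrable_subset[OF K[of ?d]])
      have "0 \<le> ?c" by simp
      then show "{?c<..<?d} \<subseteq> {0..?d}" using less_imp_le[OF order_le_less_trans, of 0 ?c] by auto
    qed auto
    fix n a b :: real assume n: "n > 0" "?c \<le> a" "a < b" "b \<le> ?d"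
    let ?z = "bump n a b"
    have out: "?z x = 0" if "x < ?c" for x using that n by (intro bump_outside) auto
    have zm: "?z \<in> borel_measurable borel"
      by (intro borel_measurable_continuous_onI smooth_line_continuous smooth_bump)
    have zb: "\<bar>?z x\<bar> \<le> 1" for x using bump_bounds[of n a b x] by simp
    have zs: "?z x = 0" if "\<bar>x\<bar> > \<bar>a\<bar> + \<bar>b\<bar>" for x using that n by (intro bump_outside) auto
    note mu = mode_integral[OF T L2(1) W zm zb zs] and mt = mode_integral[OF T L2(2) W zm zb zs]
    have "(\<lambda>p. ?z (fst p) * ?e (snd p)) \<in> test_fun_interior T"
      by (rule tensor_test_fun_interior[OF bump_test[OF n(1)] wave_smooth wave_periodic[OF T] c out])
    then have "(LINT p:cyl T|lborel. u p * pdt (\<lambda>p. ?z (fst p) * ?e (snd p)) p) = - (LINT p:cyl T|lborel. ut p * (?z (fst p) * ?e (snd p)))"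
      using H1 unfolding H1_cyl_def by blast
    moreover have "(LINT p:cyl T|lborel. u p * pdt (\<lambda>p. ?z (fst p) * ?e (snd p)) p)
        = (LINT p:cyl T|lborel. ?l * (u p * (?z (fst p) * ?e2 (snd p))))"
      by (simp add: pdt_tensor[OF wave_smooth] wave_deriv algebra_simps)
    ultimately have eq: "?l * (LINT x:{0..}|lborel. mode T ?e2 u x * ?z x) + (LINT x:{0..}|lborel. mode T ?e ut x * ?z x) = 0"
      using mu(2) mt(2) by simp
    have cut: "(LINT x:{0..?d}|lborel. h x * ?z x) = (LINT x:{0..}|lborel. h x * ?z x)" for h
      unfolding set_lebesgue_integral_def
      by (rule Bochner_Integration.integral_cong) (use n in \<open>auto simp: indicator_def intro!: bump_outside\<close>)
    have iz: "set_integrable lborel {0..?d} (\<lambda>x. h x * ?z x)" if "set_integrable lborel {0..?d} h" for h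
      by (rule set_integrable_continuous_mult[OF that smooth_line_continuous[OF smooth_bump]])
    have "(LINT x:{?c<..<?d}|lborel. K x * ?z x) = (LINT x:{0..?d}|lborel. K x * ?z x)"
      unfolding set_lebesgue_integral_def
    proof (rule Bochner_Integration.integral_cong)
      fix x :: real
      show "indicator {?c<..<?d} x *\<^sub>R (K x * ?z x) = indicator {0..?d} x *\<^sub>R (K x * ?z x)"
      proof (cases "x \<in> {a<..<b}")
        case True then show ?thesis using n order_trans[OF less_imp_le[OF c] n(2)] by (simp add: indicator_def)
      qed (simp add: bump_outside n)
    qed simp
    also have "\<dots> = (LINT x:{0..?d}|lborel. ?l * (mode T ?e2 u x * ?z x) + mode T ?e ut x * ?z x)"
      by (simp add: K_def algebra_simps)
    also have "\<dots> = ?l * (LINT x:{0..?d}|lborel. mode T ?e2 u x * ?z x) + (LINT x:{0..?d}|lborel. mode T ?e ut x * ?z x)"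
      using iz[OF iu] iz[OF iut] by (subst set_integral_add) auto
    finally show "(LINT x:{?c<..<?d}|lborel. K x * ?z x) = 0" using eq by (simp add: cut)
  qed
  then have "AE x in lborel. \<forall>N::nat. x \<in> {1 / (real N + 1)<..<real N + 1} \<longrightarrow> K x = 0"
    by (simp only: AE_all_countable) simp
  then show ?thesis
  proof (rule AE_mp, intro AE_I2 impI)
    fix x :: real assume K0: "\<forall>N::nat. x \<in> {1 / (real N + 1)<..<real N + 1} \<longrightarrow> K x = 0" and x: "x > 0"
    obtain N :: nat where N: "max x (1 / x) < real N" using reals_Archimedean2 by blast
    have "1 / (real N + 1) < x"
    proof -
      have "1 / x < real N + 1" using N by simp
      then have "1 < x * (real N + 1)" using x by (simp add: field_simps)
      then show ?thesis by (simp add: field_simps)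
    qed
    then have "K x = 0" using K0 N by auto
    then show "mode T ?e ut x = - ?l * mode T ?e2 u x" by (simp add: K_def)
  qed
qed

lemma set_integral_cong_AE_half_line:
  fixes F G :: "real \<Rightarrow> real"
  assumes F: "set_integrable lborel {0..x} F" and G: "set_integrable lborel {0..x} G"
    and eq: "AE y in lborel. y > 0 \<longrightarrow> F y = G y"
  shows "(LINT y:{0..x}|lborel. F y) = (LINT y:{0..x}|lborel. G y)"
  unfolding set_lebesgue_integral_def
proof (rule integral_cong_AE)
  show "(\<lambda>y. indicator {0..x} y *\<^sub>R F y) \<in> borel_measurable lborel" "(\<lambda>y. indicator {0..x} y *\<^sub>R G y) \<in> borel_measurable lborel"
    using F G unfolding set_integrable_def by (blast dest: borel_measurable_integrable)+
  have "AE y in lborel. y \<noteq> (0::real)" by (rule AE_lborel_singleton)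
  with eq show "AE y in lborel. indicator {0..x} y *\<^sub>R F y = indicator {0..x} y *\<^sub>R G y"
    by eventually_elim (auto simp: indicator_def)
qed

lemma square_set_integrable_cong_AE:
  fixes F G :: "real \<Rightarrow> real"
  assumes F: "set_integrable lborel {0..} (\<lambda>x. (F x)\<^sup>2)" and G: "continuous_on {0..} G"
    and eq: "AE y in lborel. y > 0 \<longrightarrow> F y = G y"
  shows "set_integrable lborel {0..} (\<lambda>x. (G x)\<^sup>2)"
  unfolding set_integrable_def
proof (rule integrable_cong_AE_imp[OF F[unfolded set_integrable_def]])
  show "(\<lambda>x. indicator {0..} x *\<^sub>R (G x)\<^sup>2) \<in> borel_measurable lborel"
    using borel_measurable_continuous_on_indicator[OF _ continuous_on_power[OF G]] by simp
  have "AE y in lborel. y \<noteq> (0::real)" by (rule AE_lborel_singleton)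
  with eq show "AE y in lborel. indicator {0..} y *\<^sub>R (F y)\<^sup>2 = indicator {0..} y *\<^sub>R (G y)\<^sup>2"
    by eventually_elim (auto simp: indicator_def)
qed

text \<open>Green's formula for the trace is the equation \<open>U' = P\<close> with the initial value of \<open>U\<close>, and the weak
  equation is \<open>P' = - l\<^sup>2 V U\<close> with the initial value of \<open>P\<close>; both are integrated by
  \<open>du_Bois_Reymond_half_line\<close>.\<close>
lemma mode_system:
  fixes T :: real and k :: int
  defines "l \<equiv> of_int k * (2 * pi / T)"
  assumes T: "T > 0" and H1: "H1_cyl T u ux ut" and tr: "has_trace T u ux ut g"
    and Vm: "V \<in> borel_measurable borel" and Vb: "\<And>x. \<bar>V x\<bar> \<le> K"
    and weak: "\<And>\<phi>. \<phi> \<in> test_fun T \<Longrightarrow>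
      (LINT p:cyl T|lborel. - V (fst p) * ut p * pdt \<phi> p + ux p * pdx \<phi> p)
        - (LINT t:{0..<T}|lborel. q t * pdt \<phi> (0, t)) = 0"
  obtains U P where "continuous_on {0..} U" "continuous_on {0..} P"
    "\<And>x. x \<ge> 0 \<Longrightarrow> U x = (LINT t:{0..<T}|lborel. g t * wave T k \<alpha> t) + (LINT y:{0..x}|lborel. P y)"
    "\<And>x. x \<ge> 0 \<Longrightarrow> P x = - l * (LINT t:{0..<T}|lborel. q t * wave T k (\<alpha> + pi / 2) t)
        + (LINT y:{0..x}|lborel. - l\<^sup>2 * V y * U y)"
    "AE x in lborel. x > 0 \<longrightarrow> mode T (wave T k \<alpha>) u x = U x"
    "set_integrable lborel {0..} (\<lambda>x. (U x)\<^sup>2)" "set_integrable lborel {0..} (\<lambda>x. (P x)\<^sup>2)"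
proof -
  let ?e = "wave T k \<alpha>" and ?e2 = "wave T k (\<alpha> + pi / 2)"
  have L2: "L2_cyl T u" "L2_cyl T ux" "L2_cyl T ut" using H1 by (auto simp: H1_cyl_def)
  note W = wave_continuous wave_bounded
  define A where "A = mode T ?e u"
  define B where "B = mode T ?e ux"
  define C where "C x = - l\<^sup>2 * V x * A x" for x
  define G where "G = (LINT t:{0..<T}|lborel. g t * ?e t)"
  define F where "F = (LINT t:{0..<T}|lborel. q t * ?e2 t)"
  have A: "set_integrable lborel {0..R} A" and B: "set_integrable lborel {0..R} B" for R
    unfolding A_def B_def by (intro mode_set_integrable[OF T _ W] L2)+
  have Vint: "set_integrable lborel S (\<lambda>x. c * V x * h x)" if h: "set_integrable lborel S h" for S c and h :: "real \<Rightarrow> real"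
  proof (rule set_integrable_bound)
    show "set_integrable lborel S (\<lambda>x. c * K * h x)" using h by (rule set_integrable_mult_right)
    have "(\<lambda>x. indicator S x *\<^sub>R h x) \<in> borel_measurable lborel"
      using h unfolding set_integrable_def by (rule borel_measurable_integrable)
    then have "(\<lambda>x. (c * V x) * (indicator S x *\<^sub>R h x)) \<in> borel_measurable lborel"
      using Vm by simp
    then show "set_borel_measurable lborel S (\<lambda>x. c * V x * h x)"
      unfolding set_borel_measurable_def by (rule measurable_cong[THEN iffD1, rotated]) auto
    have "\<bar>c * V x * h x\<bar> \<le> \<bar>c * K * h x\<bar>" for x
      unfolding abs_mult using Vb[of x] by (intro mult_right_mono mult_left_mono) auto
    then show "AE x in lborel. x \<in> S \<longrightarrow> norm (c * V x * h x) \<le> norm (c * K * h x)" by simp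
  qed
  have C: "set_integrable lborel {0..R} C" for R unfolding C_def by (rule Vint[OF A])
  define U where "U x = G + (LINT y:{0..x}|lborel. B y)" for x
  define P where "P x = - l * F + (LINT y:{0..x}|lborel. C y)" for x
  have AU: "AE x in lborel. x > 0 \<longrightarrow> A x = U x"
    unfolding U_def
  proof (rule du_Bois_Reymond_half_line[OF A B])
    fix \<zeta> assume "test_line \<zeta>"
    then show "(LINT x:{0..}|lborel. A x * deriv \<zeta> x) + (LINT x:{0..}|lborel. B x * \<zeta> x) = - (\<zeta> 0 * G)"
      unfolding A_def B_def G_def by (rule trace_Green[OF T L2 tr _ W])
  qed
  have BP: "AE x in lborel. x > 0 \<longrightarrow> B x = P x"
    unfolding P_def
  proof (rule du_Bois_Reymond_half_line[OF B C])
    fix \<zeta> assume \<zeta>: "test_line \<zeta>"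
    have sm: "smooth_line \<zeta>" using \<zeta> by (simp add: test_line_def)
    obtain R M0 M1 where R: "\<And>x. \<bar>x\<bar> > R \<Longrightarrow> \<zeta> x = 0" and R': "\<And>x. \<bar>x\<bar> > R \<Longrightarrow> deriv \<zeta> x = 0"
    and M: "\<And>x. \<bar>deriv \<zeta> x\<bar> \<le> M0" "\<And>x. \<bar>\<zeta> x\<bar> \<le> M1"
    by (rule test_line_bounds[OF \<zeta>]) blast
    have zc: "continuous_on UNIV \<zeta>" "continuous_on UNIV (deriv \<zeta>)"
      by (intro smooth_line_continuous smooth_line_deriv sm)+
    then have zm: "\<zeta> \<in> borel_measurable borel" "deriv \<zeta> \<in> borel_measurable borel"
      by (auto intro: borel_measurable_continuous_onI)
    define Vz where "Vz x = V x * \<zeta> x" for x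
    have Vzm: "Vz \<in> borel_measurable borel" unfolding Vz_def using Vm zm by simp
    have Vzb: "\<bar>Vz x\<bar> \<le> K * M1" for x
      unfolding Vz_def abs_mult using Vb[of x] M(2)[of x] by (intro mult_mono) auto
    have Vzs: "Vz x = 0" if "\<bar>x\<bar> > R" for x using R[OF that] by (simp add: Vz_def)
    have mt: "set_integrable lborel (cyl T) (\<lambda>p. ut p * (Vz (fst p) * ?e2 (snd p)))"
      "(LINT p:cyl T|lborel. ut p * (Vz (fst p) * ?e2 (snd p))) = (LINT x:{0..}|lborel. mode T ?e2 ut x * Vz x)"
      by (rule mode_integral[OF T L2(3) wave_continuous wave_bounded Vzm Vzb Vzs]; assumption)+
    have mx: "set_integrable lborel (cyl T) (\<lambda>p. ux p * (deriv \<zeta> (fst p) * ?e (snd p)))"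
      "(LINT p:cyl T|lborel. ux p * (deriv \<zeta> (fst p) * ?e (snd p))) = (LINT x:{0..}|lborel. B x * deriv \<zeta> x)"
      unfolding B_def by (rule mode_integral[OF T L2(2) wave_continuous wave_bounded zm(2) M(1) R']; assumption)+
    let ?\<phi> = "\<lambda>p. \<zeta> (fst p) * ?e (snd p)"
    have "?\<phi> \<in> test_fun T" by (rule tensor_test_fun[OF \<zeta> wave_smooth wave_periodic[OF T]])
    from weak[OF this]
    have "(LINT p:cyl T|lborel. - l * (ut p * (Vz (fst p) * ?e2 (snd p))) + ux p * (deriv \<zeta> (fst p) * ?e (snd p)))
        = (LINT t:{0..<T}|lborel. (\<zeta> 0 * l) * (q t * ?e2 t))"
      by (simp add: pdt_tensor[OF wave_smooth] pdx_tensor[OF sm] wave_deriv l_def Vz_def algebra_simps)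
    moreover have "(LINT p:cyl T|lborel. - l * (ut p * (Vz (fst p) * ?e2 (snd p))) + ux p * (deriv \<zeta> (fst p) * ?e (snd p)))
        = - l * (LINT x:{0..}|lborel. mode T ?e2 ut x * Vz x) + (LINT x:{0..}|lborel. B x * deriv \<zeta> x)"
    proof -
      have e1: "(LINT p:cyl T|lborel. - l * (ut p * (Vz (fst p) * ?e2 (snd p)))) = - l * (LINT x:{0..}|lborel. mode T ?e2 ut x * Vz x)"
        by (simp only: set_integral_mult_right mt(2))
      have e2: "set_integrable lborel (cyl T) (\<lambda>p. - l * (ut p * (Vz (fst p) * ?e2 (snd p))))"
        by (intro set_integrable_mult_right impI mt(1))
      show ?thesis by (simp only: set_integral_add(2)[OF e2 mx(1)] mx(2) e1)
    qed
    moreover have "(LINT x:{0..}|lborel. mode T ?e2 ut x * Vz x) = (LINT x:{0..}|lborel. l * (A x * Vz x))"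
      unfolding set_lebesgue_integral_def
    proof (rule integral_cong_AE)
      have "(\<lambda>x. (indicator {0..} x * mode T ?e2 ut x) * Vz x) \<in> borel_measurable lborel"
        using mode_measurable[OF T L2(3) wave_continuous wave_bounded] Vzm by simp
      then show "(\<lambda>x. indicator {0..} x *\<^sub>R (mode T ?e2 ut x * Vz x)) \<in> borel_measurable lborel"
        by (simp add: mult.assoc)
      have "(\<lambda>x. l * ((indicator {0..} x * A x) * Vz x)) \<in> borel_measurable lborel"
        unfolding A_def using mode_measurable[OF T L2(1) wave_continuous wave_bounded] Vzm by simp
      then show "(\<lambda>x. indicator {0..} x *\<^sub>R (l * (A x * Vz x))) \<in> borel_measurable lborel"
        by (rule measurable_cong[THEN iffD1, rotated]) (simp add: algebra_simps)
      have "AE y in lborel. y \<noteq> (0::real)" by (rule AE_lborel_singleton)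
      with mode_weak_t_derivative[OF T H1, of k "\<alpha> + pi / 2", unfolded wave_shift_pi mode_uminus]
      show "AE x in lborel. indicator {0..} x *\<^sub>R (mode T ?e2 ut x * Vz x) = indicator {0..} x *\<^sub>R (l * (A x * Vz x))"
        by eventually_elim (auto simp: indicator_def A_def l_def)
    qed
    moreover have "(LINT x:{0..}|lborel. C x * \<zeta> x) = - l\<^sup>2 * (LINT x:{0..}|lborel. A x * Vz x)"
    proof -
      have "(\<lambda>x. C x * \<zeta> x) = (\<lambda>x. - l\<^sup>2 * (A x * Vz x))" by (auto simp: C_def Vz_def algebra_simps)
      then show ?thesis by (simp only: set_integral_mult_right)
    qed
    ultimately show "(LINT x:{0..}|lborel. B x * deriv \<zeta> x) + (LINT x:{0..}|lborel. C x * \<zeta> x) = - (\<zeta> 0 * (- l * F))"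
      by (simp add: F_def power2_eq_square algebra_simps)
  qed
  have Uc: "continuous_on {0..} U" and Pc: "continuous_on {0..} P"
    unfolding U_def P_def by (intro continuous_on_half_line continuous_intros primitive_continuous B C)+
  have ci: "set_integrable lborel {0..R} h" if "continuous_on {0..} h" for R and h :: "real \<Rightarrow> real"
    by (rule borel_integrable_atLeastAtMost'[OF continuous_on_subset[OF that]]) auto
  show ?thesis
  proof (rule that[OF Uc Pc])
    show "U x = (LINT t:{0..<T}|lborel. g t * ?e t) + (LINT y:{0..x}|lborel. P y)" for x
      unfolding U_def G_def[symmetric] using set_integral_cong_AE_half_line[OF B ci[OF Pc] BP] by simp
    have CU: "AE y in lborel. y > 0 \<longrightarrow> C y = - l\<^sup>2 * V y * U y"
      using AU by eventually_elim (simp add: C_def)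
    show "P x = - l * (LINT t:{0..<T}|lborel. q t * ?e2 t) + (LINT y:{0..x}|lborel. - l\<^sup>2 * V y * U y)" for x
      unfolding P_def F_def[symmetric]
      by (simp only: set_integral_cong_AE_half_line[OF C Vint[OF ci[OF Uc]] CU])
    show "AE x in lborel. x > 0 \<longrightarrow> mode T ?e u x = U x" using AU by (simp add: A_def)
    show "set_integrable lborel {0..} (\<lambda>x. (U x)\<^sup>2)"
      by (rule square_set_integrable_cong_AE[OF _ Uc AU]) (unfold A_def, rule mode_square_integrable[OF T L2(1) W])
    show "set_integrable lborel {0..} (\<lambda>x. (P x)\<^sup>2)"
      by (rule square_set_integrable_cong_AE[OF _ Pc BP]) (unfold B_def, rule mode_square_integrable[OF T L2(2) W])
  qed
qed

section \<open>The layered medium\<close>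

lemma finite_lattice: "finite {x \<in> {c..d::real}. \<exists>n::int. x = e + 2 * pi * n}"
proof (rule finite_subset)
  show "{x \<in> {c..d}. \<exists>n::int. x = e + 2 * pi * n} \<subseteq> (\<lambda>n::int. e + 2 * pi * n) ` {\<lfloor>(c - e) / (2 * pi)\<rfloor>..\<lceil>(d - e) / (2 * pi)\<rceil>}"
  proof
    fix x assume "x \<in> {x \<in> {c..d}. \<exists>n::int. x = e + 2 * pi * n}"
    then obtain n :: int where x: "x = e + 2 * pi * n" "c \<le> x" "x \<le> d" by auto
    then have "(c - e) / (2 * pi) \<le> n" "n \<le> (d - e) / (2 * pi)" by (auto simp: field_simps)
    then have "n \<in> {\<lfloor>(c - e) / (2 * pi)\<rfloor>..\<lceil>(d - e) / (2 * pi)\<rceil>}" by (simp; linarith)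
    then show "x \<in> (\<lambda>n::int. e + 2 * pi * n) ` {\<lfloor>(c - e) / (2 * pi)\<rfloor>..\<lceil>(d - e) / (2 * pi)\<rceil>}" using x by blast
  qed
qed simp

text \<open>The integers \<open>ma\<close> and \<open>mb\<close> are those of the two resonance conditions.\<close>
locale layered_medium =
  fixes T a b \<theta> :: real and ma mb :: nat
  assumes T: "T > 0" and a: "0 < a" and ab: "a < b" and th: "0 < \<theta>" "\<theta> < 1"
    and res_a: "4 * sqrt a * \<theta> * (2 * pi / T) = 2 * real ma + 1"
    and res_b: "4 * sqrt b * (1 - \<theta>) * (2 * pi / T) = 2 * real mb + 1"
begin

definition hw :: real where "hw = pi * \<theta>"
definition \<kappa> :: real where "\<kappa> = sqrt a / sqrt b"
text \<open>The \<open>a\<close>-layers are the intervals of half-width \<open>hw\<close> around \<open>2 \<pi> n\<close>. The numbers \<open>n1\<close> and \<open>n2\<close>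
  count the right and the left ends of \<open>a\<close>-layers up to \<open>x\<close>: a point lies in a \<open>b\<close>-layer if they
  agree, and in an \<open>a\<close>-layer if \<open>n2 x = n1 x + 1\<close>.\<close>
definition n1 :: "real \<Rightarrow> int" where "n1 x = \<lfloor>(x - hw) / (2 * pi)\<rfloor>"
definition n2 :: "real \<Rightarrow> int" where "n2 x = \<lfloor>(x + hw) / (2 * pi)\<rfloor>"
text \<open>The reciprocal \<open>sqrt (V x)\<close> of the wave speed.\<close>
definition slow :: "real \<Rightarrow> real" where "slow x = (if n1 x = n2 x then sqrt b else sqrt a)"
text \<open>The time in which a wave crosses half an \<open>a\<close>-layer.\<close>
definition h :: real where "h = sqrt a * hw"
text \<open>The time in which a wave crosses one period of the medium.\<close>
definition \<sigma> :: real where "\<sigma> = 2 * h + (2 * pi - 2 * hw) * sqrt b"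
text \<open>The signed travel time from the first interface \<open>hw\<close> to \<open>x\<close>, a primitive of \<open>slow\<close>.\<close>
definition s :: "real \<Rightarrow> real" where
  "s x = (if n1 x = n2 x then n1 x * \<sigma> + sqrt b * (x - hw - 2 * pi * n1 x)
          else n2 x * \<sigma> - h + sqrt a * (x - 2 * pi * n2 x))"
definition interfaces :: "real set" where
  "interfaces = {x. \<exists>n::int. x = hw + 2 * pi * n \<or> x = - (hw) + 2 * pi * n}"

lemma sqrt_pos: "0 < sqrt a" "sqrt a < sqrt b" "0 < sqrt b" using a ab by auto

lemma kappa: "0 < \<kappa>" "\<kappa> < 1" "\<kappa> * sqrt b = sqrt a"
  using sqrt_pos by (auto simp: \<kappa>_def)

lemma n1_iff: "n1 x = n \<longleftrightarrow> hw + 2 * pi * n \<le> x \<and> x < hw + 2 * pi * n + 2 * pi"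
  unfolding n1_def floor_eq_iff by (auto simp: field_simps)

lemma n2_iff: "n2 x = n \<longleftrightarrow> - (hw) + 2 * pi * n \<le> x \<and> x < - (hw) + 2 * pi * n + 2 * pi"
  unfolding n2_def floor_eq_iff by (auto simp: field_simps)

lemma n1_bounds: "hw + 2 * pi * n1 x \<le> x" "x < hw + 2 * pi * n1 x + 2 * pi"
  using n1_iff[of x "n1 x"] by auto

lemma n2_bounds: "- (hw) + 2 * pi * n2 x \<le> x" "x < - (hw) + 2 * pi * n2 x + 2 * pi"
  using n2_iff[of x "n2 x"] by auto

lemma hw: "0 < hw" "hw < pi" using th by (auto simp: hw_def)

lemma period_step:
  "2 * pi * real_of_int (n + 1) = 2 * pi * n + 2 * pi" "2 * pi * real_of_int (n - 1) = 2 * pi * n - 2 * pi"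
  by (simp_all add: algebra_simps)

lemma n1_n2: "n2 x = n1 x \<or> n2 x = n1 x + 1"
proof (cases "x < - (hw) + 2 * pi * n1 x + 2 * pi")
  case True
  then have "n2 x = n1 x" unfolding n2_iff using n1_bounds[of x] hw by linarith
  then show ?thesis ..
next
  case False
  then have "n2 x = n1 x + 1" unfolding n2_iff period_step using n1_bounds[of x] False hw by linarith
  then show ?thesis ..
qed

lemma n1_ge: "x \<ge> 0 \<Longrightarrow> n1 x \<ge> -1"
proof (rule ccontr)
  assume x: "x \<ge> 0" and "\<not> n1 x \<ge> -1"
  then have "n1 x \<le> -2" by simp
  then have "real_of_int (n1 x) \<le> -2" by linarith
  then have "2 * pi * n1 x \<le> 2 * pi * (-2)" by (intro mult_left_mono) auto
  then show False using n1_bounds(2)[of x] x hw by linarith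
qed

lemma n2_ge: "x \<ge> 0 \<Longrightarrow> n2 x \<ge> 0"
proof (rule ccontr)
  assume x: "x \<ge> 0" and "\<not> n2 x \<ge> 0"
  then have "real_of_int (n2 x) \<le> -1" by linarith
  then have "2 * pi * n2 x \<le> 2 * pi * (-1)" by (intro mult_left_mono) auto
  then show False using n2_bounds(2)[of x] x hw by linarith
qed

text \<open>Travel time from the left end of a \<open>b\<close>-layer within one period.\<close>
definition cell :: "real \<Rightarrow> real" where
  "cell y = sqrt b * min y ((2 * pi - 2 * hw)) + sqrt a * max 0 (y - (2 * pi - 2 * hw))"

lemma s_cell: "s x = n1 x * \<sigma> + cell (x - hw - 2 * pi * n1 x)"
proof (cases "n1 x = n2 x")
  case True
  have "x - hw - 2 * pi * n1 x \<le> (2 * pi - 2 * hw)"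
    using n2_bounds(2)[of x] True by (simp add: algebra_simps)
  then show ?thesis using True by (simp add: s_def cell_def)
next
  case False
  then have n: "n2 x = n1 x + 1" using n1_n2[of x] by auto
  have "x - hw - 2 * pi * n1 x \<ge> (2 * pi - 2 * hw)"
    using n2_bounds(1)[of x] n by (simp add: algebra_simps)
  then have "cell (x - hw - 2 * pi * n1 x) = sqrt b * ((2 * pi - 2 * hw)) + sqrt a * (x - hw - 2 * pi * n1 x - (2 * pi - 2 * hw))"
    by (simp add: cell_def)
  then show ?thesis using False n by (simp add: s_def \<sigma>_def h_def algebra_simps)
qed

lemma cell_diff:
  assumes "y \<le> z" shows "0 \<le> cell z - cell y" "cell z - cell y \<le> sqrt b * (z - y)"
proof -
  define L where "L = (2 * pi - 2 * hw)"
  have p: "min y L \<le> min z L" "max 0 (y - L) \<le> max 0 (z - L)"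
    "(min z L - min y L) + (max 0 (z - L) - max 0 (y - L)) = z - y" using assms by auto
  have e: "cell z - cell y = sqrt b * (min z L - min y L) + sqrt a * (max 0 (z - L) - max 0 (y - L))"
    by (simp add: cell_def L_def algebra_simps)
  show "0 \<le> cell z - cell y" unfolding e using p sqrt_pos by (intro add_nonneg_nonneg mult_nonneg_nonneg) auto
  have "cell z - cell y \<le> sqrt b * (min z L - min y L) + sqrt b * (max 0 (z - L) - max 0 (y - L))"
    unfolding e using p sqrt_pos by (intro add_left_mono mult_right_mono) auto
  also have "\<dots> = sqrt b * (z - y)" using p(3) by (metis distrib_left)
  finally show "cell z - cell y \<le> sqrt b * (z - y)" .
qed

lemma cell_0: "cell 0 = 0" using hw by (simp add: cell_def)

lemma cell_period: "cell (2 * pi) = \<sigma>"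
  using hw by (simp add: cell_def \<sigma>_def h_def algebra_simps)

lemma n1_mono: "x \<le> y \<Longrightarrow> n1 x \<le> n1 y"
  unfolding n1_def by (intro floor_mono divide_right_mono) auto

lemma n2_mono: "x \<le> y \<Longrightarrow> n2 x \<le> n2 y"
  unfolding n2_def by (intro floor_mono divide_right_mono) auto

text \<open>Inside a period this is the slope bound for \<open>cell\<close>. Otherwise the travel time splits into a
  final piece of the first period, full periods, and an initial piece of the last one.\<close>
lemma s_mono_Lipschitz:
  assumes "x \<le> y" shows "0 \<le> s y - s x \<and> s y - s x \<le> sqrt b * (y - x)"
proof (cases "n1 x = n1 y")
  case True
  then have "s y - s x = cell (y - hw - 2 * pi * n1 y) - cell (x - hw - 2 * pi * n1 x)"
    by (simp add: s_cell)
  then show ?thesis using cell_diff[of "x - hw - 2 * pi * n1 x" "y - hw - 2 * pi * n1 y"] True assms by simp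
next
  case False
  define N where "N = n1 y - n1 x - 1"
  have N: "N \<ge> 0" using n1_mono[OF assms] False by (simp add: N_def)
  define x' where "x' = x - hw - 2 * pi * n1 x"
  define y' where "y' = y - hw - 2 * pi * n1 y"
  have x': "0 \<le> x'" "x' \<le> 2 * pi" and y': "0 \<le> y'" "y' \<le> 2 * pi"
    using n1_bounds[of x] n1_bounds[of y] by (auto simp: x'_def y'_def)
  have e: "s y - s x = N * \<sigma> + (\<sigma> - cell x') + (cell y' - cell 0)"
    by (simp add: s_cell x'_def y'_def N_def cell_0 algebra_simps)
  have c: "0 \<le> \<sigma> - cell x'" "\<sigma> - cell x' \<le> sqrt b * (2 * pi - x')" "0 \<le> cell y' - cell 0" "cell y' - cell 0 \<le> sqrt b * (y' - 0)"
    using cell_diff[OF x'(2)] cell_diff[OF y'(1)] by (auto simp: cell_period)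
  have "0 \<le> \<sigma>" "\<sigma> \<le> sqrt b * (2 * pi)" using cell_diff[of 0 "2 * pi"] by (auto simp: cell_0 cell_period)
  then have "0 \<le> N * \<sigma>" "N * \<sigma> \<le> N * (sqrt b * (2 * pi))" using N by (auto intro: mult_left_mono)
  moreover have "N * (sqrt b * (2 * pi)) + sqrt b * (2 * pi - x') + sqrt b * (y' - 0) = sqrt b * (y - x)"
    by (simp add: N_def x'_def y'_def algebra_simps)
  ultimately show ?thesis using c unfolding e by linarith
qed

lemma s_Lipschitz: "\<bar>s x - s y\<bar> \<le> sqrt b * \<bar>x - y\<bar>"
  using s_mono_Lipschitz[of x y] s_mono_Lipschitz[of y x] by (cases "x \<le> y") auto

lemma s_continuous: "continuous_on S s"
proof -
  have "continuous_on UNIV s"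
    unfolding continuous_on_iff
  proof (intro ballI allI impI)
    fix x e :: real assume "e > 0"
    then show "\<exists>d>0. \<forall>y\<in>UNIV. dist y x < d \<longrightarrow> dist (s y) (s x) < e"
    proof (intro exI[of _ "e / sqrt b"] conjI ballI impI)
      fix y assume "dist y x < e / sqrt b"
      then have "sqrt b * \<bar>y - x\<bar> < e" using sqrt_pos by (simp add: dist_real_def field_simps)
      then show "dist (s y) (s x) < e" using s_Lipschitz[of y x] by (simp add: dist_real_def)
    qed (use sqrt_pos in simp)
  qed
  then show ?thesis by (rule continuous_on_subset) simp
qed

lemma s_n1_interface: "s (hw + 2 * pi * of_int n) = of_int n * \<sigma>"
proof -
  have "n1 (hw + 2 * pi * of_int n) = n" by (simp add: n1_iff)
  then show ?thesis by (simp add: s_cell cell_0)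
qed

lemma s_n2_interface: "s (- (hw) + 2 * pi * of_int n) = of_int n * \<sigma> - 2 * h"
proof -
  have 1: "n2 (- (hw) + 2 * pi * of_int n) = n" by (simp add: n2_iff)
  have 2: "n1 (- (hw) + 2 * pi * of_int n) = n - 1" unfolding n1_iff period_step using hw by linarith
  show ?thesis unfolding s_def 1 2 by (simp add: h_def algebra_simps)
qed

lemma s_0: "s 0 = - h"
proof -
  have "n2 0 = 0" "n1 0 = -1" unfolding n1_iff n2_iff using hw by simp_all
  then show ?thesis by (simp add: s_def)
qed

lemma n1_0: "n1 0 = -1" and n2_0: "n2 0 = 0"
  unfolding n1_iff n2_iff using hw by simp_all

lemma n1_jump:
  assumes "n1 x \<noteq> n1 y" "x \<le> y"
  obtains n :: int where "x \<le> hw + 2 * pi * n" "hw + 2 * pi * n \<le> y"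
proof
  have "n1 x + 1 \<le> n1 y" using assms n1_mono by force
  then have "2 * pi * (real_of_int (n1 x) + 1) \<le> 2 * pi * real_of_int (n1 y)" by (intro mult_left_mono) (linarith | simp)+
  then show "x \<le> hw + 2 * pi * n1 y" using n1_bounds(2)[of x] by (simp add: algebra_simps)
qed (rule n1_bounds)

lemma n2_jump:
  assumes "n2 x \<noteq> n2 y" "x \<le> y"
  obtains n :: int where "x \<le> - (hw) + 2 * pi * n" "- (hw) + 2 * pi * n \<le> y"
proof
  have "n2 x + 1 \<le> n2 y" using assms n2_mono by force
  then have "2 * pi * (real_of_int (n2 x) + 1) \<le> 2 * pi * real_of_int (n2 y)" by (intro mult_left_mono) (linarith | simp)+
  then show "x \<le> - (hw) + 2 * pi * n2 y" using n2_bounds(2)[of x] by (simp add: algebra_simps)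
qed (rule n2_bounds)

lemma slow_pos: "slow x > 0" "slow x \<le> sqrt b" using sqrt_pos by (auto simp: slow_def)

text \<open>The identity behind the continuity of both partial derivatives across the interfaces:
  \<open>\<kappa> powi n1 x\<close> is the amplitude of the time derivative and changes at the right ends of the
  \<open>a\<close>-layers only, whereas the amplitude \<open>sqrt b * \<kappa> powi n2 x\<close> of the derivative in \<open>x\<close> changes
  at the left ends only.\<close>
lemma kappa_slow: "\<kappa> powi n1 x * slow x = sqrt b * \<kappa> powi n2 x"
proof (cases "n1 x = n2 x")
  case False
  then have "n2 x = n1 x + 1" using n1_n2[of x] by auto
  then have "\<kappa> powi n2 x = \<kappa> powi n1 x * \<kappa>" using kappa by (simp add: power_int_add)
  then show ?thesis using False kappa(3) by (simp add: slow_def mult.commute mult.left_commute)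
qed (simp add: slow_def)

lemma kappa_n1_le: "x \<ge> 0 \<Longrightarrow> \<bar>\<kappa> powi n1 x\<bar> \<le> 1 / \<kappa>"
proof -
  assume "x \<ge> 0"
  then have "\<kappa> powi n1 x \<le> \<kappa> powi (-1)" using kappa n1_ge by (intro power_int_decreasing) auto
  then show ?thesis using kappa by (simp add: power_int_minus inverse_eq_divide)
qed

lemma kappa_n2_le: "x \<ge> 0 \<Longrightarrow> \<bar>\<kappa> powi n2 x\<bar> \<le> 1"
proof -
  assume "x \<ge> 0"
  then have "\<kappa> powi n2 x \<le> \<kappa> powi 0" using kappa n2_ge by (intro power_int_decreasing) auto
  then show ?thesis using kappa by simp
qed

lemma floor_locally_constant:
  fixes q :: real
  assumes "q \<notin> \<int>"
  shows "\<forall>\<^sub>F p in nhds q. \<lfloor>p\<rfloor> = \<lfloor>q\<rfloor>"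
proof -
  have "of_int \<lfloor>q\<rfloor> < q" using assms by (metis Ints_of_int floor_less_cancel floor_of_int of_int_floor_le order_le_less)
  moreover have "q < of_int \<lfloor>q\<rfloor> + 1" by linarith
  ultimately have "\<forall>\<^sub>F p in nhds q. p \<in> {of_int \<lfloor>q\<rfloor><..<of_int \<lfloor>q\<rfloor> + 1}"
    by (intro eventually_nhds_in_open) auto
  then show ?thesis by eventually_elim (auto simp: floor_eq_iff)
qed

lemma layer_index_locally_constant:
  assumes "x \<notin> interfaces"
  shows "\<forall>\<^sub>F y in nhds x. n1 y = n1 x \<and> n2 y = n2 x"
proof -
  have "(x - hw) / (2 * pi) \<notin> \<int>" "(x + hw) / (2 * pi) \<notin> \<int>"
    using assms by (auto simp: interfaces_def Ints_def field_simps)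
  then have "\<forall>\<^sub>F p in nhds ((x - hw) / (2 * pi)). \<lfloor>p\<rfloor> = n1 x" "\<forall>\<^sub>F p in nhds ((x + hw) / (2 * pi)). \<lfloor>p\<rfloor> = n2 x"
    unfolding n1_def n2_def by (auto intro: floor_locally_constant)
  moreover have "filterlim (\<lambda>y. (y - hw) / (2 * pi)) (nhds ((x - hw) / (2 * pi))) (nhds x)"
    "filterlim (\<lambda>y. (y + hw) / (2 * pi)) (nhds ((x + hw) / (2 * pi))) (nhds x)"
    by (intro tendsto_intros filterlim_ident; simp)+
  ultimately have "\<forall>\<^sub>F y in nhds x. \<lfloor>(y - hw) / (2 * pi)\<rfloor> = n1 x" "\<forall>\<^sub>F y in nhds x. \<lfloor>(y + hw) / (2 * pi)\<rfloor> = n2 x"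
    unfolding filterlim_iff by blast+
  then show ?thesis by eventually_elim (simp add: n1_def n2_def)
qed

lemma s_affine_in_layer:
  assumes "n1 y = n1 x" "n2 y = n2 x" shows "s y = s x + slow x * (y - x)"
  using assms by (simp add: s_def slow_def algebra_simps)

lemma s_DERIV:
  assumes "x \<notin> interfaces" shows "(s has_real_derivative slow x) (at x)"
proof -
  have "((\<lambda>y. s x + slow x * (y - x)) has_real_derivative slow x) (at x)"
    by (auto intro!: derivative_eq_intros)
  moreover have "\<forall>\<^sub>F y in nhds x. s y = s x + slow x * (y - x)"
    using layer_index_locally_constant[OF assms] by eventually_elim (auto intro: s_affine_in_layer)
  ultimately show ?thesis by (subst DERIV_cong_ev) auto
qed

lemma finite_interfaces: "finite (interfaces \<inter> {c..d})"
proof -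
  have "interfaces \<inter> {c..d} \<subseteq> {x \<in> {c..d}. \<exists>n::int. x = hw + 2 * pi * n} \<union> {x \<in> {c..d}. \<exists>n::int. x = - (hw) + 2 * pi * n}"
    by (auto simp: interfaces_def)
  then show ?thesis by (rule finite_subset) (intro finite_UnI finite_lattice)
qed

text \<open>In units of the period \<open>T\<close>, every layer is crossed in an odd number of quarters, and hence every period of the
  medium in a number of halves.\<close>
lemma resonance: "2 * h = (2 * real ma + 1) * (T / 4)" "\<sigma> = (real ma + real mb + 1) * (T / 2)"
proof -
  have "(2 * real ma + 1) * (T / 4) = 4 * sqrt a * \<theta> * (2 * pi / T) * (T / 4)" by (simp only: res_a)
  also have "\<dots> = 2 * h" using T by (simp add: h_def hw_def field_simps)
  finally show 1: "2 * h = (2 * real ma + 1) * (T / 4)" ..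
  have "(2 * real mb + 1) * (T / 4) = 4 * sqrt b * (1 - \<theta>) * (2 * pi / T) * (T / 4)" by (simp only: res_b)
  also have "\<dots> = (2 * pi - 2 * hw) * sqrt b" using T by (simp add: hw_def field_simps)
  finally have "(2 * pi - 2 * hw) * sqrt b = (2 * real mb + 1) * (T / 4)" ..
  then show "\<sigma> = (real ma + real mb + 1) * (T / 2)"
    unfolding \<sigma>_def 1 by (simp add: field_simps)
qed

text \<open>The exceptional points are those at which the potential is unspecified.\<close>
lemma potential_eq_slow:
  assumes V: "step_potential a b \<theta> V" and x: "x \<notin> interfaces" "\<And>n::int. x \<noteq> pi + 2 * pi * n"
  shows "V x = (slow x)\<^sup>2"
proof -
  define n where "n = \<lfloor>(x + pi) / (2 * pi)\<rfloor>"
  define y where "y = x - 2 * pi * n"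
  have per: "V (z + 2 * pi * of_int m) = V z" for z and m :: int
  proof -
    have up: "V (z + 2 * pi * real k) = V z" for z k
    proof (induction k)
      case (Suc k)
      have "V (z + 2 * pi * real (Suc k)) = V ((z + 2 * pi * real k) + 2 * pi)" by (simp add: algebra_simps)
      then show ?case using V Suc unfolding step_potential_def by simp
    qed simp
    show ?thesis
    proof (cases "m \<ge> 0")
      case True then show ?thesis using up[of z "nat m"] by simp
    next
      case False then show ?thesis using up[of "z + 2 * pi * of_int m" "nat (- m)"] by simp
    qed
  qed
  have Vy: "V x = V y" using per[of y n] by (simp add: y_def)
  have "of_int n \<le> (x + pi) / (2 * pi)" "(x + pi) / (2 * pi) < of_int n + 1" unfolding n_def by linarith+
  then have y: "- pi \<le> y" "y < pi" by (auto simp: y_def field_simps)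
  have "y \<noteq> - pi"
  proof
    assume "y = - pi"
    then have "x = pi + 2 * pi * (n - 1)" by (simp add: y_def algebra_simps)
    then show False using x(2)[of "n - 1"] by simp
  qed
  then have y': "\<bar>y\<bar> < pi" using y by auto
  have ne: "\<bar>y\<bar> \<noteq> hw"
  proof
    assume "\<bar>y\<bar> = hw"
    then have "x = hw + 2 * pi * n \<or> x = - (hw) + 2 * pi * n" by (auto simp: y_def abs_if split: if_splits)
    then show False using x(1) by (auto simp: interfaces_def)
  qed
  consider "\<bar>y\<bar> < hw" | "y > hw" | "y < - (hw)" using ne by linarith
  then show ?thesis
  proof cases
    case 1
    then have "n2 x = n" "n1 x = n - 1" unfolding n1_iff n2_iff period_step using hw by (auto simp: y_def abs_less_iff)
    then show ?thesis using 1 V a Vy by (simp add: slow_def step_potential_def hw_def)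
  next
    case 2
    then have "n2 x = n" "n1 x = n" unfolding n1_iff n2_iff period_step using hw y by (auto simp: y_def)
    then show ?thesis using 2 V a ab Vy y' by (simp add: slow_def step_potential_def hw_def mult.commute)
  next
    case 3
    then have "n2 x = n - 1" "n1 x = n - 1" unfolding n1_iff n2_iff period_step using hw y by (auto simp: y_def)
    then show ?thesis using 3 V a ab Vy y' by (simp add: slow_def step_potential_def hw_def mult.commute)
  qed
qed

end

section \<open>Square-integrable solutions of the mode equations\<close>

text \<open>A constant dominated by square-integrable functions is square-integrable on the half-line.\<close>
lemma square_integrable_constant_zero:
  fixes U P :: "real \<Rightarrow> real"
  assumes U: "set_integrable lborel {0..} (\<lambda>x. (U x)\<^sup>2)" and P: "set_integrable lborel {0..} (\<lambda>x. (P x)\<^sup>2)"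
    and le: "\<And>x. x \<ge> 0 \<Longrightarrow> \<bar>c\<bar> \<le> M * (\<bar>U x\<bar> + \<bar>P x\<bar>)"
  shows "c = 0"
proof (rule ccontr)
  assume c: "c \<noteq> 0"
  have sq: "c\<^sup>2 \<le> 2 * M\<^sup>2 * ((U x)\<^sup>2 + (P x)\<^sup>2)" if "x \<ge> 0" for x
  proof -
    have "\<bar>c\<bar>\<^sup>2 \<le> (M * (\<bar>U x\<bar> + \<bar>P x\<bar>))\<^sup>2" using le[OF that] by (intro power_mono) auto
    also have "\<dots> = M\<^sup>2 * (\<bar>U x\<bar> + \<bar>P x\<bar>)\<^sup>2" by (simp add: power_mult_distrib)
    also have "(\<bar>U x\<bar> + \<bar>P x\<bar>)\<^sup>2 \<le> 2 * ((U x)\<^sup>2 + (P x)\<^sup>2)"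
      using sum_squares_bound[of "\<bar>U x\<bar>" "\<bar>P x\<bar>"] by (simp add: power2_sum)
    then have "M\<^sup>2 * (\<bar>U x\<bar> + \<bar>P x\<bar>)\<^sup>2 \<le> M\<^sup>2 * (2 * ((U x)\<^sup>2 + (P x)\<^sup>2))" by (rule mult_left_mono) simp
    finally show ?thesis by (simp add: algebra_simps)
  qed
  have "set_integrable lborel {0..} (\<lambda>x. 2 * M\<^sup>2 * ((U x)\<^sup>2 + (P x)\<^sup>2))"
    by (intro set_integrable_mult_right impI set_integral_add U P)
  then have "set_integrable lborel {0..} (\<lambda>x::real. c\<^sup>2)"
  proof (rule set_integrable_bound)
    show "set_borel_measurable lborel {0..} (\<lambda>x::real. c\<^sup>2)" by (simp add: set_borel_measurable_def)
    show "AE x in lborel. x \<in> {0..} \<longrightarrow> norm (c\<^sup>2) \<le> norm (2 * M\<^sup>2 * ((U x)\<^sup>2 + (P x)\<^sup>2))"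
      using sq by (auto intro!: AE_I2 order_trans[OF _ abs_ge_self])
  qed
  then have i: "integrable lborel (\<lambda>x::real. indicator {0..} x *\<^sub>R c\<^sup>2)"
    by (simp only: set_integrable_def)
  have "integrable lborel (\<lambda>x::real. inverse (c\<^sup>2) * (indicator {0..} x *\<^sub>R c\<^sup>2))"
    by (rule integrable_mult_right[OF i])
  then have "integrable lborel (indicator {0..} :: real \<Rightarrow> real)"
    using c by (simp add: field_simps)
  then have fin: "emeasure lborel {0::real..} < \<infinity>" by (simp add: integrable_indicator_iff)
  have "of_nat n \<le> emeasure lborel {0::real..}" for n :: nat
  proof -
    have "emeasure lborel {0..real n} \<le> emeasure lborel {0::real..}" by (rule emeasure_mono) auto
    then show ?thesis by (simp add: ennreal_of_nat_eq_real_of_nat)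
  qed
  then have "emeasure lborel {0::real..} = \<infinity>"
    using ennreal_Ex_less_of_nat fin by (metis infinity_ennreal_def linorder_not_le)
  then show False using fin by simp
qed

lemma primitive_DERIV:
  fixes f :: "real \<Rightarrow> real"
  assumes W: "\<And>x. x \<ge> 0 \<Longrightarrow> W x = c + (LINT y:{0..x}|lborel. f y)"
    and f: "\<And>R. set_integrable lborel {0..R} f" and x: "x > 0" and cont: "isCont f x"
  shows "(W has_real_derivative f x) (at x)"
proof -
  have "f integrable_on {0..x + 1}" using set_borel_integral_eq_integral(1)[OF f] .
  then have "((\<lambda>u. integral {0..u} f) has_vector_derivative f x) (at x within ({0..x + 1} - {}))"
    by (rule integral_has_vector_derivative_continuous_at)
      (use x cont in \<open>auto intro: continuous_at_imp_continuous_at_within\<close>)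
  moreover have "at x within ({0..x + 1} - {}) = at x" using x by (intro at_within_interior) simp
  ultimately have "((\<lambda>u. integral {0..u} f) has_real_derivative f x) (at x)"
    by (simp add: has_real_derivative_iff_has_vector_derivative)
  then have "((\<lambda>u. c + integral {0..u} f) has_real_derivative 0 + f x) (at x)"
    by (intro DERIV_add DERIV_const)
  then have "((\<lambda>u. c + integral {0..u} f) has_real_derivative f x) (at x)" by simp
  then show ?thesis
  proof (rule has_field_derivative_transform_within_open[where S = "{0<..}"])
    fix u :: real assume "u \<in> {0<..}"
    then show "c + integral {0..u} f = W u"
      using W[of u] set_borel_integral_eq_integral(2)[OF f[of u]] by simp
  qed (use x in auto)
qed

context layered_medium
begin

lemma n1_locally_constant:
  assumes "\<And>n::int. x \<noteq> hw + 2 * pi * n" shows "\<forall>\<^sub>F y in nhds x. n1 y = n1 x"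
proof -
  have "(x - hw) / (2 * pi) \<notin> \<int>" using assms by (auto simp: Ints_def field_simps)
  then have "\<forall>\<^sub>F p in nhds ((x - hw) / (2 * pi)). \<lfloor>p\<rfloor> = n1 x"
    unfolding n1_def by (auto intro: floor_locally_constant)
  moreover have "filterlim (\<lambda>y. (y - hw) / (2 * pi)) (nhds ((x - hw) / (2 * pi))) (nhds x)"
    by (intro tendsto_intros filterlim_ident; simp)
  ultimately show ?thesis unfolding filterlim_iff n1_def by blast
qed

lemma n2_locally_constant:
  assumes "\<And>n::int. x \<noteq> - hw + 2 * pi * n" shows "\<forall>\<^sub>F y in nhds x. n2 y = n2 x"
proof -
  have "(x + hw) / (2 * pi) \<notin> \<int>" using assms by (auto simp: Ints_def field_simps)
  then have "\<forall>\<^sub>F p in nhds ((x + hw) / (2 * pi)). \<lfloor>p\<rfloor> = n2 x"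
    unfolding n2_def by (auto intro: floor_locally_constant)
  moreover have "filterlim (\<lambda>y. (y + hw) / (2 * pi)) (nhds ((x + hw) / (2 * pi))) (nhds x)"
    by (intro tendsto_intros filterlim_ident; simp)
  ultimately show ?thesis unfolding filterlim_iff n2_def by blast
qed

text \<open>A step factor does not destroy continuity if the other factor vanishes wherever it jumps.\<close>
lemma floor_step_product_continuous:
  fixes A :: "real \<Rightarrow> real" and f :: "int \<Rightarrow> real" and n :: "real \<Rightarrow> int"
  assumes A: "continuous_on UNIV A"
    and const: "\<And>x. A x \<noteq> 0 \<Longrightarrow> \<forall>\<^sub>F y in nhds x. n y = n x"
    and near: "\<And>x. \<forall>\<^sub>F y in nhds x. n y \<in> {n x - 1..n x + 1}"
  shows "continuous_on UNIV (\<lambda>x. f (n x) * A x)"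
  unfolding continuous_on_eq_continuous_at[OF open_UNIV]
proof
  fix x
  have Ax: "isCont A x" using A by (simp add: continuous_on_eq_continuous_at)
  show "isCont (\<lambda>x. f (n x) * A x) x"
  proof (cases "A x = 0")
    case False
    have "isCont (\<lambda>y. f (n x) * A y) x" using Ax by simp
    moreover have "\<forall>\<^sub>F y in nhds x. f (n x) * A y = f (n y) * A y"
      using const[OF False] by eventually_elim simp
    ultimately show ?thesis by (simp add: isCont_cong)
  next
    case True
    define B where "B = Max ((\<lambda>i. \<bar>f i\<bar>) ` {n x - 1..n x + 1})"
    have le: "\<forall>\<^sub>F y in at x. norm (f (n y)) \<le> B"
      using near[of x] unfolding eventually_at_filter
      by eventually_elim (auto simp: B_def intro!: Max_ge)
    have "(A \<longlongrightarrow> 0) (at x)" using Ax True by (simp add: isCont_def)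
    then have lim: "((\<lambda>y. B * \<bar>A y\<bar>) \<longlongrightarrow> 0) (at x)"
      by (intro tendsto_mult_right_zero tendsto_rabs_zero)
    have "((\<lambda>y. f (n y) * A y) \<longlongrightarrow> 0) (at x)"
    proof (rule Lim_null_comparison[OF _ lim])
      show "\<forall>\<^sub>F y in at x. norm (f (n y) * A y) \<le> B * \<bar>A y\<bar>"
        using le by eventually_elim (simp add: abs_mult mult_right_mono)
    qed
    then show ?thesis using True by (simp add: isCont_def)
  qed
qed

lemma n1_near: "\<forall>\<^sub>F y in nhds x. n1 y \<in> {n1 x - 1..n1 x + 1}"
proof -
  have "\<forall>\<^sub>F y in nhds x. y \<in> {x - pi<..<x + pi}" by (intro eventually_nhds_in_open) auto
  then show ?thesis
  proof eventually_elim
    case (elim y)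
    have "n1 y \<le> n1 (x + 2 * pi)" "n1 (x - 2 * pi) \<le> n1 y" using elim by (auto intro!: n1_mono)
    moreover have "n1 (x + 2 * pi) = n1 x + 1" "n1 (x - 2 * pi) = n1 x - 1"
      unfolding n1_iff period_step using n1_bounds[of x] by auto
    ultimately show ?case by simp
  qed
qed

lemma n2_near: "\<forall>\<^sub>F y in nhds x. n2 y \<in> {n2 x - 1..n2 x + 1}"
proof -
  have "\<forall>\<^sub>F y in nhds x. y \<in> {x - pi<..<x + pi}" by (intro eventually_nhds_in_open) auto
  then show ?thesis
  proof eventually_elim
    case (elim y)
    have "n2 y \<le> n2 (x + 2 * pi)" "n2 (x - 2 * pi) \<le> n2 y" using elim by (auto intro!: n2_mono)
    moreover have "n2 (x + 2 * pi) = n2 x + 1" "n2 (x - 2 * pi) = n2 x - 1"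
      unfolding n2_iff period_step using n2_bounds[of x] by auto
    ultimately show ?case by simp
  qed
qed

lemma n1_product_continuous:
  fixes A :: "real \<Rightarrow> real" and f :: "int \<Rightarrow> real"
  assumes "continuous_on UNIV A" "\<And>n::int. A (hw + 2 * pi * n) = 0"
  shows "continuous_on UNIV (\<lambda>x. f (n1 x) * A x)"
proof (rule floor_step_product_continuous[where n = n1, OF assms(1)])
  show "\<forall>\<^sub>F y in nhds x. n1 y = n1 x" if "A x \<noteq> 0" for x
    by (rule n1_locally_constant) (use assms(2) that in auto)
qed (rule n1_near)

lemma n2_product_continuous:
  fixes A :: "real \<Rightarrow> real" and f :: "int \<Rightarrow> real"
  assumes "continuous_on UNIV A" "\<And>n::int. A (- hw + 2 * pi * n) = 0"
  shows "continuous_on UNIV (\<lambda>x. f (n2 x) * A x)"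
proof (rule floor_step_product_continuous[where n = n2, OF assms(1)])
  show "\<forall>\<^sub>F y in nhds x. n2 y = n2 x" if "A x \<noteq> 0" for x
    by (rule n2_locally_constant) (use assms(2) that in auto)
qed (rule n2_near)

lemma layer_DERIV:
  assumes x: "x \<notin> interfaces" and g: "(g has_real_derivative g') (at (s x))"
  shows "((\<lambda>y. f (n1 y) (n2 y) * g (s y)) has_real_derivative f (n1 x) (n2 x) * g' * slow x) (at x)"
proof -
  have "((\<lambda>y. f (n1 x) (n2 x) * g (s y)) has_real_derivative f (n1 x) (n2 x) * (g' * slow x)) (at x)"
    by (intro DERIV_cmult DERIV_chain2[where f = g and g = s, OF g] s_DERIV x)
  moreover have "\<forall>\<^sub>F y in nhds x. f (n1 y) (n2 y) * g (s y) = f (n1 x) (n2 x) * g (s y)"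
    using layer_index_locally_constant[OF x] by eventually_elim simp
  ultimately show ?thesis by (subst DERIV_cong_ev) (auto simp: mult.assoc)
qed

text \<open>The second-order equation \<open>U'' = - l\<^sup>2 V U\<close> as a first-order system with transmission conditions:
  \<open>U\<close> and \<open>P\<close> are continuous, and the equations hold off the interfaces.\<close>
definition mode_solution :: "real \<Rightarrow> (real \<Rightarrow> real) \<Rightarrow> (real \<Rightarrow> real) \<Rightarrow> bool" where
  "mode_solution l U P \<longleftrightarrow> continuous_on {0..} U \<and> continuous_on {0..} P \<and>
     (\<forall>x>0. x \<notin> interfaces \<longrightarrow> (U has_real_derivative P x) (at x) \<and>
        (P has_real_derivative - l\<^sup>2 * (slow x)\<^sup>2 * U x) (at x))"

lemma constant_if_derivative_zero_in_layers:
  fixes W :: "real \<Rightarrow> real"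
  assumes c: "continuous_on {0..} W" and d: "\<And>x. x > 0 \<Longrightarrow> x \<notin> interfaces \<Longrightarrow> (W has_real_derivative 0) (at x)"
    and x: "x \<ge> 0"
  shows "W x = W 0"
proof -
  have "((\<lambda>_. 0) has_integral (W x - W 0)) {0..x}"
  proof (rule fundamental_theorem_of_calculus_interior_strong[OF finite_interfaces[of 0 x] x])
    fix y assume "y \<in> {0<..<x} - interfaces \<inter> {0..x}"
    then show "(W has_vector_derivative 0) (at y)"
      using d[of y] by (auto simp: has_real_derivative_iff_has_vector_derivative)
  qed (rule continuous_on_subset[OF c], auto)
  then show ?thesis using has_integral_unique[OF _ has_integral_0] by fastforce
qed

lemma Wronskian_constant:
  assumes "mode_solution l U P" "mode_solution l U' P'" "x \<ge> 0"
  shows "U x * P' x - P x * U' x = U 0 * P' 0 - P 0 * U' 0"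
proof (rule constant_if_derivative_zero_in_layers[of "\<lambda>x. U x * P' x - P x * U' x"])
  show "continuous_on {0..} (\<lambda>x. U x * P' x - P x * U' x)"
    using assms unfolding mode_solution_def by (intro continuous_intros) auto
  fix y assume y: "y > 0" "y \<notin> interfaces"
  have "((\<lambda>x. U x * P' x - P x * U' x) has_real_derivative
     (P y * P' y + (- l\<^sup>2 * (slow y)\<^sup>2 * U' y) * U y) - ((- l\<^sup>2 * (slow y)\<^sup>2 * U y) * U' y + P' y * P y)) (at y)"
    using assms y unfolding mode_solution_def by (intro DERIV_diff DERIV_mult) auto
  then show "((\<lambda>x. U x * P' x - P x * U' x) has_real_derivative 0) (at y)"
    by (simp add: algebra_simps)
qed fact

text \<open>The Wronskian is constant; if one solution is square-integrable and the other one bounded, it is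
  also square-integrable on the half-line.\<close>
lemma Wronskian_zero:
  assumes sol: "mode_solution l U P" "mode_solution l U' P'"
    and sq: "set_integrable lborel {0..} (\<lambda>x. (U x)\<^sup>2)" "set_integrable lborel {0..} (\<lambda>x. (P x)\<^sup>2)"
    and bd: "\<And>x. x \<ge> 0 \<Longrightarrow> \<bar>U' x\<bar> \<le> M \<and> \<bar>P' x\<bar> \<le> M"
    and x: "x \<ge> 0"
  shows "U x * P' x = P x * U' x"
proof -
  have "U 0 * P' 0 - P 0 * U' 0 = 0"
  proof (rule square_integrable_constant_zero[OF sq, where M = M])
    fix y :: real assume y: "y \<ge> 0"
    have "\<bar>U 0 * P' 0 - P 0 * U' 0\<bar> = \<bar>U y * P' y - P y * U' y\<bar>"
      using Wronskian_constant[OF sol y] by simp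
    also have "\<dots> \<le> \<bar>U y\<bar> * \<bar>P' y\<bar> + \<bar>P y\<bar> * \<bar>U' y\<bar>" by (metis abs_mult abs_triangle_ineq4)
    also have "\<dots> \<le> \<bar>U y\<bar> * M + \<bar>P y\<bar> * M" using bd[OF y] by (intro add_mono mult_left_mono) auto
    finally show "\<bar>U 0 * P' 0 - P 0 * U' 0\<bar> \<le> M * (\<bar>U y\<bar> + \<bar>P y\<bar>)" by (simp add: algebra_simps)
  qed
  then show ?thesis using Wronskian_constant[OF sol x] by simp
qed

definition freq :: "int \<Rightarrow> real" where "freq k = of_int k * (2 * pi / T)"

lemma freq_sigma: "freq k * (of_int n * \<sigma>) = pi * of_int (k * n * (int ma + int mb + 1))"
  using T by (simp add: freq_def resonance field_simps)

lemma freq_2h: "freq k * (2 * h) = pi / 2 * of_int (k * (2 * int ma + 1))"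
  using T by (simp add: freq_def resonance field_simps)

lemma sin_freq_n1: "sin (freq k * s (hw + 2 * pi * of_int n)) = 0"
  by (simp only: s_n1_interface freq_sigma sin_npi_int)

text \<open>At the left ends of the \<open>a\<close>-layers the phase of an odd mode is an odd multiple of \<open>\<pi> / 2\<close>.\<close>
lemma cos_freq_n2_odd:
  assumes "odd k" shows "cos (freq k * s (- hw + 2 * pi * of_int n)) = 0"
proof -
  have "odd (k * (2 * int ma + 1))" using assms by simp
  then obtain i where i: "k * (2 * int ma + 1) = 2 * i + 1" by (rule oddE)
  have "freq k * s (- hw + 2 * pi * of_int n) = pi * of_int (k * n * (int ma + int mb + 1)) - pi / 2 * of_int (2 * i + 1)"
    by (simp only: s_n2_interface right_diff_distrib freq_sigma freq_2h i)
  also have "\<dots> = pi * of_int (k * n * (int ma + int mb + 1) - i) - pi / 2"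
    by (simp add: algebra_simps)
  finally show ?thesis by (simp only: cos_diff sin_npi_int cos_pi_half mult_zero_right mult_zero_left add_0)
qed

lemma sin_freq_n2_even:
  assumes "even k" shows "sin (freq k * s (- hw + 2 * pi * of_int n)) = 0"
proof -
  obtain i where i: "k = 2 * i" using assms by (auto elim: evenE)
  have "freq k * s (- hw + 2 * pi * of_int n) = pi * of_int (k * n * (int ma + int mb + 1)) - pi / 2 * of_int (k * (2 * int ma + 1))"
    by (simp only: s_n2_interface right_diff_distrib freq_sigma freq_2h)
  also have "\<dots> = pi * of_int (k * n * (int ma + int mb + 1) - i * (2 * int ma + 1))"
    by (simp add: i algebra_simps)
  finally show ?thesis by (simp only: sin_npi_int)
qed

lemma kappa_powi_slow': "\<kappa> powi (- n2 x) * slow x = sqrt b * \<kappa> powi (- n1 x)"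
proof -
  have "\<kappa> powi (- n2 x) * slow x = \<kappa> powi (- n2 x) * \<kappa> powi (- n1 x) * (\<kappa> powi n1 x * slow x)"
    using kappa by (simp add: power_int_minus)
  also have "\<dots> = sqrt b * \<kappa> powi (- n1 x)"
    unfolding kappa_slow using kappa by (simp add: power_int_minus)
  finally show ?thesis .
qed

lemma trig_continuous: "continuous_on UNIV (\<lambda>x. sin (c * s x))" "continuous_on UNIV (\<lambda>x. cos (c * s x))"
  by (intro continuous_intros s_continuous)+

lemma trig_deriv: "((\<lambda>y. sin (c * y)) has_real_derivative cos (c * y) * c) (at y)"
  "((\<lambda>y. cos (c * y)) has_real_derivative - sin (c * y) * c) (at y)" for c y :: real
  by (auto intro!: derivative_eq_intros)

text \<open>Fundamental solutions for odd \<open>k\<close>. The amplitudes of \<open>Udec\<close> and \<open>Pinc\<close> jump at zeros of the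
  sine, those of \<open>Pdec\<close> and \<open>Uinc\<close> at zeros of the cosine.\<close>
definition Udec where "Udec k x = \<kappa> powi n1 x * sin (freq k * s x)"
definition Pdec where "Pdec k x = freq k * sqrt b * \<kappa> powi n2 x * cos (freq k * s x)"
definition Uinc where "Uinc k x = \<kappa> powi (- n2 x) * cos (freq k * s x)"
definition Pinc where "Pinc k x = - freq k * sqrt b * \<kappa> powi (- n1 x) * sin (freq k * s x)"

lemma decaying_mode: assumes "odd k" shows "mode_solution (freq k) (Udec k) (Pdec k)"
  unfolding mode_solution_def
proof (intro conjI allI impI)
  have "continuous_on UNIV (Udec k)" unfolding Udec_def
    by (rule n1_product_continuous[OF trig_continuous(1) sin_freq_n1])
  then show "continuous_on {0..} (Udec k)" by (rule continuous_on_subset) simp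
  have "continuous_on UNIV (Pdec k)" unfolding Pdec_def
    by (rule n2_product_continuous[OF trig_continuous(2) cos_freq_n2_odd[OF assms]])
  then show "continuous_on {0..} (Pdec k)" by (rule continuous_on_subset) simp
  fix x assume x: "x \<notin> interfaces"
  have "(Udec k has_real_derivative \<kappa> powi n1 x * (cos (freq k * s x) * freq k) * slow x) (at x)"
    unfolding Udec_def using layer_DERIV[OF x trig_deriv(1), of "\<lambda>i j. \<kappa> powi i" "freq k"] .
  also have "\<kappa> powi n1 x * (cos (freq k * s x) * freq k) * slow x = (\<kappa> powi n1 x * slow x) * (cos (freq k * s x) * freq k)"
    by simp
  also have "\<dots> = Pdec k x" unfolding kappa_slow by (simp add: Pdec_def)
  finally show "(Udec k has_real_derivative Pdec k x) (at x)" .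
  have "(Pdec k has_real_derivative (freq k * sqrt b * \<kappa> powi n2 x) * (- sin (freq k * s x) * freq k) * slow x) (at x)"
    unfolding Pdec_def using layer_DERIV[OF x trig_deriv(2), of "\<lambda>i j. freq k * sqrt b * \<kappa> powi j" "freq k"] .
  also have "(freq k * sqrt b * \<kappa> powi n2 x) * (- sin (freq k * s x) * freq k) * slow x
      = - (freq k)\<^sup>2 * slow x * sin (freq k * s x) * (sqrt b * \<kappa> powi n2 x)" by (simp add: power2_eq_square)
  also have "\<dots> = - (freq k)\<^sup>2 * (slow x)\<^sup>2 * Udec k x"
    unfolding kappa_slow[symmetric] by (simp add: power2_eq_square Udec_def)
  finally show "(Pdec k has_real_derivative - (freq k)\<^sup>2 * (slow x)\<^sup>2 * Udec k x) (at x)" .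
qed

lemma growing_mode: assumes "odd k" shows "mode_solution (freq k) (Uinc k) (Pinc k)"
  unfolding mode_solution_def
proof (intro conjI allI impI)
  have "continuous_on UNIV (Uinc k)" unfolding Uinc_def
    by (rule n2_product_continuous[OF trig_continuous(2) cos_freq_n2_odd[OF assms]])
  then show "continuous_on {0..} (Uinc k)" by (rule continuous_on_subset) simp
  have "continuous_on UNIV (Pinc k)" unfolding Pinc_def
    by (rule n1_product_continuous[OF trig_continuous(1) sin_freq_n1])
  then show "continuous_on {0..} (Pinc k)" by (rule continuous_on_subset) simp
  fix x assume x: "x \<notin> interfaces"
  have "(Uinc k has_real_derivative \<kappa> powi (- n2 x) * (- sin (freq k * s x) * freq k) * slow x) (at x)"
    unfolding Uinc_def using layer_DERIV[OF x trig_deriv(2), of "\<lambda>i j. \<kappa> powi (- j)" "freq k"] .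
  also have "\<kappa> powi (- n2 x) * (- sin (freq k * s x) * freq k) * slow x = (\<kappa> powi (- n2 x) * slow x) * (- sin (freq k * s x) * freq k)"
    by simp
  also have "\<dots> = Pinc k x" unfolding kappa_powi_slow' by (simp add: Pinc_def)
  finally show "(Uinc k has_real_derivative Pinc k x) (at x)" .
  have "(Pinc k has_real_derivative (- freq k * sqrt b * \<kappa> powi (- n1 x)) * (cos (freq k * s x) * freq k) * slow x) (at x)"
    unfolding Pinc_def using layer_DERIV[OF x trig_deriv(1), of "\<lambda>i j. - freq k * sqrt b * \<kappa> powi (- i)" "freq k"] .
  also have "(- freq k * sqrt b * \<kappa> powi (- n1 x)) * (cos (freq k * s x) * freq k) * slow x
      = - (freq k)\<^sup>2 * slow x * cos (freq k * s x) * (sqrt b * \<kappa> powi (- n1 x))" by (simp add: power2_eq_square)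
  also have "\<dots> = - (freq k)\<^sup>2 * (slow x)\<^sup>2 * Uinc k x"
    unfolding kappa_powi_slow'[symmetric] by (simp add: power2_eq_square Uinc_def)
  finally show "(Pinc k has_real_derivative - (freq k)\<^sup>2 * (slow x)\<^sup>2 * Uinc k x) (at x)" .
qed

lemma slow_kappa: "slow x = sqrt b * \<kappa> powi (- n1 x) * \<kappa> powi n2 x" "1 / slow x = \<kappa> powi n1 x * (\<kappa> powi (- n2 x) / sqrt b)"
proof -
  have "slow x = \<kappa> powi (- n1 x) * (\<kappa> powi n1 x * slow x)" using kappa by (simp add: power_int_minus)
  then show 1: "slow x = sqrt b * \<kappa> powi (- n1 x) * \<kappa> powi n2 x" unfolding kappa_slow by simp
  show "1 / slow x = \<kappa> powi n1 x * (\<kappa> powi (- n2 x) / sqrt b)"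
    unfolding 1 using kappa sqrt_pos by (simp add: power_int_minus field_simps)
qed

text \<open>For even \<open>k\<close> the sine vanishes at all interfaces, so a factor that jumps there is harmless and
  the amplitudes need not change from period to period.\<close>
lemma even_modes:
  assumes "even k"
  shows "mode_solution (freq k) (\<lambda>x. 1 / slow x * sin (freq k * s x)) (\<lambda>x. freq k * cos (freq k * s x))"
    and "mode_solution (freq k) (\<lambda>x. cos (freq k * s x)) (\<lambda>x. - freq k * slow x * sin (freq k * s x))"
proof -
  note z = sin_freq_n1 sin_freq_n2_even[OF assms]
  have "continuous_on UNIV (\<lambda>x. \<kappa> powi n1 x * (\<kappa> powi (- n2 x) / sqrt b * sin (freq k * s x)))"
    by (rule n1_product_continuous, rule n2_product_continuous[OF trig_continuous(1) z(2)]) (simp add: z)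
  moreover have "(\<lambda>x. 1 / slow x * sin (freq k * s x)) = (\<lambda>x. \<kappa> powi n1 x * (\<kappa> powi (- n2 x) / sqrt b * sin (freq k * s x)))"
    by (simp only: slow_kappa(2) mult.assoc)
  ultimately have c1: "continuous_on S (\<lambda>x. 1 / slow x * sin (freq k * s x))" for S
    by (metis continuous_on_subset subset_UNIV)
  have "continuous_on UNIV (\<lambda>x. (- freq k * sqrt b * \<kappa> powi (- n1 x)) * (\<kappa> powi n2 x * sin (freq k * s x)))"
    by (rule n1_product_continuous, rule n2_product_continuous[OF trig_continuous(1) z(2)]) (simp add: z)
  moreover have "(\<lambda>x. (- freq k * sqrt b * \<kappa> powi (- n1 x)) * (\<kappa> powi n2 x * sin (freq k * s x))) = (\<lambda>x. - freq k * slow x * sin (freq k * s x))"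
    unfolding slow_kappa(1) by (auto simp: mult.assoc)
  ultimately have c2: "continuous_on S (\<lambda>x. - freq k * slow x * sin (freq k * s x))" for S
    by (metis continuous_on_subset subset_UNIV)
  have sl: "slow x \<noteq> 0" for x using slow_pos[of x] by simp
  have g: "slow y = (if n1 y = n2 y then sqrt b else sqrt a)" for y by (simp add: slow_def)
  show "mode_solution (freq k) (\<lambda>x. 1 / slow x * sin (freq k * s x)) (\<lambda>x. freq k * cos (freq k * s x))"
    unfolding mode_solution_def
  proof (intro conjI allI impI c1 continuous_on_subset[OF trig_continuous(2)] continuous_intros s_continuous)
    fix x assume x: "x \<notin> interfaces"
    show "((\<lambda>x. 1 / slow x * sin (freq k * s x)) has_real_derivative freq k * cos (freq k * s x)) (at x)"
      using layer_DERIV[OF x trig_deriv(1), of "\<lambda>i j. 1 / (if i = j then sqrt b else sqrt a)" "freq k", folded g] sl[of x]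
      by (simp add: mult.commute)
    show "((\<lambda>x. freq k * cos (freq k * s x)) has_real_derivative - (freq k)\<^sup>2 * (slow x)\<^sup>2 * (1 / slow x * sin (freq k * s x))) (at x)"
      using layer_DERIV[OF x trig_deriv(2), of "\<lambda>i j. freq k" "freq k"] sl[of x]
      by (simp add: power2_eq_square algebra_simps)
  qed auto
  show "mode_solution (freq k) (\<lambda>x. cos (freq k * s x)) (\<lambda>x. - freq k * slow x * sin (freq k * s x))"
    unfolding mode_solution_def
  proof (intro conjI allI impI c2 continuous_on_subset[OF trig_continuous(2)] continuous_intros s_continuous)
    fix x assume x: "x \<notin> interfaces"
    show "((\<lambda>x. cos (freq k * s x)) has_real_derivative - freq k * slow x * sin (freq k * s x)) (at x)"
      using layer_DERIV[OF x trig_deriv(2), of "\<lambda>i j. 1" "freq k"] by (simp add: algebra_simps)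
    show "((\<lambda>x. - freq k * slow x * sin (freq k * s x)) has_real_derivative - (freq k)\<^sup>2 * (slow x)\<^sup>2 * cos (freq k * s x)) (at x)"
      using layer_DERIV[OF x trig_deriv(1), of "\<lambda>i j. - freq k * (if i = j then sqrt b else sqrt a)" "freq k", folded g]
      by (simp add: power2_eq_square algebra_simps)
  qed auto
qed

lemma abs_trig_le: "\<bar>c\<bar> \<le> M \<Longrightarrow> \<bar>c * sin y\<bar> \<le> M" "\<bar>c\<bar> \<le> M \<Longrightarrow> \<bar>c * cos y\<bar> \<le> M" for c M y :: real
proof -
  assume c: "\<bar>c\<bar> \<le> M"
  have "\<bar>c\<bar> * \<bar>sin y\<bar> \<le> \<bar>c\<bar> * 1" "\<bar>c\<bar> * \<bar>cos y\<bar> \<le> \<bar>c\<bar> * 1" by (intro mult_left_mono; simp)+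
  then show "\<bar>c * sin y\<bar> \<le> M" "\<bar>c * cos y\<bar> \<le> M" using c by (auto simp: abs_mult)
qed

text \<open>The Wronskian with the decaying solution vanishes, the one with the growing solution is constant.
  Solving these two linear equations for \<open>U\<close> gives a multiple of \<open>Udec\<close>; the first of them, at
  \<open>x = 0\<close>, relates the initial values.\<close>
lemma odd_mode_decays:
  assumes k: "odd k" and sol: "mode_solution (freq k) U P"
    and sq: "set_integrable lborel {0..} (\<lambda>x. (U x)\<^sup>2)" "set_integrable lborel {0..} (\<lambda>x. (P x)\<^sup>2)"
  shows "\<exists>A. \<forall>x\<ge>0. U x = A * Udec k x" and "U 0 * (freq k * sqrt a * cos (freq k * h)) = - P 0 * sin (freq k * h)"
proof -
  define M where "M = 1 / \<kappa> + \<bar>freq k * sqrt b\<bar>"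
  have bd: "\<bar>Udec k x\<bar> \<le> M \<and> \<bar>Pdec k x\<bar> \<le> M" if "x \<ge> 0" for x
  proof
    show "\<bar>Udec k x\<bar> \<le> M" unfolding Udec_def M_def
      by (rule abs_trig_le) (use kappa_n1_le[OF that] in linarith)
    have "\<bar>freq k * sqrt b * \<kappa> powi n2 x\<bar> \<le> \<bar>freq k * sqrt b\<bar> * 1"
      unfolding abs_mult[of "freq k * sqrt b"] using kappa_n2_le[OF that] by (intro mult_left_mono) auto
    then show "\<bar>Pdec k x\<bar> \<le> M" unfolding Pdec_def M_def
      using kappa by (intro abs_trig_le) (smt (verit) divide_pos_pos)
  qed
  have W1: "U x * Pdec k x = P x * Udec k x" if "x \<ge> 0" for x
    by (rule Wronskian_zero[OF sol decaying_mode[OF k] sq bd that])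
  define c where "c = U 0 * Pinc k 0 - P 0 * Uinc k 0"
  have W2: "U x * Pinc k x - P x * Uinc k x = c" if "x \<ge> 0" for x
    unfolding c_def by (rule Wronskian_constant[OF sol growing_mode[OF k] that])
  have l: "freq k * sqrt b \<noteq> 0" using k T sqrt_pos by (auto simp: freq_def)
  have det: "Udec k x * Pinc k x - Pdec k x * Uinc k x = - (freq k * sqrt b)" for x
  proof -
    have "\<kappa> powi n1 x * \<kappa> powi (- n1 x) = 1" "\<kappa> powi n2 x * \<kappa> powi (- n2 x) = 1"
      using kappa by (auto simp: power_int_minus)
    moreover have "Udec k x * Pinc k x - Pdec k x * Uinc k x = - (freq k * sqrt b) *
      ((\<kappa> powi n1 x * \<kappa> powi (- n1 x)) * (sin (freq k * s x))\<^sup>2 + (\<kappa> powi n2 x * \<kappa> powi (- n2 x)) * (cos (freq k * s x))\<^sup>2)"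
      by (simp add: Udec_def Pdec_def Uinc_def Pinc_def power2_eq_square algebra_simps)
    ultimately show ?thesis by simp
  qed
  have "U x = (- c / (freq k * sqrt b)) * Udec k x" if "x \<ge> 0" for x
  proof -
    have "U x * (Udec k x * Pinc k x - Pdec k x * Uinc k x)
        = Udec k x * (U x * Pinc k x - P x * Uinc k x) + (P x * Udec k x - U x * Pdec k x) * Uinc k x"
      by (simp add: algebra_simps)
    then have "U x * (- (freq k * sqrt b)) = Udec k x * c" by (simp add: det W1[OF that] W2[OF that])
    then show ?thesis using l by (simp add: field_simps)
  qed
  then show "\<exists>A. \<forall>x\<ge>0. U x = A * Udec k x" by blast
  have "U 0 * (freq k * sqrt b * cos (freq k * h)) = - P 0 * ((1 / \<kappa>) * sin (freq k * h))"
    using W1[of 0] by (simp add: Udec_def Pdec_def s_0 n1_0 n2_0 power_int_minus inverse_eq_divide)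
  then have "U 0 * (freq k * (\<kappa> * sqrt b) * cos (freq k * h)) = - P 0 * sin (freq k * h)"
    using kappa(1) by (simp add: field_simps)
  then show "U 0 * (freq k * sqrt a * cos (freq k * h)) = - P 0 * sin (freq k * h)"
    by (simp only: kappa(3))
qed

text \<open>For \<open>k \<noteq> 0\<close> both fundamental solutions are bounded, so \<open>U\<close> has zero Wronskian with both. For
  \<open>k = 0\<close> the solutions are affine.\<close>
lemma even_mode_vanishes:
  assumes k: "even k" and sol: "mode_solution (freq k) U P"
    and sq: "set_integrable lborel {0..} (\<lambda>x. (U x)\<^sup>2)" "set_integrable lborel {0..} (\<lambda>x. (P x)\<^sup>2)"
    and x: "x \<ge> 0"
  shows "U x = 0 \<and> P x = 0"
proof (cases "k = 0")
  case True
  then have f: "freq k = 0" by (simp add: freq_def)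
  have P: "P y = P 0" if "y \<ge> 0" for y
    by (rule constant_if_derivative_zero_in_layers[OF _ _ that]) (use sol f in \<open>auto simp: mode_solution_def\<close>)
  have P0: "P 0 = 0"
  proof (rule square_integrable_constant_zero[OF sq, where M = 1])
    show "\<bar>P 0\<bar> \<le> 1 * (\<bar>U y\<bar> + \<bar>P y\<bar>)" if "y \<ge> 0" for y using P[OF that] by simp
  qed
  have U: "U y = U 0" if "y \<ge> 0" for y
  proof (rule constant_if_derivative_zero_in_layers[OF _ _ that])
    show "continuous_on {0..} U" using sol by (simp add: mode_solution_def)
    show "(U has_real_derivative 0) (at z)" if "z > 0" "z \<notin> interfaces" for z
      using sol that P[of z] P0 by (auto simp: mode_solution_def)
  qed
  have "U 0 = 0"
  proof (rule square_integrable_constant_zero[OF sq, where M = 1])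
    show "\<bar>U 0\<bar> \<le> 1 * (\<bar>U y\<bar> + \<bar>P y\<bar>)" if "y \<ge> 0" for y using U[OF that] by simp
  qed
  then show ?thesis using U[OF x] P[OF x] P0 by simp
next
  case False
  then have l: "freq k \<noteq> 0" using T by (simp add: freq_def)
  define M where "M = 1 / sqrt a + \<bar>freq k\<bar> * sqrt b + \<bar>freq k\<bar> + 1"
  have sa: "slow y \<ge> sqrt a" for y using sqrt_pos by (auto simp: slow_def)
  have M: "1 / slow y \<le> M" "\<bar>freq k * slow y\<bar> \<le> M" "\<bar>freq k\<bar> \<le> M" "1 \<le> M" for y
  proof -
    have p: "0 \<le> 1 / sqrt a" "0 \<le> \<bar>freq k\<bar> * sqrt b" "0 \<le> \<bar>freq k\<bar>" using sqrt_pos by auto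
    have "1 / slow y \<le> 1 / sqrt a" using sa[of y] sqrt_pos slow_pos[of y] by (intro divide_left_mono mult_pos_pos) auto
    then show "1 / slow y \<le> M" using p unfolding M_def by linarith
    have "\<bar>freq k * slow y\<bar> \<le> \<bar>freq k\<bar> * sqrt b" using slow_pos[of y] by (simp add: abs_mult mult_left_mono)
    then show "\<bar>freq k * slow y\<bar> \<le> M" using p unfolding M_def by linarith
    show "\<bar>freq k\<bar> \<le> M" using p unfolding M_def by linarith
    show "1 \<le> M" using p unfolding M_def by linarith
  qed
  have b1: "\<bar>1 / slow y * sin (freq k * s y)\<bar> \<le> M \<and> \<bar>freq k * cos (freq k * s y)\<bar> \<le> M" for y
    using M(1)[of y] M(2)[of y] M(3,4) slow_pos[of y] by (intro conjI abs_trig_le) auto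
  have b2: "\<bar>cos (freq k * s y)\<bar> \<le> M \<and> \<bar>- freq k * slow y * sin (freq k * s y)\<bar> \<le> M" for y
    using M(1)[of y] M(2)[of y] M(3,4) by (intro conjI abs_trig_le order_trans[OF abs_cos_le_one]) auto
  let ?S = "sin (freq k * s x)" and ?C = "cos (freq k * s x)"
  have 1: "U x * (freq k * ?C) = P x * (1 / slow x * ?S)"
    by (rule Wronskian_zero[OF sol even_modes(1)[OF k] sq b1 x])
  have 2: "U x * (- freq k * slow x * ?S) = P x * ?C"
    by (rule Wronskian_zero[OF sol even_modes(2)[OF k] sq b2 x])
  have sl: "slow x > 0" by (rule slow_pos)
  have "u * l * (c\<^sup>2 + d\<^sup>2) = (u * (l * c)) * c - (u * (- l * w * d)) * (1 / w * d)" if "w > 0" for u l c d w :: real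
    using that by (simp add: power2_eq_square field_simps)
  from this[OF sl] have "U x * freq k * (?C\<^sup>2 + ?S\<^sup>2) = (U x * (freq k * ?C)) * ?C - (U x * (- freq k * slow x * ?S)) * (1 / slow x * ?S)" .
  also have "\<dots> = 0" unfolding 1 2 by simp
  finally have U0: "U x = 0" using l by simp
  have "P x * ?C = 0" "P x * ?S = 0" using 1 2 U0 sl by auto
  then have "P x = 0" using sin_zero_abs_cos_one[of "freq k * s x"] by auto
  then show ?thesis using U0 by simp
qed

lemma slow_measurable: "slow \<in> borel_measurable borel"
proof -
  have "(\<lambda>x. if real_of_int \<lfloor>(x - hw) / (2 * pi)\<rfloor> = real_of_int \<lfloor>(x + hw) / (2 * pi)\<rfloor> then sqrt b else sqrt a) \<in> borel_measurable borel"
    by measurable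
  then show ?thesis by (simp add: slow_def[abs_def] n1_def n2_def)
qed

text \<open>The integral form produced by the weak equation implies the form with derivatives, since inside
  a layer the integrand is continuous.\<close>
lemma mode_solution_integral:
  assumes U: "continuous_on {0..} U" and P: "continuous_on {0..} P"
    and Ui: "\<And>x. x \<ge> 0 \<Longrightarrow> U x = c + (LINT y:{0..x}|lborel. P y)"
    and Pi: "\<And>x. x \<ge> 0 \<Longrightarrow> P x = d + (LINT y:{0..x}|lborel. - l\<^sup>2 * (slow y)\<^sup>2 * U y)"
  shows "mode_solution l U P"
  unfolding mode_solution_def
proof (intro conjI U P allI impI)
  fix x :: real assume x: "x > 0" "x \<notin> interfaces"
  have ci: "isCont h x" if "continuous_on {0..} h" for h :: "real \<Rightarrow> real"
    using continuous_on_interior[OF that] x by simp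
  show "(U has_real_derivative P x) (at x)"
    by (rule primitive_DERIV[OF Ui _ x(1) ci[OF P]])
      (auto intro!: borel_integrable_atLeastAtMost' continuous_on_subset[OF P])
  show "(P has_real_derivative - l\<^sup>2 * (slow x)\<^sup>2 * U x) (at x)"
  proof (rule primitive_DERIV[OF Pi _ x(1)])
    have cx: "isCont (\<lambda>y. - l\<^sup>2 * (slow x)\<^sup>2 * U y) x" using ci[OF U] by simp
    have "\<forall>\<^sub>F y in nhds x. - l\<^sup>2 * (slow x)\<^sup>2 * U y = - l\<^sup>2 * (slow y)\<^sup>2 * U y"
      using layer_index_locally_constant[OF x(2)] by eventually_elim (simp add: slow_def)
    from isCont_cong[OF this] cx show "isCont (\<lambda>y. - l\<^sup>2 * (slow y)\<^sup>2 * U y) x" by blast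
    fix R
    have "set_integrable lborel {0..R} (\<lambda>y. - l\<^sup>2 * (slow y)\<^sup>2)"
    proof (rule set_integrable_bound)
      show "set_integrable lborel {0..R} (\<lambda>y. l\<^sup>2 * b)" by (rule borel_integrable_atLeastAtMost') simp
      show "set_borel_measurable lborel {0..R} (\<lambda>y. - l\<^sup>2 * (slow y)\<^sup>2)"
        unfolding set_borel_measurable_def using slow_measurable by simp
      have "(slow y)\<^sup>2 \<le> b" for y using a ab by (auto simp: slow_def)
      then show "AE y in lborel. y \<in> {0..R} \<longrightarrow> norm (- l\<^sup>2 * (slow y)\<^sup>2) \<le> norm (l\<^sup>2 * b)"
        using a ab by (auto simp: abs_mult intro!: mult_left_mono)
    qed
    then show "set_integrable lborel {0..R} (\<lambda>y. - l\<^sup>2 * (slow y)\<^sup>2 * U y)"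
      by (rule set_integrable_continuous_mult) (rule continuous_on_subset[OF U], simp)
  qed
qed

end

section \<open>Periodic functions and their coefficients\<close>

abbreviation coef :: "real \<Rightarrow> (real \<Rightarrow> real) \<Rightarrow> int \<Rightarrow> real \<Rightarrow> real" where
  "coef T F k \<alpha> \<equiv> LINT t:{0..<T}|lborel. F t * wave T k \<alpha> t"

lemma Fourier_uniqueness_wave:
  assumes T: "T > 0" and D: "set_integrable lborel {0..<T} D"
    and z: "\<And>k \<alpha>. coef T D k \<alpha> = 0"
  shows "AE t in lborel. t \<in> {0<..<T} \<longrightarrow> D t = 0"
proof (rule Fourier_uniqueness[OF T D])
  show "(LINT t:{0..<T}|lborel. D t * cos (of_int k * (2 * pi / T) * t)) = 0" for k
    using z[of k 0] by (simp add: wave_def)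
  have "cos (x + - (pi / 2)) = sin x" for x :: real by (simp add: cos_diff)
  then show "(LINT t:{0..<T}|lborel. D t * sin (of_int k * (2 * pi / T) * t)) = 0" for k
    using z[of k "- (pi / 2)"] by (simp only: wave_def)
qed

text \<open>The set of points where \<open>D\<close> is nonzero is open, and a nonempty open set is not negligible.\<close>
lemma continuous_zero_if_AE_zero:
  fixes D :: "real \<Rightarrow> real"
  assumes c: "continuous_on UNIV D" and z: "AE t in lborel. t \<in> {c<..<d} \<longrightarrow> D t = 0" and cd: "c < d"
    and t: "t \<in> {c..d}"
  shows "D t = 0"
proof -
  let ?N = "{t. D t \<noteq> 0} \<inter> {c<..<d}"
  have "open {t. D t \<noteq> 0}" using c by (intro open_Collect_neq) (auto intro: continuous_intros)
  then have o: "open ?N" by (intro open_Int) auto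
  have "AE t in lborel. t \<notin> ?N" using z by eventually_elim auto
  then have "?N \<in> null_sets lborel" using o by (subst (asm) AE_iff_null_sets[symmetric]) auto
  then have "negligible ?N"
    by (simp add: negligible_iff_null_sets null_sets_completionI)
  then have "?N = {}" using o open_not_negligible by blast
  then have sub: "{c<..<d} \<subseteq> {t. D t = 0}" by auto
  have "closed {t. D t = 0}" using c by (intro closed_Collect_eq) (auto intro: continuous_intros)
  then have "closure {c<..<d} \<subseteq> {t. D t = 0}" by (rule closure_minimal[OF sub])
  then show ?thesis using t cd by auto
qed

lemma periodic_int:
  fixes F :: "real \<Rightarrow> 'a"
  assumes "\<And>t. F (t + T) = F t" shows "F (t + of_int n * T) = F t"
proof -
  have up: "F (t + real k * T) = F t" for t k
  proof (induction k)
    case (Suc k)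
    have "F (t + real (Suc k) * T) = F ((t + real k * T) + T)" by (simp add: algebra_simps)
    then show ?case using assms Suc by simp
  qed simp
  show ?thesis
  proof (cases "n \<ge> 0")
    case True then show ?thesis using up[of t "nat n"] by simp
  next
    case False then show ?thesis using up[of "t + of_int n * T" "nat (- n)"] by simp
  qed
qed

lemma shift_into_period:
  fixes t T :: real
  assumes "T > 0" obtains n :: int where "t - of_int n * T \<in> {0..<T}"
proof -
  define n where "n = \<lfloor>t / T\<rfloor>"
  have "of_int n \<le> t / T" "t / T < of_int n + 1" unfolding n_def by linarith+
  then have "t - of_int n * T \<in> {0..<T}" using assms by (auto simp: field_simps)
  then show ?thesis by (rule that)
qed

lemma periodic_zero:
  fixes D :: "real \<Rightarrow> real"
  assumes T: "T > 0" and p: "\<And>t. D (t + T) = D t" and z: "\<And>t. t \<in> {0..T} \<Longrightarrow> D t = 0"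
  shows "D t = 0"
proof -
  obtain n :: int where "t - of_int n * T \<in> {0..<T}" using shift_into_period[OF T] by blast
  then have "t - of_int n * T \<in> {0..T}" by simp
  from z[OF this] have "D (t - of_int n * T) = 0" .
  then show ?thesis using periodic_int[of D T "t - of_int n * T" n, OF p] by simp
qed

lemma continuous_Fourier_zero:
  assumes T: "T > 0" and c: "continuous_on UNIV D" and p: "\<And>t. D (t + T) = D t"
    and z: "\<And>k \<alpha>. coef T D k \<alpha> = 0"
  shows "D t = 0"
proof (rule periodic_zero[of T D, OF T p])
  have "set_integrable lborel {0..<T} D"
    unfolding set_integral_Ico_Icc by (intro borel_integrable_atLeastAtMost' continuous_on_subset[OF c]) auto
  then show "t \<in> {0..T} \<Longrightarrow> D t = 0" for t
    by (rule continuous_zero_if_AE_zero[OF c Fourier_uniqueness_wave[OF T _ z] T])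
qed

lemma periodic_extension:
  fixes c :: "real \<Rightarrow> real"
  assumes T: "T > 0" and c: "continuous_on {0..T} c" and e: "c 0 = c T"
  obtains C where "continuous_on UNIV C" "\<And>t. C (t + T) = C t" "\<And>t. t \<in> {0..T} \<Longrightarrow> C t = c t"
proof -
  define C where "C t = c (t - T * of_int \<lfloor>t / T\<rfloor>)" for t
  have val: "C y = c (y - T * of_int n)" if "T * of_int n \<le> y" "y \<le> T * of_int n + T" for y and n :: int
  proof (cases "y = T * of_int n + T")
    case True
    then have "y / T = of_int (n + 1)" using T by (simp add: field_simps)
    then have "C y = c 0" using True by (simp add: C_def algebra_simps)
    then show ?thesis using True e by simp
  next
    case False
    then have "\<lfloor>y / T\<rfloor> = n" using that T by (simp add: floor_eq_iff field_simps)
    then show ?thesis by (simp add: C_def)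
  qed
  have per: "C (t + T) = C t" for t
  proof -
    have "(t + T) / T = t / T + 1" using T by (simp add: field_simps)
    then show ?thesis by (simp add: C_def algebra_simps)
  qed
  have cont: "isCont C t" for t
  proof -
    define n where "n = \<lfloor>t / T\<rfloor>"
    have n: "T * of_int n \<le> t" "t < T * of_int n + T"
    proof -
      have "of_int n \<le> t / T" "t / T < of_int n + 1" unfolding n_def by linarith+
      then show "T * of_int n \<le> t" "t < T * of_int n + T" using T by (auto simp: field_simps)
    qed
    have cc: "continuous_on {T * of_int m..T * of_int m + T} C" for m :: int
    proof (rule continuous_on_eq)
      show "continuous_on {T * of_int m..T * of_int m + T} (\<lambda>y. c (y - T * of_int m))"
        by (rule continuous_on_compose2[OF c]) (auto intro: continuous_intros)
      show "c (y - T * of_int m) = C y" if "y \<in> {T * of_int m..T * of_int m + T}" for y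
        using val[of m y] that by simp
    qed
    have "continuous_on ({T * of_int (n - 1)..T * of_int (n - 1) + T} \<union> {T * of_int n..T * of_int n + T}) C"
      by (intro continuous_on_closed_Un cc) auto
    then have "continuous_on {T * of_int n - T<..<T * of_int n + T} C"
      by (rule continuous_on_subset) (auto simp: algebra_simps)
    then show ?thesis using n T by (subst (asm) continuous_on_eq_continuous_at) auto
  qed
  show ?thesis
    by (rule that[of C]) (use cont per val[of 0] in \<open>auto simp: continuous_on_eq_continuous_at\<close>)
qed

lemma wave_diff: "wave T k \<alpha> (t - c) = wave T k (\<alpha> - of_int k * (2 * pi / T) * c) t"
proof -
  have "of_int k * (2 * pi / T) * (t - c) + \<alpha> = of_int k * (2 * pi / T) * t + (\<alpha> - of_int k * (2 * pi / T) * c)"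
    by (simp only: right_diff_distrib)
  then show ?thesis by (simp only: wave_def)
qed

lemma wave_coefficient_shift:
  assumes T: "T > 0" and G: "continuous_on UNIV G" "\<And>t. G (t + T) = G t"
  shows "(LINT t:{0..<T}|lborel. G (t + c) * wave T k \<alpha> t)
     = coef T G k (\<alpha> - of_int k * (2 * pi / T) * c)"
proof -
  let ?F = "\<lambda>t. G t * wave T k (\<alpha> - of_int k * (2 * pi / T) * c) t"
  have "(LINT t:{0..<T}|lborel. ?F (t + c)) = (LINT t:{0..<T}|lborel. ?F t)"
    by (rule periodic_shift_integral[OF T]) (auto intro!: continuous_intros G wave_continuous simp: G wave_periodic[OF T])
  moreover have "wave T k (\<alpha> - of_int k * (2 * pi / T) * c) (t + c) = wave T k \<alpha> t" for t
    using wave_diff[of T k \<alpha> "t + c" c] by simp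
  ultimately show ?thesis by (simp only:)
qed

lemma coefficient_add:
  fixes D E :: "real \<Rightarrow> real"
  assumes D: "set_integrable lborel {0..<T} D" and E: "set_integrable lborel {0..<T} E"
  shows "(LINT t:{0..<T}|lborel. (D t + c * E t) * wave T k \<alpha> t)
    = coef T D k \<alpha> + c * coef T E k \<alpha>"
proof -
  have i: "set_integrable lborel {0..<T} (\<lambda>t. h t * wave T k \<alpha> t)" if "set_integrable lborel {0..<T} h" for h
    using that unfolding set_integral_Ico_Icc by (intro set_integrable_continuous_mult wave_continuous)
  have "(LINT t:{0..<T}|lborel. (D t + c * E t) * wave T k \<alpha> t) = (LINT t:{0..<T}|lborel. D t * wave T k \<alpha> t + c * (E t * wave T k \<alpha> t))"
    by (simp add: algebra_simps)
  also have "\<dots> = coef T D k \<alpha> + c * coef T E k \<alpha>"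
    using i[OF D] i[OF E] by (subst set_integral_add) auto
  finally show ?thesis .
qed

lemma continuous_coefficient_integrable:
  "continuous_on UNIV h \<Longrightarrow> set_integrable lborel {0..<T} (h :: real \<Rightarrow> real)"
  unfolding set_integral_Ico_Icc by (intro borel_integrable_atLeastAtMost') (auto intro: continuous_on_subset)

lemma wave_antiderivative:
  "(wave T k (\<alpha> - pi / 2) has_real_derivative of_int k * (2 * pi / T) * wave T k \<alpha> t) (at t)"
  using smooth_line_has_deriv[OF wave_smooth, of T k "\<alpha> - pi / 2" t] by (simp only: wave_deriv diff_add_cancel)

lemma wave_mean_zero:
  assumes T: "T > 0" and k: "k \<noteq> 0"
  shows "(LINT t:{0..<T}|lborel. wave T k \<alpha> t) = 0"
proof -
  define l where "l = of_int k * (2 * pi / T)"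
  have l: "l \<noteq> 0" using T k by (simp add: l_def)
  define W where "W t = wave T k (\<alpha> - pi / 2) t / l" for t
  have d: "(W has_real_derivative wave T k \<alpha> t) (at t)" for t
    using DERIV_cdivide[OF wave_antiderivative[of T k \<alpha> t], of l] l by (simp add: W_def[abs_def] l_def)
  have "(wave T k \<alpha> has_integral (W T - W 0)) {0..T}"
  proof (rule fundamental_theorem_of_calculus)
    show "(W has_vector_derivative wave T k \<alpha> t) (at t within {0..T})" for t
      by (rule has_vector_derivative_at_within[OF d[unfolded has_real_derivative_iff_has_vector_derivative]])
  qed (use T in simp)
  then have "integral {0..T} (wave T k \<alpha>) = W T - W 0" by (rule integral_unique)
  also have "\<dots> = 0" using wave_periodic[OF T, of k "\<alpha> - pi / 2" 0] by (simp add: W_def)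
  finally have "integral {0..T} (wave T k \<alpha>) = 0" .
  moreover have "(LINT t:{0..T}|lborel. wave T k \<alpha> t) = integral {0..T} (wave T k \<alpha>)"
    by (intro set_borel_integral_eq_integral(2) borel_integrable_atLeastAtMost' wave_continuous)
  ultimately show ?thesis by (simp add: set_integral_Ico_Icc)
qed

text \<open>Subtracting the mean makes the remaining coefficient vanish, too.\<close>
lemma AE_constant_if_coefficients_zero:
  assumes T: "T > 0" and D: "set_integrable lborel {0..<T} D"
    and z: "\<And>k \<alpha>. k \<noteq> 0 \<Longrightarrow> coef T D k \<alpha> = 0"
  obtains C where "AE t in lborel. t \<in> {0<..<T} \<longrightarrow> D t = C"
proof -
  define C where "C = (LINT t:{0..<T}|lborel. D t) / T"
  have one: "set_integrable lborel {0..<T} (\<lambda>_. 1 :: real)" by (rule continuous_coefficient_integrable) simp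
  have l1: "(LINT t:{0..<T}|lborel. 1 :: real) = T" using T by (simp add: set_lebesgue_integral_def)
  have "AE t in lborel. t \<in> {0<..<T} \<longrightarrow> D t + (- C) * 1 = 0"
  proof (rule Fourier_uniqueness_wave[OF T])
    show "set_integrable lborel {0..<T} (\<lambda>t. D t + (- C) * 1)"
      by (intro set_integral_add D set_integrable_mult_right impI one)
    fix k \<alpha>
    have "coef T D k \<alpha> + (- C) * (LINT t:{0..<T}|lborel. 1 * wave T k \<alpha> t) = 0"
    proof (cases "k = 0")
      case True
      have "(LINT t:{0..<T}|lborel. D t * cos \<alpha>) = (LINT t:{0..<T}|lborel. D t) * cos \<alpha>"
        "(LINT t:{0..<T}|lborel. cos \<alpha>) = T * cos \<alpha>" using T by (auto simp: set_lebesgue_integral_def)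
      then show ?thesis using True T by (simp add: wave_def C_def)
    next
      case False
      then show ?thesis using z[OF False] wave_mean_zero[OF T False] by simp
    qed
    then show "(LINT t:{0..<T}|lborel. (D t + (- C) * 1) * wave T k \<alpha> t) = 0"
      using coefficient_add[OF D one, of "- C" k \<alpha>] by simp
  qed
  then show ?thesis by (intro that[of C]) simp
qed

text \<open>The primitive of \<open>g'\<close> has the same coefficients of nonzero order as \<open>g\<close>, by integration by parts,
  and it is periodic, because the constant test function shows that \<open>g'\<close> has mean zero.\<close>
lemma W11_continuous_representative:
  assumes T: "T > 0" and W: "W11_circle T g g'"
  obtains G where "continuous_on UNIV G" "\<And>t. G (t + T) = G t"
    "AE t in lborel. t \<in> {0<..<T} \<longrightarrow> g t = G t"
    "\<And>t. t \<in> {0..T} \<Longrightarrow> G t = G 0 + (LINT y:{0..t}|lborel. g' y)"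
proof -
  have gi: "set_integrable lborel {0..<T} g" and g'i: "set_integrable lborel {0..<T} g'"
    and weak: "\<And>\<psi>. smooth_line \<psi> \<Longrightarrow> (\<And>t. \<psi> (t + T) = \<psi> t) \<Longrightarrow>
        (LINT t:{0..<T}|lborel. g t * deriv \<psi> t) = - (LINT t:{0..<T}|lborel. g' t * \<psi> t)"
    using W unfolding W11_circle_def by auto
  have g'I: "set_integrable lborel {0..T} g'" using g'i by (simp add: set_integral_Ico_Icc)
  define G0 where "G0 t = (LINT y:{0..t}|lborel. g' y)" for t
  have G0c: "continuous_on {0..T} G0" unfolding G0_def by (rule primitive_continuous[OF g'I])
  have G0i: "set_integrable lborel {0..<T} G0"
    unfolding set_integral_Ico_Icc by (rule borel_integrable_atLeastAtMost'[OF G0c])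
  have "(LINT t:{0..<T}|lborel. g t * deriv (wave T 0 0) t) = - (LINT t:{0..<T}|lborel. g' t * wave T 0 0 t)"
    by (rule weak[OF wave_smooth wave_periodic[OF T]])
  moreover have "deriv (wave T 0 0) = (\<lambda>t. 0)" "wave T 0 0 = (\<lambda>t. 1)"
    unfolding wave_deriv by (auto simp: wave_def)
  ultimately have "(LINT t:{0..<T}|lborel. g' t) = 0"
    by (simp add: set_lebesgue_integral_def)
  then have mean: "(LINT t:{0..T}|lborel. g' t) = 0" by (simp only: set_integral_Ico_Icc)
  have coef: "(LINT t:{0..<T}|lborel. (g t + (-1) * G0 t) * wave T k \<alpha> t) = 0" if k: "k \<noteq> 0" for k \<alpha>
  proof -
    let ?l = "of_int k * (2 * pi / T)" and ?\<psi> = "wave T k (\<alpha> - pi / 2)"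
    have l: "?l \<noteq> 0" using T k by simp
    note d = wave_antiderivative[of T k \<alpha>]
    have dd: "deriv ?\<psi> t = ?l * wave T k \<alpha> t" for t by (rule DERIV_imp_deriv[OF d])
    have "(LINT t:{0..T}|lborel. G0 t * (?l * wave T k \<alpha> t)) = ?\<psi> T * (LINT y:{0..T}|lborel. g' y) - (LINT y:{0..T}|lborel. g' y * ?\<psi> y)"
      unfolding G0_def by (rule integral_by_parts_primitive[OF _ g'I d]) (use T in \<open>auto intro!: continuous_intros wave_continuous\<close>)
    also have "\<dots> = (LINT t:{0..T}|lborel. g t * (?l * wave T k \<alpha> t))"
      using weak[OF wave_smooth wave_periodic[OF T], of k "\<alpha> - pi / 2"] unfolding dd set_integral_Ico_Icc mean by simp
    finally have "(LINT t:{0..T}|lborel. ?l * (G0 t * wave T k \<alpha> t)) = (LINT t:{0..T}|lborel. ?l * (g t * wave T k \<alpha> t))"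
      by (simp only: mult.left_commute)
    then have "?l * (LINT t:{0..T}|lborel. G0 t * wave T k \<alpha> t) = ?l * (LINT t:{0..T}|lborel. g t * wave T k \<alpha> t)"
      by (simp only: set_integral_mult_right)
    then have "(LINT t:{0..T}|lborel. G0 t * wave T k \<alpha> t) = (LINT t:{0..T}|lborel. g t * wave T k \<alpha> t)" using l by simp
    then show ?thesis using coefficient_add[OF gi G0i, of "-1" k \<alpha>] by (simp add: set_integral_Ico_Icc)
  qed
  have int: "set_integrable lborel {0..<T} (\<lambda>t. g t + (-1) * G0 t)"
    by (intro set_integral_add gi set_integrable_mult_right impI G0i)
  obtain C where C: "AE t in lborel. t \<in> {0<..<T} \<longrightarrow> g t + (-1) * G0 t = C"
    by (rule AE_constant_if_coefficients_zero[OF T int coef])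
  have G00: "G0 0 = 0" unfolding G0_def by (rule set_integral_point)
  have e: "C + G0 0 = C + G0 T" using mean G00 by (simp add: G0_def)
  obtain G where G: "continuous_on UNIV G" "\<And>t. G (t + T) = G t" "\<And>t. t \<in> {0..T} \<Longrightarrow> G t = C + G0 t"
    by (rule periodic_extension[OF T continuous_on_add[OF continuous_on_const G0c] e]) blast
  show ?thesis
  proof (rule that[OF G(1,2)])
    show "AE t in lborel. t \<in> {0<..<T} \<longrightarrow> g t = G t"
      using C by eventually_elim (auto simp: G(3))
    show "G t = G 0 + (LINT y:{0..t}|lborel. g' y)" if "t \<in> {0..T}" for t
      using G(3)[OF that] G(3)[of 0] T G00 by (simp add: G0_def)
  qed
qed

lemma coefficient_cong_AE:
  assumes "set_integrable lborel {0..<T} g" "set_integrable lborel {0..<T} G"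
    and eq: "AE t in lborel. t \<in> {0<..<T} \<longrightarrow> g t = G t"
  shows "coef T g k \<alpha> = coef T G k \<alpha>"
  unfolding set_lebesgue_integral_def
proof (rule integral_cong_AE)
  have m: "(\<lambda>t. indicator {0..<T} t *\<^sub>R (h t * wave T k \<alpha> t)) \<in> borel_measurable lborel"
    if "set_integrable lborel {0..<T} h" for h
  proof -
    have "set_integrable lborel {0..<T} (\<lambda>t. h t * wave T k \<alpha> t)"
      using that unfolding set_integral_Ico_Icc by (intro set_integrable_continuous_mult wave_continuous)
    then show ?thesis unfolding set_integrable_def by (rule borel_measurable_integrable)
  qed
  show "(\<lambda>t. indicator {0..<T} t *\<^sub>R (g t * wave T k \<alpha> t)) \<in> borel_measurable lborel"
    "(\<lambda>t. indicator {0..<T} t *\<^sub>R (G t * wave T k \<alpha> t)) \<in> borel_measurable lborel"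
    by (intro m assms)+
  have "AE t in lborel. t \<noteq> (0::real)" by (rule AE_lborel_singleton)
  with eq show "AE t in lborel. indicator {0..<T} t *\<^sub>R (g t * wave T k \<alpha> t) = indicator {0..<T} t *\<^sub>R (G t * wave T k \<alpha> t)"
    by eventually_elim (auto simp: indicator_def)
qed

section \<open>The boundary function of a weak solution\<close>

text \<open>Replaces the potential, which is unspecified at the interfaces, by a measurable bounded one.\<close>
lemma weak_identity_cong_potential:
  assumes T: "T > 0" and ut: "L2_cyl T ut" and ux: "L2_cyl T ux"
    and V': "V' \<in> borel_measurable borel" and N: "countable {x. V x \<noteq> V' x}"
    and \<phi>: "\<phi> \<in> test_fun T"
  shows "(LINT p:cyl T|lborel. - V (fst p) * ut p * pdt \<phi> p + ux p * pdx \<phi> p)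
       = (LINT p:cyl T|lborel. - V' (fst p) * ut p * pdt \<phi> p + ux p * pdx \<phi> p)"
proof -
  have V: "V \<in> borel_measurable borel"
    by (rule measurable_discrete_difference[OF V' N]) auto
  have "smooth_plane \<phi>" using \<phi> by (simp add: test_fun_def)
  from smooth_plane_continuous(2,3)[OF this, of UNIV]
  have [measurable]: "pdx \<phi> \<in> borel_measurable borel" "pdt \<phi> \<in> borel_measurable borel"
    by (auto intro: borel_measurable_continuous_onI)
  have [measurable]: "(\<lambda>p. indicator (cyl T) p * ut p) \<in> borel_measurable borel" "(\<lambda>p. indicator (cyl T) p * ux p) \<in> borel_measurable borel"
    using L2_cyl_measurable[OF ut] L2_cyl_measurable[OF ux] by (simp_all add: lborel_prod)
  have [measurable]: "(fst :: real \<times> real \<Rightarrow> real) \<in> borel_measurable borel"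
    by (intro borel_measurable_continuous_onI continuous_intros)
  have m: "(\<lambda>p. indicator (cyl T) p *\<^sub>R (- W (fst p) * ut p * pdt \<phi> p + ux p * pdx \<phi> p)) \<in> borel_measurable lborel"
    if [measurable]: "W \<in> borel_measurable borel" for W
  proof -
    have "(\<lambda>p. - W (fst p) * (indicator (cyl T) p * ut p) * pdt \<phi> p + (indicator (cyl T) p * ux p) * pdx \<phi> p) \<in> borel_measurable borel"
      by measurable
    moreover have "indicator (cyl T) p *\<^sub>R (- W (fst p) * ut p * pdt \<phi> p + ux p * pdx \<phi> p)
      = - W (fst p) * (indicator (cyl T) p * ut p) * pdt \<phi> p + (indicator (cyl T) p * ux p) * pdx \<phi> p" for p
      by (simp add: algebra_simps)
    ultimately show ?thesis by simp
  qed
  have "AE p::real\<times>real in lborel \<Otimes>\<^sub>M lborel. V (fst p) = V' (fst p)"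
  proof (rule lborel_pair.AE_pair_measure)
    have "Measurable.pred borel (\<lambda>p::real\<times>real. V (fst p) = V' (fst p))" using V V' by measurable
    then have "{p::real\<times>real. V (fst p) = V' (fst p)} \<in> sets borel" by (simp add: pred_def)
    then show "{p \<in> space (lborel \<Otimes>\<^sub>M lborel). V (fst (p::real\<times>real)) = V' (fst p)} \<in> sets (lborel \<Otimes>\<^sub>M lborel)"
      unfolding lborel_prod by simp
    have "AE x in lborel. x \<notin> {x. V x \<noteq> V' x}"
      by (rule AE_discrete_difference[OF N]) auto
    then show "AE x in lborel. AE y in lborel. V (fst (x, y)) = V' (fst (x, y))"
      by eventually_elim simp
  qed
  then have ae: "AE p::real\<times>real in lborel. V (fst p) = V' (fst p)" unfolding lborel_prod .
  show ?thesis unfolding set_lebesgue_integral_def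
    by (rule integral_cong_AE[OF m[OF V] m[OF V']]) (use ae in \<open>eventually_elim, simp\<close>)
qed

context layered_medium
begin

lemma countable_potential_difference:
  assumes "step_potential a b \<theta> V" shows "countable {x. V x \<noteq> (slow x)\<^sup>2}"
proof (rule countable_subset)
  show "{x. V x \<noteq> (slow x)\<^sup>2} \<subseteq> (range (\<lambda>n::int. hw + 2 * pi * n) \<union> range (\<lambda>n::int. - hw + 2 * pi * n)) \<union> range (\<lambda>n::int. pi + 2 * pi * n)"
    using potential_eq_slow[OF assms] by (force simp: interfaces_def)
qed (intro countable_Un countable_image countableI_type)

text \<open>The consequences of the mode equations for the coefficients of \<open>g\<close>, \<open>q = f(g')\<close> and \<open>u(x, \<cdot>)\<close>. For
  odd \<open>k\<close> the first statement is the ratio of \<open>U'\<close> and \<open>U\<close> at \<open>x = 0\<close>. It is multiplied by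
  \<open>sin (freq k * h)\<close>, and so is the fourth one, to avoid a division.\<close>
lemma boundary_coefficients:
  assumes V: "step_potential a b \<theta> V" and H1: "H1_cyl T u ux ut" and tr: "has_trace T u ux ut g"
    and weak: "\<forall>\<phi>\<in>test_fun T.
      (LINT p:cyl T|lborel. - V (fst p) * ut p * pdt \<phi> p + ux p * pdx \<phi> p)
        - (LINT t:{0..<T}|lborel. q t * pdt \<phi> (0, t)) = 0"
  shows "odd k \<Longrightarrow> coef T q k (\<alpha> + pi / 2) * sin (freq k * h)
        = sqrt a * cos (freq k * h) * coef T g k \<alpha>"
    and "even k \<Longrightarrow> coef T g k \<alpha> = 0"
    and "even k \<Longrightarrow> k \<noteq> 0 \<Longrightarrow> coef T q k (\<alpha> + pi / 2) = 0"
    and "odd k \<Longrightarrow> AE x in lborel. x > 0 \<longrightarrow> mode T (wave T k \<alpha>) u x * sin (freq k * h)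
        = - \<kappa> * Udec k x * coef T g k \<alpha>"
    and "even k \<Longrightarrow> AE x in lborel. x > 0 \<longrightarrow> mode T (wave T k \<alpha>) u x = 0"
proof -
  define Ge where "Ge = coef T g k \<alpha>"
  define Fe where "Fe = coef T q k (\<alpha> + pi / 2)"
  have L2: "L2_cyl T ut" "L2_cyl T ux" using H1 by (auto simp: H1_cyl_def)
  have Vm: "(\<lambda>x. (slow x)\<^sup>2) \<in> borel_measurable borel" using slow_measurable by measurable
  have Vb: "\<bar>(slow x)\<^sup>2\<bar> \<le> b" for x using a ab by (auto simp: slow_def)
  have weak': "(LINT p:cyl T|lborel. - (\<lambda>x. (slow x)\<^sup>2) (fst p) * ut p * pdt \<phi> p + ux p * pdx \<phi> p)
        - (LINT t:{0..<T}|lborel. q t * pdt \<phi> (0, t)) = 0" if "\<phi> \<in> test_fun T" for \<phi>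
    using bspec[OF weak that] weak_identity_cong_potential[OF T L2 Vm countable_potential_difference[OF V] that] by simp
  obtain U P where UP: "continuous_on {0..} U" "continuous_on {0..} P"
    "\<And>x. x \<ge> 0 \<Longrightarrow> U x = Ge + (LINT y:{0..x}|lborel. P y)"
    "\<And>x. x \<ge> 0 \<Longrightarrow> P x = - freq k * Fe + (LINT y:{0..x}|lborel. - (freq k)\<^sup>2 * (slow y)\<^sup>2 * U y)"
    "AE x in lborel. x > 0 \<longrightarrow> mode T (wave T k \<alpha>) u x = U x"
    "set_integrable lborel {0..} (\<lambda>x. (U x)\<^sup>2)" "set_integrable lborel {0..} (\<lambda>x. (P x)\<^sup>2)"
    unfolding Ge_def Fe_def freq_def
    by (rule mode_system[OF T H1 tr Vm Vb weak', of k \<alpha>]) blast+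
  have sol: "mode_solution (freq k) U P" by (rule mode_solution_integral[OF UP(1-4)])
  have U0: "U 0 = Ge" and P0: "P 0 = - freq k * Fe" using UP(3)[of 0] UP(4)[of 0] unfolding set_integral_point by simp_all
  have fk: "freq k \<noteq> 0" if "k \<noteq> 0" using T that by (simp add: freq_def)
  { assume k: "odd k"
    have "freq k * (Fe * sin (freq k * h)) = freq k * (sqrt a * cos (freq k * h) * Ge)"
    proof -
      have "Ge * (freq k * sqrt a * cos (freq k * h)) = (freq k * Fe) * sin (freq k * h)"
        using odd_mode_decays(2)[OF k sol UP(6,7)] unfolding U0 P0 by simp
      from this[symmetric] show ?thesis by (simp only: mult_ac)
    qed
    then show "coef T q k (\<alpha> + pi / 2) * sin (freq k * h)
        = sqrt a * cos (freq k * h) * coef T g k \<alpha>"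
      using fk k by (auto simp: Ge_def Fe_def)
    obtain A where A: "\<And>x. x \<ge> 0 \<Longrightarrow> U x = A * Udec k x"
      using odd_mode_decays(1)[OF k sol UP(6,7)] by blast
    have "Udec k 0 * \<kappa> = - sin (freq k * h)"
      using kappa by (simp add: Udec_def s_0 n1_0 power_int_minus)
    then have As: "A * sin (freq k * h) = - \<kappa> * Ge"
      using A[of 0] U0 by (simp add: algebra_simps)
    have Us: "U x * sin (freq k * h) = - \<kappa> * Udec k x * Ge" if "x \<ge> 0" for x
    proof -
      have "U x * sin (freq k * h) = (A * sin (freq k * h)) * Udec k x" using A[OF that] by simp
      then show ?thesis unfolding As by simp
    qed
    show "AE x in lborel. x > 0 \<longrightarrow> mode T (wave T k \<alpha>) u x * sin (freq k * h)
        = - \<kappa> * Udec k x * coef T g k \<alpha>"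
      unfolding Ge_def[symmetric] using UP(5) by eventually_elim (use Us in auto)
  next
    assume k: "even k"
    note z = even_mode_vanishes[OF k sol UP(6,7)]
    show "coef T g k \<alpha> = 0" using z[of 0] U0 by (simp add: Ge_def)
    show "AE x in lborel. x > 0 \<longrightarrow> mode T (wave T k \<alpha>) u x = 0"
      using UP(5) by eventually_elim (simp add: z)
    assume "k \<noteq> 0"
    then show "coef T q k (\<alpha> + pi / 2) = 0"
      using z[of 0] P0 fk by (simp add: Fe_def)
  }
qed

text \<open>For odd \<open>k\<close> the angle \<open>freq k * h\<close> is an odd multiple of \<open>\<pi> / 4\<close>. The third identity turns the
  impedance \<open>cot (freq k * h)\<close> into the effect \<open>sin (freq k * (2 * h))\<close> of a time shift.\<close>
lemma freq_h_odd:
  assumes "odd k"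
  shows "cos (freq k * (2 * h)) = 0" "sin (freq k * h) \<noteq> 0"
    "sin (freq k * h) * sin (freq k * (2 * h)) = cos (freq k * h)" "2 * (sin (freq k * h))\<^sup>2 = 1"
proof -
  have "cos (freq k * s (- hw + 2 * pi * of_int 0)) = 0" by (rule cos_freq_n2_odd[OF assms])
  then show c: "cos (freq k * (2 * h)) = 0" by (simp only: s_n2_interface) simp
  have e: "freq k * (2 * h) = 2 * (freq k * h)" by simp
  show half: "2 * (sin (freq k * h))\<^sup>2 = 1" using c unfolding e cos_double_sin by simp
  then show "sin (freq k * h) \<noteq> 0" by auto
  have "sin (freq k * h) * sin (freq k * (2 * h)) = (2 * (sin (freq k * h))\<^sup>2) * cos (freq k * h)"
    unfolding e sin_double by (simp add: power2_eq_square)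
  then show "sin (freq k * h) * sin (freq k * (2 * h)) = cos (freq k * h)" by (simp only: half mult_1)
qed

lemma freq_half_period: "freq k * (T / 2) = pi * of_int k"
  using T by (simp add: freq_def field_simps)

text \<open>Comparing coefficients gives \<open>f (g' t) = sqrt a * G (t + 2 * h) + C\<close> almost everywhere. Solving for \<open>g'\<close>
  shows that \<open>G\<close> is continuously differentiable. The constant is zero because \<open>G\<close>, \<open>G'\<close> and, as
  \<open>f\<close> is odd, also \<open>f (G' t)\<close> are antiperiodic.\<close>
lemma boundary_function:
  assumes f: "\<And>y. f (- y) = - f y" "homeomorphism UNIV UNIV f (inv f)"
    and V: "step_potential a b \<theta> V" and H1: "H1_cyl T u ux ut" and tr: "has_trace T u ux ut g"
    and W: "W11_circle T g g'" and fi: "set_integrable lborel {0..<T} (\<lambda>t. f (g' t))"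
    and weak: "\<forall>\<phi>\<in>test_fun T.
      (LINT p:cyl T|lborel. - V (fst p) * ut p * pdt \<phi> p + ux p * pdx \<phi> p)
        - (LINT t:{0..<T}|lborel. f (g' t) * pdt \<phi> (0, t)) = 0"
  obtains G p where "\<And>t. (G has_real_derivative p t) (at t)" "continuous_on UNIV p"
    "\<And>t. G (t + T / 2) = - G t" "\<And>t. f (p t) = sqrt a * G (t + 2 * h)"
    "\<And>k \<alpha>. coef T g k \<alpha> = coef T G k \<alpha>"
proof -
  obtain G where Gc: "continuous_on UNIV G" and GT: "\<And>t. G (t + T) = G t"
    and Gae: "AE t in lborel. t \<in> {0<..<T} \<longrightarrow> g t = G t"
    and Gint: "\<And>t. t \<in> {0..T} \<Longrightarrow> G t = G 0 + (LINT y:{0..t}|lborel. g' y)"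
    by (rule W11_continuous_representative[OF T W]) blast
  have gi: "set_integrable lborel {0..<T} g" and g'i: "set_integrable lborel {0..<T} g'"
    using W by (auto simp: W11_circle_def)
  have coef: "coef T g k \<alpha> = coef T G k \<alpha>" for k \<alpha>
    by (rule coefficient_cong_AE[OF gi continuous_coefficient_integrable[OF Gc] Gae])
  note bc = boundary_coefficients[OF V H1 tr weak]
  have shiftc: "continuous_on UNIV (\<lambda>t. G (t + c))" for c
    by (rule continuous_on_compose2[OF Gc]) (auto intro: continuous_intros)
  note shift = wave_coefficient_shift[OF T Gc GT, folded freq_def]
  \<comment> \<open>A shift by half a period multiplies the \<open>k\<close>-th coefficients by \<open>(-1)\<^sup>k\<close>, and the even ones vanish.\<close>
  have anti: "G (t + T / 2) = - G t" for t
  proof -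
    have "G t + 1 * G (t + T / 2) = 0"
    proof (rule continuous_Fourier_zero[where D = "\<lambda>t. G t + 1 * G (t + T / 2)", OF T])
      show "continuous_on UNIV (\<lambda>t. G t + 1 * G (t + T / 2))" by (intro continuous_intros Gc shiftc)
      show "G (t + T) + 1 * G (t + T + T / 2) = G t + 1 * G (t + T / 2)" for t
        using GT[of t] GT[of "t + T / 2"] by (simp add: algebra_simps)
      fix k \<alpha>
      have "coef T G k \<alpha> + 1 * coef T (\<lambda>t. G (t + T / 2)) k \<alpha> = 0"
      proof (cases "even k")
        case True
        then show ?thesis unfolding shift using bc(2)[OF True] by (simp add: coef)
      next
        case False
        have "wave T k (\<alpha> - freq k * (T / 2)) t = - wave T k \<alpha> t" for t
        proof -
          have e: "freq k * t + (\<alpha> - freq k * (T / 2)) = (freq k * t + \<alpha>) - pi * of_int k"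
            unfolding freq_half_period by simp
          have "cos (pi * of_int k) = -1" using False by (auto simp: cos_int_times_real elim!: oddE)
          then show ?thesis unfolding wave_def freq_def[symmetric] e cos_diff by simp
        qed
        then show ?thesis unfolding shift by (simp add: set_lebesgue_integral_def)
      qed
      then show "(LINT t:{0..<T}|lborel. (G t + 1 * G (t + T / 2)) * wave T k \<alpha> t) = 0"
        by (subst coefficient_add) (auto intro!: continuous_coefficient_integrable Gc shiftc)
    qed
    then show ?thesis by simp
  qed
  \<comment> \<open>For odd \<open>k\<close> the impedance \<open>sqrt a * cot (freq k * h)\<close> equals \<open>sqrt a * sin (freq k * (2 * h))\<close>, which is the
    factor produced by the shift by \<open>2 * h\<close>. The mean value stays undetermined at this point.\<close>
  have cz: "(LINT t:{0..<T}|lborel. (f (g' t) + (- sqrt a) * G (t + 2 * h)) * wave T k \<alpha> t) = 0" if k0: "k \<noteq> 0" for k \<alpha>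
  proof -
    have a2: "\<alpha> = (\<alpha> - pi / 2) + pi / 2" by simp
    have "coef T (\<lambda>t. f (g' t)) k \<alpha> + (- sqrt a) * coef T (\<lambda>t. G (t + 2 * h)) k \<alpha> = 0"
    proof (cases "even k")
      case True
      have "coef T (\<lambda>t. f (g' t)) k \<alpha> = 0"
        using bc(3)[OF True k0, of "\<alpha> - pi / 2"] by simp
      moreover have "coef T (\<lambda>t. G (t + 2 * h)) k \<alpha> = 0"
        unfolding shift using bc(2)[OF True] by (simp add: coef)
      ultimately show ?thesis by simp
    next
      case False
      define X where "X = coef T G k (\<alpha> - pi / 2)"
      have 1: "coef T (\<lambda>t. f (g' t)) k \<alpha> * sin (freq k * h) = sqrt a * cos (freq k * h) * X"
        using bc(1)[OF False, of "\<alpha> - pi / 2"] by (simp add: coef X_def)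
      have "wave T k (\<alpha> - freq k * (2 * h)) t = sin (freq k * (2 * h)) * wave T k (\<alpha> - pi / 2) t" for t
      proof -
        have e: "freq k * t + (\<alpha> - freq k * (2 * h)) = (freq k * t + \<alpha>) - freq k * (2 * h)"
          "freq k * t + (\<alpha> - pi / 2) = (freq k * t + \<alpha>) - pi / 2" by simp_all
        show ?thesis unfolding wave_def freq_def[symmetric] e cos_diff freq_h_odd(1)[OF False] by simp
      qed
      then have "coef T (\<lambda>t. G (t + 2 * h)) k \<alpha> = (LINT t:{0..<T}|lborel. sin (freq k * (2 * h)) * (G t * wave T k (\<alpha> - pi / 2) t))"
        unfolding shift by (simp add: algebra_simps)
      then have 2: "coef T (\<lambda>t. G (t + 2 * h)) k \<alpha> = sin (freq k * (2 * h)) * X"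
        by (simp only: X_def set_integral_mult_right)
      have "sin (freq k * h) * (coef T (\<lambda>t. f (g' t)) k \<alpha> + (- sqrt a) * (sin (freq k * (2 * h)) * X))
         = sqrt a * X * (cos (freq k * h) - sin (freq k * h) * sin (freq k * (2 * h)))"
        using 1 by (simp add: algebra_simps)
      also have "\<dots> = 0" by (simp add: freq_h_odd(3)[OF False])
      finally show ?thesis unfolding 2 using freq_h_odd(2)[OF False] by simp
    qed
    then show ?thesis
      by (subst coefficient_add[OF fi continuous_coefficient_integrable[OF shiftc]])
  qed
  have iz: "set_integrable lborel {0..<T} (\<lambda>t. f (g' t) + (- sqrt a) * G (t + 2 * h))"
    by (intro set_integral_add fi set_integrable_mult_right impI continuous_coefficient_integrable shiftc)
  obtain C where C: "AE t in lborel. t \<in> {0<..<T} \<longrightarrow> f (g' t) + (- sqrt a) * G (t + 2 * h) = C"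
    by (rule AE_constant_if_coefficients_zero[OF T iz cz])
  define p where "p t = inv f (sqrt a * G (t + 2 * h) + C)" for t
  have finv: "inv f (f y) = y" "f (inv f y) = y" for y
    using f(2) by (auto simp: homeomorphism_def)
  have pc: "continuous_on UNIV p"
    unfolding p_def
    by (rule continuous_on_compose2[of UNIV "inv f"]) (use f(2) in \<open>auto simp: homeomorphism_def intro!: continuous_intros shiftc\<close>)
  have pT: "p (t + T) = p t" for t
    unfolding p_def using GT[of "t + 2 * h"] by (simp add: algebra_simps)
  have fp: "f (p t) = sqrt a * G (t + 2 * h) + C" for t by (simp add: p_def finv)
  have g'p: "AE t in lborel. t > 0 \<longrightarrow> (if t < T then g' t else p t) = p t"
    using C
  proof eventually_elim
    case (elim t)
    have "p t = inv f (f (g' t))" if "0 < t" "t < T"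
    proof -
      have "sqrt a * G (t + 2 * h) + C = f (g' t)" using elim that by auto
      then show ?thesis by (simp only: p_def)
    qed
    then show ?case by (simp add: finv)
  qed
  obtain H0 where H0: "\<And>t. (H0 has_real_derivative p t) (at t)"
    by (rule exists_antiderivative[OF pc]) blast
  define H where "H t = G 0 + (H0 t - H0 0)" for t
  have Hd: "(H has_real_derivative p t) (at t)" for t
    unfolding H_def by (auto intro!: derivative_eq_intros H0)
  have HG: "H t = G t" if t: "t \<in> {0..T}" for t
  proof -
    have pi: "set_integrable lborel {0..t} p" by (rule borel_integrable_atLeastAtMost'[OF continuous_on_subset[OF pc]]) auto
    have "(LINT y:{0..t}|lborel. g' y) = (LINT y:{0..t}|lborel. p y)"
      unfolding set_lebesgue_integral_def
    proof (rule integral_cong_AE)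
      have "set_integrable lborel {0..t} g'"
        by (rule set_integrable_subset[OF g'i[unfolded set_integral_Ico_Icc]]) (use t in auto)
      then show "(\<lambda>y. indicator {0..t} y *\<^sub>R g' y) \<in> borel_measurable lborel"
        unfolding set_integrable_def by (rule borel_measurable_integrable)
      show "(\<lambda>y. indicator {0..t} y *\<^sub>R p y) \<in> borel_measurable lborel"
        using pi unfolding set_integrable_def by (rule borel_measurable_integrable)
      have "AE y in lborel. y \<noteq> (0::real)" "AE y in lborel. y \<noteq> T" by (rule AE_lborel_singleton)+
      with g'p show "AE y in lborel. indicator {0..t} y *\<^sub>R g' y = indicator {0..t} y *\<^sub>R p y"
        by eventually_elim (use t in \<open>auto simp: indicator_def split: if_splits\<close>)
    qed
    also have "\<dots> = integral {0..t} p" by (rule set_borel_integral_eq_integral(2)[OF pi])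
    also have "(p has_integral (H t - H 0)) {0..t}"
    proof (rule fundamental_theorem_of_calculus)
      show "(H has_vector_derivative p y) (at y within {0..t})" for y
        by (rule has_vector_derivative_at_within[OF Hd[unfolded has_real_derivative_iff_has_vector_derivative]])
    qed (use t in simp)
    then have "integral {0..t} p = H t - H 0" by (rule integral_unique)
    finally show ?thesis using Gint[OF t] by (simp add: H_def)
  qed
  have HT: "H (t + T) = H t" for t
  proof -
    have "((\<lambda>t. H (t + T) - H t) has_real_derivative p (t + T) * 1 - p t) (at t)" for t
      by (intro DERIV_diff Hd DERIV_chain2[where f = H, OF Hd]) (auto intro!: derivative_eq_intros)
    then have "((\<lambda>t. H (t + T) - H t) has_real_derivative 0) (at t)" for t using pT by simp
    then have "H (t + T) - H t = H (0 + T) - H 0"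
      using DERIV_isconst_all[of "\<lambda>t. H (t + T) - H t"] by blast
    also have "\<dots> = 0" using HG[of 0] HG[of T] GT[of 0] T by simp
    finally show ?thesis by simp
  qed
  have HGall: "H t = G t" for t
  proof -
    have "H t - G t = 0"
      by (rule periodic_zero[OF T, of "\<lambda>t. H t - G t"]) (use HT GT HG in auto)
    then show ?thesis by simp
  qed
  then have HGf: "H = G" by auto
  have Gd: "(G has_real_derivative p t) (at t)" for t using Hd unfolding HGf .
  have panti: "p (t + T / 2) = - p t" for t
  proof -
    have "((\<lambda>t. G (t + T / 2)) has_real_derivative p (t + T / 2) * 1) (at t)"
      by (rule DERIV_chain2[where f = G, OF Gd]) (auto intro!: derivative_eq_intros)
    moreover have "((\<lambda>t. G (t + T / 2)) has_real_derivative - p t) (at t)"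
      unfolding anti by (intro DERIV_minus Gd)
    ultimately show ?thesis using DERIV_unique by fastforce
  qed
  have "C = 0"
  proof -
    have "f (p (0 + T / 2)) = - f (p 0)" unfolding panti f(1) ..
    then show ?thesis using anti[of "2 * h"] unfolding fp by (simp add: algebra_simps)
  qed
  with fp have "f (p t) = sqrt a * G (t + 2 * h)" for t by simp
  then show ?thesis using that[OF Gd pc anti _ coef] by blast
qed

end

section \<open>The d'Alembert solution generated by a boundary function\<close>

text \<open>A product of a bounded step factor and a factor that varies by at most \<open>W\<close> varies by a multiple of
  \<open>W\<close>, if the second factor has a zero between the two points whenever the step factor jumps.\<close>
lemma jump_bound:
  fixes A1 A2 m1 m2 W M :: real
  assumes "\<bar>m1\<bar> \<le> M" "\<bar>m2\<bar> \<le> M" "\<bar>A1 - A2\<bar> \<le> W" "m1 \<noteq> m2 \<Longrightarrow> \<bar>A1\<bar> \<le> W \<and> \<bar>A2\<bar> \<le> W"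
  shows "\<bar>m1 * A1 - m2 * A2\<bar> \<le> 2 * M * W"
proof (cases "m1 = m2")
  case True
  have W: "0 \<le> W" "0 \<le> M" using assms(1,3) by linarith+
  have "\<bar>m1 * A1 - m2 * A2\<bar> = \<bar>m1\<bar> * \<bar>A1 - A2\<bar>" using True by (simp add: abs_mult flip: right_diff_distrib)
  also have "\<dots> \<le> M * W" using assms W by (intro mult_mono) auto
  also have "\<dots> \<le> 2 * M * W" using W by simp
  finally show ?thesis .
next
  case False
  have M: "0 \<le> M" using assms(1) by linarith
  have "\<bar>m1 * A1 - m2 * A2\<bar> \<le> \<bar>m1\<bar> * \<bar>A1\<bar> + \<bar>m2\<bar> * \<bar>A2\<bar>" by (metis abs_mult abs_triangle_ineq4)
  also have "\<dots> \<le> M * W + M * W" using assms False M by (intro add_mono mult_mono) auto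
  finally show ?thesis by simp
qed

lemma holder_on_imp_continuous_on:
  assumes "holder_on r S g" "r > 0" shows "continuous_on S g"
proof -
  obtain L where L: "\<And>x y. x \<in> S \<Longrightarrow> y \<in> S \<Longrightarrow> \<bar>g x - g y\<bar> \<le> L * dist x y powr r"
    using assms(1) by (auto simp: holder_on_def)
  show ?thesis unfolding continuous_on_def
  proof
    fix x assume x: "x \<in> S"
    have d: "((\<lambda>y. dist y x) \<longlongrightarrow> 0) (at x within S)"
      using tendsto_dist[OF tendsto_ident_at tendsto_const, of x x S] by simp
    have "((\<lambda>y. L * dist y x powr r) \<longlongrightarrow> L * 0) (at x within S)"
      by (intro tendsto_mult tendsto_const tendsto_zero_powrI[OF d tendsto_const]) (use assms(2) in auto)
    then have lim: "((\<lambda>y. L * dist y x powr r) \<longlongrightarrow> 0) (at x within S)" by simp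
    have "((\<lambda>y. g y - g x) \<longlongrightarrow> 0) (at x within S)"
      by (rule Lim_null_comparison[OF _ lim]) (auto simp: eventually_at_filter intro!: always_eventually L x)
    then show "(g \<longlongrightarrow> g x) (at x within S)" by (simp add: LIM_zero_iff)
  qed
qed

context layered_medium
begin

text \<open>At the interfaces the waves travelling to the left and to the right agree up to sign.\<close>
lemma antiperiodic_shift:
  fixes F :: "real \<Rightarrow> real"
  assumes "\<And>t. F (t + T / 2) = - F t"
  shows "F (t + of_int n * \<sigma>) = F (t - of_int n * \<sigma>)" and "F (t + (of_int n * \<sigma> - 2 * h)) = - F (t - (of_int n * \<sigma> - 2 * h))"
proof -
  have per: "F (t + T) = F t" for t
    using assms[of t] assms[of "t + T / 2"] by (simp add: algebra_simps)
  note pi = periodic_int[of F T, OF per]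
  have "t + of_int n * \<sigma> = (t - of_int n * \<sigma>) + of_int (n * (int ma + int mb + 1)) * T"
    by (simp add: resonance(2) field_simps)
  then show "F (t + of_int n * \<sigma>) = F (t - of_int n * \<sigma>)" by (simp only: pi)
  have "t + (of_int n * \<sigma> - 2 * h) = (t - (of_int n * \<sigma> - 2 * h) + T / 2) + of_int (n * (int ma + int mb + 1) - int ma - 1) * T"
    by (simp add: resonance field_simps)
  then show "F (t + (of_int n * \<sigma> - 2 * h)) = - F (t - (of_int n * \<sigma> - 2 * h))" by (simp only: pi assms)
qed

lemma antiperiodic_derivative:
  fixes F F' :: "real \<Rightarrow> real"
  assumes d: "\<And>t. (F has_real_derivative F' t) (at t)" and anti: "\<And>t. F (t + T / 2) = - F t"
  shows "F' (t + T / 2) = - F' t"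
proof (rule DERIV_unique)
  have "((\<lambda>t. F (t + T / 2)) has_real_derivative F' (t + T / 2) * 1) (at t)"
    by (rule DERIV_chain2[where f = F, OF d]) (auto intro!: derivative_eq_intros)
  then show "((\<lambda>t. F (t + T / 2)) has_real_derivative F' (t + T / 2)) (at t)" by simp
  show "((\<lambda>t. F (t + T / 2)) has_real_derivative - F' t) (at t)"
    unfolding anti by (intro DERIV_minus d)
qed

lemma bounded_if_antiperiodic:
  fixes F :: "real \<Rightarrow> real"
  assumes c: "continuous_on UNIV F" and anti: "\<And>t. F (t + T / 2) = - F t"
  obtains M where "\<And>t. \<bar>F t\<bar> \<le> M"
proof -
  have per: "F (t + T) = F t" for t
    using anti[of t] anti[of "t + T / 2"] by (simp add: algebra_simps)
  obtain M where M: "\<And>t. t \<in> {0..T} \<Longrightarrow> \<bar>F t\<bar> \<le> M"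
    using compact_imp_bounded[OF compact_continuous_image[OF continuous_on_subset[OF c] compact_Icc]]
    by (fastforce simp: bounded_iff)
  have "\<bar>F t\<bar> \<le> M" for t
  proof -
    obtain n :: int where "t - of_int n * T \<in> {0..<T}" using shift_into_period[OF T] by blast
    then have "t - of_int n * T \<in> {0..T}" by simp
    from M[OF this] show ?thesis using periodic_int[of F T "t - of_int n * T" n, OF per] by simp
  qed
  then show ?thesis by (rule that)
qed

end

text \<open>The properties of the boundary function on which the construction of the solution rests; \<open>p\<close> is
  its derivative.\<close>
locale boundary_data = layered_medium +
  fixes G p :: "real \<Rightarrow> real" and r Lp :: real
  assumes G_DERIV: "\<And>t. (G has_real_derivative p t) (at t)"
    and p_continuous: "continuous_on UNIV p"
    and G_anti: "\<And>t. G (t + T / 2) = - G t"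
    and r: "0 < r" "r < 1"
    and p_holder: "\<And>t t'. \<bar>p t - p t'\<bar> \<le> Lp * \<bar>t - t'\<bar> powr r"
begin

text \<open>The normalization for which \<open>v\<close> below has the boundary values \<open>G\<close>.\<close>
definition Q where "Q t = \<kappa> / 2 * (G (t + h) - G (t - h))"
definition Q' where "Q' t = \<kappa> / 2 * (p (t + h) - p (t - h))"
text \<open>D'Alembert's formula in terms of the travel time. The minus sign makes \<open>v\<close> vanish at the right ends
  of the \<open>a\<close>-layers, where the amplitude jumps.\<close>
definition v :: "real \<times> real \<Rightarrow> real" where "v = (\<lambda>(x, t). \<kappa> powi n1 x * (Q (t + s x) - Q (t - s x)))"
definition vt :: "real \<times> real \<Rightarrow> real" where "vt = (\<lambda>(x, t). \<kappa> powi n1 x * (Q' (t + s x) - Q' (t - s x)))"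
definition vx :: "real \<times> real \<Rightarrow> real" where "vx = (\<lambda>(x, t). sqrt b * \<kappa> powi n2 x * (Q' (t + s x) + Q' (t - s x)))"

lemma p_anti: "p (t + T / 2) = - p t"
  by (rule antiperiodic_derivative[OF G_DERIV G_anti])

lemma Q_anti: "Q (t + T / 2) = - Q t" and Q'_anti: "Q' (t + T / 2) = - Q' t"
proof -
  have e: "t + T / 2 + h = t + h + T / 2" "t + T / 2 - h = t - h + T / 2" by auto
  show "Q (t + T / 2) = - Q t" "Q' (t + T / 2) = - Q' t"
    unfolding Q_def Q'_def e G_anti p_anti by (simp_all add: algebra_simps)
qed

lemma Q_DERIV: "(Q has_real_derivative Q' t) (at t)"
proof -
  have "((\<lambda>t. G (t + h)) has_real_derivative p (t + h) * 1) (at t)"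
    by (rule DERIV_chain2[where f = G, OF G_DERIV]) (auto intro!: derivative_eq_intros)
  moreover have "((\<lambda>t. G (t - h)) has_real_derivative p (t - h) * 1) (at t)"
    by (rule DERIV_chain2[where f = G, OF G_DERIV]) (auto intro!: derivative_eq_intros)
  ultimately have "((\<lambda>t. \<kappa> / 2 * (G (t + h) - G (t - h))) has_real_derivative \<kappa> / 2 * (p (t + h) * 1 - p (t - h) * 1)) (at t)"
    by (intro DERIV_cmult DERIV_diff)
  then show ?thesis by (simp add: Q_def[abs_def] Q'_def)
qed

lemma Q_at_n1: "Q (t + of_int n * \<sigma>) = Q (t - of_int n * \<sigma>)" "Q' (t + of_int n * \<sigma>) = Q' (t - of_int n * \<sigma>)"
  by (rule antiperiodic_shift(1)[of Q, OF Q_anti] antiperiodic_shift(1)[of Q', OF Q'_anti])+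

lemma Q_at_n2: "Q' (t + (of_int n * \<sigma> - 2 * h)) = - Q' (t - (of_int n * \<sigma> - 2 * h))"
  by (rule antiperiodic_shift(2)[of Q', OF Q'_anti])

lemma Q'_continuous: "continuous_on UNIV Q'"
  unfolding Q'_def by (intro continuous_intros continuous_on_compose2[OF p_continuous]) auto

lemma Q_continuous: "continuous_on UNIV Q"
  using Q_DERIV DERIV_continuous_on has_field_derivative_at_within by blast

definition MQ where "MQ = (SOME M. \<forall>t. \<bar>Q t\<bar> \<le> M \<and> \<bar>Q' t\<bar> \<le> M)"

lemma MQ: "\<bar>Q t\<bar> \<le> MQ" "\<bar>Q' t\<bar> \<le> MQ" "0 \<le> MQ"
proof -
  obtain M1 where 1: "\<And>t. \<bar>Q t\<bar> \<le> M1" by (rule bounded_if_antiperiodic[OF Q_continuous Q_anti]) blast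
  obtain M2 where 2: "\<And>t. \<bar>Q' t\<bar> \<le> M2" by (rule bounded_if_antiperiodic[OF Q'_continuous Q'_anti]) blast
  have "\<forall>t. \<bar>Q t\<bar> \<le> max M1 M2 \<and> \<bar>Q' t\<bar> \<le> max M1 M2"
    using 1 2 by (auto simp: le_max_iff_disj)
  then have "\<forall>t. \<bar>Q t\<bar> \<le> MQ \<and> \<bar>Q' t\<bar> \<le> MQ" unfolding MQ_def by (rule someI)
  then show "\<bar>Q t\<bar> \<le> MQ" "\<bar>Q' t\<bar> \<le> MQ" "0 \<le> MQ" using abs_ge_zero order_trans by blast+
qed

lemma Lp_nonneg: "0 \<le> Lp" using p_holder[of 1 0] by simp

lemma Q'_holder: "\<bar>Q' t - Q' t'\<bar> \<le> \<kappa> * Lp * \<bar>t - t'\<bar> powr r"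
proof -
  have e: "Q' t - Q' t' = \<kappa> / 2 * ((p (t + h) - p (t' + h)) - (p (t - h) - p (t' - h)))"
    unfolding Q'_def by (simp only: right_diff_distrib)
  have "\<bar>Q' t - Q' t'\<bar> = \<kappa> / 2 * \<bar>(p (t + h) - p (t' + h)) - (p (t - h) - p (t' - h))\<bar>"
    unfolding e abs_mult using kappa by simp
  also have "\<dots> \<le> \<kappa> / 2 * (Lp * \<bar>t - t'\<bar> powr r + Lp * \<bar>t - t'\<bar> powr r)"
  proof (rule mult_left_mono)
    have "\<bar>p (t + h) - p (t' + h)\<bar> \<le> Lp * \<bar>t - t'\<bar> powr r" "\<bar>p (t - h) - p (t' - h)\<bar> \<le> Lp * \<bar>t - t'\<bar> powr r"
      using p_holder[of "t + h" "t' + h"] p_holder[of "t - h" "t' - h"] by simp_all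
    then show "\<bar>(p (t + h) - p (t' + h)) - (p (t - h) - p (t' - h))\<bar> \<le> Lp * \<bar>t - t'\<bar> powr r + Lp * \<bar>t - t'\<bar> powr r"
      by linarith
  qed (use kappa in simp)
  finally show ?thesis by (simp add: algebra_simps)
qed

lemma phase_dist: "\<bar>(t + s x) - (t' + s y)\<bar> \<le> \<bar>t - t'\<bar> + sqrt b * \<bar>x - y\<bar>" "\<bar>(t - s x) - (t' - s y)\<bar> \<le> \<bar>t - t'\<bar> + sqrt b * \<bar>x - y\<bar>"
  using s_Lipschitz[of x y] by linarith+

definition LH where "LH = 2 * (\<kappa> * Lp * (1 + sqrt b) powr r)"

lemma Q'_phase_holder:
  fixes \<epsilon> :: real
  assumes "\<epsilon> = 1 \<or> \<epsilon> = -1" "\<bar>x - y\<bar> \<le> d" "\<bar>t - t'\<bar> \<le> d"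
  shows "\<bar>(Q' (t + s x) + \<epsilon> * Q' (t - s x)) - (Q' (t' + s y) + \<epsilon> * Q' (t' - s y))\<bar> \<le> LH * d powr r"
proof -
  have d: "0 \<le> d" using assms(2) by linarith
  have "sqrt b * \<bar>x - y\<bar> \<le> sqrt b * d" using assms(2) sqrt_pos by (intro mult_left_mono) auto
  then have b1: "\<bar>(t + s x) - (t' + s y)\<bar> \<le> (1 + sqrt b) * d" and b2: "\<bar>(t - s x) - (t' - s y)\<bar> \<le> (1 + sqrt b) * d"
    using phase_dist[where t = t and x = x and t' = t' and y = y] assms(3) by (simp_all add: distrib_right)
  have K: "0 \<le> \<kappa> * Lp" using kappa Lp_nonneg by simp
  have q: "\<bar>Q' z - Q' z'\<bar> \<le> \<kappa> * Lp * ((1 + sqrt b) powr r * d powr r)" if "\<bar>z - z'\<bar> \<le> (1 + sqrt b) * d" for z z'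
  proof -
    have "\<bar>z - z'\<bar> powr r \<le> ((1 + sqrt b) * d) powr r" using that r by (intro powr_mono2) auto
    also have "\<dots> = (1 + sqrt b) powr r * d powr r" by (rule powr_mult)
    finally show ?thesis using Q'_holder[of z z'] K by (meson mult_left_mono order_trans)
  qed
  have "\<bar>(Q' (t + s x) + \<epsilon> * Q' (t - s x)) - (Q' (t' + s y) + \<epsilon> * Q' (t' - s y))\<bar>
      \<le> \<bar>Q' (t + s x) - Q' (t' + s y)\<bar> + \<bar>Q' (t - s x) - Q' (t' - s y)\<bar>"
    using assms(1) by auto
  also have "\<dots> \<le> \<kappa> * Lp * ((1 + sqrt b) powr r * d powr r) + \<kappa> * Lp * ((1 + sqrt b) powr r * d powr r)"
    by (intro add_mono q b1 b2)
  finally show ?thesis by (simp add: LH_def algebra_simps)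
qed

lemma n1_jump_near:
  assumes "n1 x \<noteq> n1 y" obtains n :: int where "\<bar>x - (hw + 2 * pi * n)\<bar> \<le> \<bar>x - y\<bar>" "\<bar>y - (hw + 2 * pi * n)\<bar> \<le> \<bar>x - y\<bar>"
proof (cases "x \<le> y")
  case True
  from n1_jump[OF assms this] obtain n :: int where "x \<le> hw + 2 * pi * n" "hw + 2 * pi * n \<le> y" by blast
  then show ?thesis by (intro that[of n]) auto
next
  case False
  then obtain n :: int where "y \<le> hw + 2 * pi * n" "hw + 2 * pi * n \<le> x" using n1_jump[of y x] assms by force
  then show ?thesis by (intro that[of n]) auto
qed

lemma n2_jump_near:
  assumes "n2 x \<noteq> n2 y" obtains n :: int where "\<bar>x - (- hw + 2 * pi * n)\<bar> \<le> \<bar>x - y\<bar>" "\<bar>y - (- hw + 2 * pi * n)\<bar> \<le> \<bar>x - y\<bar>"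
proof (cases "x \<le> y")
  case True
  from n2_jump[OF assms this] obtain n :: int where "x \<le> - hw + 2 * pi * n" "- hw + 2 * pi * n \<le> y" by blast
  then show ?thesis by (intro that[of n]) auto
next
  case False
  then obtain n :: int where "y \<le> - hw + 2 * pi * n" "- hw + 2 * pi * n \<le> x" using n2_jump[of y x] assms by force
  then show ?thesis by (intro that[of n]) auto
qed

text \<open>The Hoelder bound for a wave with constant amplitude extends to the jumping amplitude by
  \<open>jump_bound\<close>; the zero between two points with different amplitudes lies on an interface.\<close>
lemma vt_holder: "holder_on r ({0..} \<times> UNIV) vt"
  unfolding holder_on_def
proof (intro exI ballI)
  fix P P' :: "real \<times> real" assume P: "P \<in> {0..} \<times> UNIV" "P' \<in> {0..} \<times> UNIV"
  obtain x t y t' where xy: "P = (x, t)" "P' = (y, t')" by (metis surj_pair)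
  have pos: "x \<ge> 0" "y \<ge> 0" using P xy by auto
  define d where "d = dist P P'"
  have d: "\<bar>x - y\<bar> \<le> d" "\<bar>t - t'\<bar> \<le> d" "0 \<le> d"
    using dist_fst_le[of P P'] dist_snd_le[of P P'] by (auto simp: xy d_def dist_real_def)
  let ?A = "\<lambda>x t. Q' (t + s x) + (-1) * Q' (t - s x)"
  have "\<bar>\<kappa> powi n1 x * ?A x t - \<kappa> powi n1 y * ?A y t'\<bar> \<le> 2 * (1 / \<kappa>) * (LH * d powr r)"
  proof (rule jump_bound)
    show "\<bar>\<kappa> powi n1 x\<bar> \<le> 1 / \<kappa>" "\<bar>\<kappa> powi n1 y\<bar> \<le> 1 / \<kappa>" using pos kappa_n1_le by auto
    show "\<bar>?A x t - ?A y t'\<bar> \<le> LH * d powr r" by (rule Q'_phase_holder) (use d in auto)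
    assume "\<kappa> powi n1 x \<noteq> \<kappa> powi n1 y"
    then have "n1 x \<noteq> n1 y" by auto
    then obtain n :: int where n: "\<bar>x - (hw + 2 * pi * n)\<bar> \<le> \<bar>x - y\<bar>" "\<bar>y - (hw + 2 * pi * n)\<bar> \<le> \<bar>x - y\<bar>"
      by (rule n1_jump_near)
    have z: "?A (hw + 2 * pi * n) t = 0" for t unfolding s_n1_interface Q_at_n1(2) by simp
    have "\<bar>?A x t - ?A (hw + 2 * pi * n) t\<bar> \<le> LH * d powr r" "\<bar>?A y t' - ?A (hw + 2 * pi * n) t'\<bar> \<le> LH * d powr r"
      by (rule Q'_phase_holder; use d n in auto)+
    then show "\<bar>?A x t\<bar> \<le> LH * d powr r \<and> \<bar>?A y t'\<bar> \<le> LH * d powr r" unfolding z by simp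
  qed
  then show "\<bar>vt P - vt P'\<bar> \<le> (2 * (1 / \<kappa>) * LH) * dist P P' powr r"
    by (simp add: xy vt_def d_def mult.assoc)
qed

lemma vx_holder: "holder_on r ({0..} \<times> UNIV) vx"
  unfolding holder_on_def
proof (intro exI ballI)
  fix P P' :: "real \<times> real" assume P: "P \<in> {0..} \<times> UNIV" "P' \<in> {0..} \<times> UNIV"
  obtain x t y t' where xy: "P = (x, t)" "P' = (y, t')" by (metis surj_pair)
  have pos: "x \<ge> 0" "y \<ge> 0" using P xy by auto
  define d where "d = dist P P'"
  have d: "\<bar>x - y\<bar> \<le> d" "\<bar>t - t'\<bar> \<le> d" "0 \<le> d"
    using dist_fst_le[of P P'] dist_snd_le[of P P'] by (auto simp: xy d_def dist_real_def)
  let ?A = "\<lambda>x t. Q' (t + s x) + 1 * Q' (t - s x)"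
  have le: "\<bar>sqrt b * \<kappa> powi n2 z\<bar> \<le> sqrt b" if "z \<ge> 0" for z
    unfolding abs_mult using kappa_n2_le[OF that] sqrt_pos by (simp add: mult_left_le)
  have "\<bar>sqrt b * \<kappa> powi n2 x * ?A x t - sqrt b * \<kappa> powi n2 y * ?A y t'\<bar> \<le> 2 * sqrt b * (LH * d powr r)"
  proof (rule jump_bound)
    show "\<bar>sqrt b * \<kappa> powi n2 x\<bar> \<le> sqrt b" "\<bar>sqrt b * \<kappa> powi n2 y\<bar> \<le> sqrt b" using pos le by auto
    show "\<bar>?A x t - ?A y t'\<bar> \<le> LH * d powr r" by (rule Q'_phase_holder) (use d in auto)
    assume "sqrt b * \<kappa> powi n2 x \<noteq> sqrt b * \<kappa> powi n2 y"
    then have "n2 x \<noteq> n2 y" by auto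
    then obtain n :: int where n: "\<bar>x - (- hw + 2 * pi * n)\<bar> \<le> \<bar>x - y\<bar>" "\<bar>y - (- hw + 2 * pi * n)\<bar> \<le> \<bar>x - y\<bar>"
      by (rule n2_jump_near)
    have z: "?A (- hw + 2 * pi * n) t = 0" for t unfolding s_n2_interface Q_at_n2 by simp
    have "\<bar>?A x t - ?A (- hw + 2 * pi * n) t\<bar> \<le> LH * d powr r" "\<bar>?A y t' - ?A (- hw + 2 * pi * n) t'\<bar> \<le> LH * d powr r"
      by (rule Q'_phase_holder; use d n in auto)+
    then show "\<bar>?A x t\<bar> \<le> LH * d powr r \<and> \<bar>?A y t'\<bar> \<le> LH * d powr r" unfolding z by simp
  qed
  then show "\<bar>vx P - vx P'\<bar> \<le> (2 * sqrt b * LH) * dist P P' powr r"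
    by (simp add: xy vx_def d_def mult.assoc)
qed

lemma v_continuous_x: "continuous_on UNIV (\<lambda>x. v (x, t))"
proof -
  have "continuous_on UNIV (\<lambda>x. Q (t + s x) - Q (t - s x))"
    by (intro continuous_intros continuous_on_compose2[OF Q_continuous] s_continuous) auto
  then have "continuous_on UNIV (\<lambda>x. \<kappa> powi n1 x * (Q (t + s x) - Q (t - s x)))"
    by (rule n1_product_continuous) (unfold s_n1_interface Q_at_n1(1), simp)
  then show ?thesis by (simp add: v_def)
qed

lemma v_DERIV_x_layer:
  assumes x: "x \<notin> interfaces" shows "((\<lambda>x. v (x, t)) has_real_derivative vx (x, t)) (at x)"
proof -
  have q: "((\<lambda>y. Q (t + y) - Q (t - y)) has_real_derivative Q' (t + y) * 1 - Q' (t - y) * (-1)) (at y)" for y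
    by (intro DERIV_diff DERIV_chain2[where f = Q, OF Q_DERIV]) (auto intro!: derivative_eq_intros)
  have "((\<lambda>x. v (x, t)) has_real_derivative \<kappa> powi n1 x * (Q' (t + s x) * 1 - Q' (t - s x) * (-1)) * slow x) (at x)"
    unfolding v_def using layer_DERIV[OF x q, of "\<lambda>i j. \<kappa> powi i"] by simp
  also have "\<kappa> powi n1 x * (Q' (t + s x) * 1 - Q' (t - s x) * (-1)) * slow x = (\<kappa> powi n1 x * slow x) * (Q' (t + s x) + Q' (t - s x))"
    by simp
  also have "\<dots> = vx (x, t)" unfolding kappa_slow by (simp add: vx_def)
  finally show ?thesis .
qed

text \<open>In \<open>x\<close>, \<open>v\<close> is continuous and has the derivative \<open>vx\<close> off finitely many interfaces. So it is the
  integral of \<open>vx\<close>, and continuity of \<open>vx\<close> gives the derivative at the interfaces as well.\<close>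
lemma v_DERIV_x:
  assumes x: "x \<ge> 0" shows "((\<lambda>x. v (x, t)) has_real_derivative vx (x, t)) (at x within {0..})"
proof -
  have vxc: "continuous_on {0..x + 1} (\<lambda>y. vx (y, t))"
    by (rule continuous_on_compose2[OF holder_on_imp_continuous_on[OF vx_holder r(1)]]) (auto intro!: continuous_intros)
  have eq: "v (y, t) = v (0, t) + integral {0..y} (\<lambda>y. vx (y, t))" if "y \<in> {0..x + 1}" for y
  proof -
    have "((\<lambda>y. vx (y, t)) has_integral (v (y, t) - v (0, t))) {0..y}"
    proof (rule fundamental_theorem_of_calculus_interior_strong[OF finite_interfaces[of 0 y]])
      show "((\<lambda>y. v (y, t)) has_vector_derivative vx (z, t)) (at z)" if "z \<in> {0<..<y} - interfaces \<inter> {0..y}" for z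
        using v_DERIV_x_layer[of z t] that by (auto simp: has_real_derivative_iff_has_vector_derivative)
      show "continuous_on {0..y} (\<lambda>y. v (y, t))" by (rule continuous_on_subset[OF v_continuous_x]) simp
    qed (use that in auto)
    then show ?thesis by (simp add: integral_unique)
  qed
  have "((\<lambda>y. v (0, t) + integral {0..y} (\<lambda>y. vx (y, t))) has_real_derivative 0 + vx (x, t)) (at x within {0..x + 1})"
    by (intro DERIV_add DERIV_const integral_has_real_derivative[OF vxc]) (use x in auto)
  then have "((\<lambda>y. v (0, t) + integral {0..y} (\<lambda>y. vx (y, t))) has_real_derivative vx (x, t)) (at x within {0..x + 1})"
    by (simp only: add_0)
  then have "((\<lambda>x. v (x, t)) has_real_derivative vx (x, t)) (at x within {0..x + 1})"
  proof (rule has_field_derivative_transform_within[where d = 1])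
    show "v (0, t) + integral {0..y} (\<lambda>y. vx (y, t)) = v (y, t)" if "y \<in> {0..x + 1}" for y
      by (rule eq[OF that, symmetric])
  qed (use x in auto)
  moreover have "at x within {0..} = at x within {0..x + 1}"
    by (rule at_within_nhd[of x "{x - 1<..<x + 1}"]) (use x in auto)
  ultimately show ?thesis by simp
qed

lemma v_DERIV_t: "((\<lambda>t. v (x, t)) has_real_derivative vt (x, t)) (at t)"
proof -
  have "((\<lambda>t. \<kappa> powi n1 x * (Q (t + s x) - Q (t - s x))) has_real_derivative \<kappa> powi n1 x * (Q' (t + s x) * 1 - Q' (t - s x) * 1)) (at t)"
    by (intro DERIV_cmult DERIV_diff DERIV_chain2[where f = Q, OF Q_DERIV]) (auto intro!: derivative_eq_intros)
  then show ?thesis by (simp add: v_def vt_def)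
qed

lemma v_C1: "C1_on ({0..} \<times> UNIV) v vx vt"
  unfolding C1_on_def
proof (intro conjI ballI)
  show "continuous_on ({0..} \<times> UNIV) vx" "continuous_on ({0..} \<times> UNIV) vt"
    by (intro holder_on_imp_continuous_on[OF _ r(1)] vx_holder vt_holder)+
  fix P :: "real \<times> real" assume P: "P \<in> {0..} \<times> UNIV"
  obtain x t where xt: "P = (x, t)" by (metis surj_pair)
  have x: "x \<ge> 0" using P xt by auto
  have "((\<lambda>(x, t). v (x, t)) has_derivative (\<lambda>(h, k). (\<lambda>h. vx (x, t) * h) h + blinfun_apply (blinfun_scaleR_left (vt (x, t))) k)) (at (x, t) within {0..} \<times> UNIV)"
  proof (rule has_derivative_partialsI)
    show "((\<lambda>x. v (x, t)) has_derivative (\<lambda>h. vx (x, t) * h)) (at x within {0..})"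
      using v_DERIV_x[OF x] by (simp add: has_field_derivative_def)
    show "((\<lambda>t. v (y, t)) has_derivative blinfun_apply (blinfun_scaleR_left (vt (y, t)))) (at t within UNIV)" for y t
    proof -
      have "(*) (vt (y, t)) = blinfun_apply (blinfun_scaleR_left (vt (y, t)))" by (auto simp: mult.commute)
      then show ?thesis using v_DERIV_t[of y t] by (simp only: has_field_derivative_def)
    qed
    have "continuous (at (x, t) within {0..} \<times> UNIV) vt"
      using holder_on_imp_continuous_on[OF vt_holder r(1)] x by (simp add: continuous_on_eq_continuous_within)
    then have "continuous (at (x, t) within {0..} \<times> UNIV) (\<lambda>p. blinfun_scaleR_left (vt p))"
      by (intro bounded_linear.continuous[OF bounded_linear_blinfun_scaleR_left])
    then show "continuous (at (x, t) within {0..} \<times> UNIV) (\<lambda>(x, t). blinfun_scaleR_left (vt (x, t)))"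
      by (simp add: case_prod_unfold)
  qed auto
  then show "(v has_derivative (\<lambda>(h, k). vx P * h + vt P * k)) (at P within {0..} \<times> UNIV)"
    by (simp add: xt mult.commute)
qed

lemma v_bounded: "x \<ge> 0 \<Longrightarrow> \<bar>v (x, t)\<bar> \<le> \<kappa> powi n1 x * (2 * MQ)"
  and vt_bounded: "x \<ge> 0 \<Longrightarrow> \<bar>vt (x, t)\<bar> \<le> 1 / \<kappa> * (2 * MQ)"
  and vx_bounded: "x \<ge> 0 \<Longrightarrow> \<bar>vx (x, t)\<bar> \<le> sqrt b * (2 * MQ)"
proof -
  assume x: "x \<ge> 0"
  have kp: "0 \<le> \<kappa> powi n1 x" "0 \<le> \<kappa> powi n2 x" using kappa by auto
  have q: "\<bar>Q (t + s x) - Q (t - s x)\<bar> \<le> 2 * MQ" "\<bar>Q' (t + s x) - Q' (t - s x)\<bar> \<le> 2 * MQ" "\<bar>Q' (t + s x) + Q' (t - s x)\<bar> \<le> 2 * MQ"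
    using MQ(1)[of "t + s x"] MQ(1)[of "t - s x"] MQ(2)[of "t + s x"] MQ(2)[of "t - s x"] by linarith+
  show "\<bar>v (x, t)\<bar> \<le> \<kappa> powi n1 x * (2 * MQ)" using q(1) kp by (simp add: v_def abs_mult mult_left_mono)
  show "\<bar>vt (x, t)\<bar> \<le> 1 / \<kappa> * (2 * MQ)"
    unfolding vt_def prod.case abs_mult using kappa_n1_le[OF x] q(2) kappa by (intro mult_mono) auto
  have "\<bar>sqrt b * \<kappa> powi n2 x\<bar> \<le> sqrt b"
    unfolding abs_mult using kappa_n2_le[OF x] sqrt_pos by (simp add: mult_left_le)
  then show "\<bar>vx (x, t)\<bar> \<le> sqrt b * (2 * MQ)"
    unfolding vx_def prod.case abs_mult[of _ "Q' (t + s x) + Q' (t - s x)"] using q(3) sqrt_pos by (intro mult_mono) auto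
qed

lemma v_anti: "v (x, t + T / 2) = - v (x, t)"
proof -
  have e: "t + T / 2 + s x = t + s x + T / 2" "t + T / 2 - s x = t - s x + T / 2" by auto
  show ?thesis unfolding v_def prod.case e Q_anti by (simp add: algebra_simps)
qed

lemma v_C1_holder: "C1_holder_cyl T r v vx vt"
proof -
  have "v (x, t + T) = v (x, t)" for x t
    using v_anti[of x t] v_anti[of x "t + T / 2"] by (simp add: algebra_simps)
  moreover have "bounded (v ` ({0..} \<times> UNIV))"
  proof -
    have "\<bar>v (x, t)\<bar> \<le> 1 / \<kappa> * (2 * MQ)" if "x \<ge> 0" for x t
    proof -
      have "\<kappa> powi n1 x * (2 * MQ) \<le> 1 / \<kappa> * (2 * MQ)"
        using kappa_n1_le[OF that] MQ(3) by (intro mult_right_mono) auto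
      then show ?thesis using v_bounded[OF that, of t] by linarith
    qed
    then show ?thesis by (auto simp: bounded_iff)
  qed
  moreover have "bounded (vt ` ({0..} \<times> UNIV))" "bounded (vx ` ({0..} \<times> UNIV))"
    using vt_bounded vx_bounded by (fastforce simp: bounded_iff)+
  ultimately show ?thesis
    unfolding C1_holder_cyl_def Let_def cyl_periodic_def using v_C1 vx_holder vt_holder by blast
qed

text \<open>One period of the medium multiplies the amplitude by \<open>\<kappa> = exp (- 2 \<pi> \<rho>)\<close>.\<close>
lemma v_decay:
  assumes \<rho>: "\<rho> = (ln b - ln a) / (4 * pi)"
  shows "\<exists>C>0. \<forall>x\<ge>0. \<forall>t. \<bar>v (x, t)\<bar> \<le> C * exp (- \<rho> * x)"
proof (intro exI conjI allI impI)
  \<comment> \<open>The summand \<open>1\<close> keeps the constant positive when the solution is zero.\<close>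
  define D where "D = exp (\<rho> * (hw + 2 * pi)) * (2 * MQ + 1)"
  show "D > 0" using MQ(3) by (simp add: D_def)
  fix x t :: real assume x: "x \<ge> 0"
  have rp: "\<rho> > 0" using a ab by (simp add: \<rho>)
  have lk: "ln \<kappa> = - (2 * pi * \<rho>)"
    using a ab by (simp add: \<kappa>_def ln_div ln_sqrt \<rho> field_simps)
  have "\<kappa> powi n1 x = \<kappa> powr n1 x" using kappa by (simp add: powr_real_of_int')
  also have "\<dots> = exp (- \<rho> * (2 * pi * n1 x))" using kappa by (simp add: powr_def lk algebra_simps)
  also have "\<dots> \<le> exp (- \<rho> * (x - hw - 2 * pi))"
    using n1_bounds(2)[of x] rp by simp
  finally have k: "\<kappa> powi n1 x \<le> exp (\<rho> * (hw + 2 * pi)) * exp (- \<rho> * x)"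
    by (simp add: exp_add[symmetric] algebra_simps)
  have "\<bar>v (x, t)\<bar> \<le> \<kappa> powi n1 x * (2 * MQ)" by (rule v_bounded[OF x])
  also have "\<dots> \<le> (exp (\<rho> * (hw + 2 * pi)) * exp (- \<rho> * x)) * (2 * MQ + 1)"
    using k MQ(3) by (intro mult_mono) auto
  finally show "\<bar>v (x, t)\<bar> \<le> D * exp (- \<rho> * x)" by (simp add: D_def algebra_simps)
qed

text \<open>Antiperiodicity gives \<open>G (t - 2 * h) = - G (t + 2 * h)\<close>, as \<open>4 * h\<close> is an odd multiple of \<open>T / 2\<close>.\<close>
lemma v_boundary: "v (0, t) = G t" "vt (0, t) = p t" "vx (0, t) = sqrt a * p (t + 2 * h)"
proof -
  have anti: "F (t + 2 * h) = - F (t - 2 * h)" if "\<And>t. F (t + T / 2) = - F t" for F :: "real \<Rightarrow> real"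
    using antiperiodic_shift(2)[of F t 0, OF that] by simp
  have e: "t + - h + h = t" "t - - h - h = t" "t - - h + h = t + 2 * h" "t + - h - h = t - 2 * h" by auto
  have k: "\<kappa> powi (-1) * (\<kappa> / 2) = 1 / 2" using kappa by (simp add: power_int_minus)
  have "v (0, t) = (\<kappa> powi (-1) * (\<kappa> / 2)) * ((G t - G (t - 2 * h)) - (G (t + 2 * h) - G t))"
    unfolding v_def prod.case n1_0 s_0 Q_def e by (simp add: algebra_simps)
  then show "v (0, t) = G t" unfolding k anti[of G, OF G_anti] by simp
  have "vt (0, t) = (\<kappa> powi (-1) * (\<kappa> / 2)) * ((p t - p (t - 2 * h)) - (p (t + 2 * h) - p t))"
    unfolding vt_def prod.case n1_0 s_0 Q'_def e by (simp add: algebra_simps)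
  then show "vt (0, t) = p t" unfolding k anti[of p, OF p_anti] by simp
  have "vx (0, t) = (\<kappa> * sqrt b) / 2 * ((p t - p (t - 2 * h)) + (p (t + 2 * h) - p t))"
    unfolding vx_def prod.case n2_0 s_0 Q'_def e by (simp add: algebra_simps)
  also have "\<dots> = sqrt a / 2 * (p (t + 2 * h) - p (t - 2 * h))" unfolding kappa(3) by (simp add: algebra_simps)
  also have "p (t - 2 * h) = - p (t + 2 * h)" using anti[of p, OF p_anti] by simp
  finally show "vx (0, t) = sqrt a * p (t + 2 * h)" by simp
qed

end

section \<open>The initial value problem and the identification with the weak solution\<close>

text \<open>The half-plane is a countable union of translates of the fundamental domain.\<close>
lemma AE_half_plane_if_AE_cylinder:
  fixes u v :: "real \<times> real \<Rightarrow> real"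
  assumes T: "T > 0" and u: "cyl_periodic T u" and v: "cyl_periodic T v"
    and eq: "AE p in lborel. indicator (cyl T) p * u p = indicator (cyl T) p * v p"
  shows "AE p in lborel. fst p \<ge> 0 \<longrightarrow> u p = v p"
proof -
  have shift: "AE p in lborel. indicator (cyl T) ((0, c) + p) * u ((0, c) + p) = indicator (cyl T) ((0, c) + p) * v ((0, c) + p)" for c :: real
  proof -
    obtain N where N: "\<And>p. p \<in> space lborel - N \<Longrightarrow> indicator (cyl T) p * u p = indicator (cyl T) p * v p" "N \<in> null_sets lborel"
      by (rule AE_E3[OF eq]) blast
    have Ns: "- N \<in> sets borel" using N(2) by auto
    have "AE p in distr lborel borel ((+) (0, c)). p \<notin> N"
      unfolding lborel_distr_plus by (rule AE_not_in[OF N(2)])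
    moreover have "(AE p in distr lborel borel ((+) (0, c)). p \<notin> N) \<longleftrightarrow> (AE p in lborel. (0, c) + p \<notin> N)"
    proof (rule AE_distr_iff)
      show "{p \<in> space borel. p \<notin> N} \<in> sets borel" using Ns by (simp add: Compl_eq)
    qed simp
    ultimately have "AE p in lborel. (0, c) + p \<notin> N" by blast
    then show ?thesis by eventually_elim (rule N(1), simp)
  qed
  have "AE p in lborel. \<forall>n::int. indicator (cyl T) ((0, of_int n * T) + p) * u ((0, of_int n * T) + p)
      = indicator (cyl T) ((0, of_int n * T) + p) * v ((0, of_int n * T) + p)"
    unfolding AE_all_countable using shift by blast
  then show ?thesis
  proof eventually_elim
    case (elim p)
    obtain x t where p: "p = (x, t)" by (metis surj_pair)
    show ?case
    proof
      assume "fst p \<ge> 0"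
      then have x: "x \<ge> 0" using p by simp
      obtain m :: int where "t - of_int m * T \<in> {0..<T}" using shift_into_period[OF T] by blast
      moreover define n where "n = - m"
      ultimately have "t + of_int n * T \<in> {0..<T}" by simp
      then have "(x, t + of_int n * T) \<in> cyl T" using x by (simp add: cyl_def)
      moreover have "(0, of_int n * T) + p = (x, t + of_int n * T)" by (simp add: p)
      ultimately have "u (x, t + of_int n * T) = v (x, t + of_int n * T)" using spec[OF elim, of n] by simp
      moreover have "u (x, t + of_int n * T) = u (x, t)" "v (x, t + of_int n * T) = v (x, t)"
        using u v x by (auto simp: cyl_periodic_def intro!: periodic_int[of "\<lambda>t. u (x, t)" T] periodic_int[of "\<lambda>t. v (x, t)" T])
      ultimately show "u p = v p" by (simp add: p)
    qed
  qed
qed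

context layered_medium
begin

text \<open>The points at which the potential is unspecified are isolated.\<close>
lemma speed_near:
  assumes V: "step_potential a b \<theta> V"
  shows "\<forall>\<^sub>F y in at x. speed V y = 1 / slow y"
proof -
  define N where "N = interfaces \<union> range (\<lambda>n::int. pi + 2 * pi * n)"
  have fin: "finite (N \<inter> {x - 1..x + 1})"
  proof -
    have "finite (range (\<lambda>n::int. pi + 2 * pi * n) \<inter> {x - 1..x + 1})"
      by (rule finite_subset[OF _ finite_lattice[of "x - 1" "x + 1" pi]]) auto
    then show ?thesis using finite_interfaces[of "x - 1" "x + 1"] by (simp add: N_def Int_Un_distrib2)
  qed
  have "open ({x - 1<..<x + 1} - (N \<inter> {x - 1..x + 1} - {x}))"
    by (intro open_Diff finite_imp_closed finite_Diff fin) auto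
  then have "\<forall>\<^sub>F y in nhds x. y \<in> {x - 1<..<x + 1} - (N \<inter> {x - 1..x + 1} - {x})"
    by (rule eventually_nhds_in_open) auto
  then show ?thesis unfolding eventually_at_filter
  proof eventually_elim
    case (elim y)
    have "speed V y = 1 / slow y" if "y \<noteq> x"
    proof -
      have "y \<notin> N" using elim that by auto
      then have "V y = (slow y)\<^sup>2" by (intro potential_eq_slow[OF V]) (auto simp: N_def)
      then show ?thesis using slow_pos[of y] by (simp add: speed_def)
    qed
    then show ?case by simp
  qed
qed

text \<open>The one-sided limits differ, whatever the value of the potential at the interface is.\<close>
lemma speed_discontinuous_at_interface:
  assumes V: "step_potential a b \<theta> V" and x: "x \<in> interfaces"
  shows "x \<in> discont (speed V)"
proof (rule ccontr)
  assume "x \<notin> discont (speed V)"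
  then have "(speed V \<longlongrightarrow> speed V x) (at x)" by (simp add: discont_def isCont_def)
  then have lim: "(speed V \<longlongrightarrow> speed V x) (at_left x)" "(speed V \<longlongrightarrow> speed V x) (at_right x)"
    by (auto simp: filterlim_at_split)
  have near: "\<forall>\<^sub>F y in at_left x. speed V y = 1 / slow y" "\<forall>\<^sub>F y in at_right x. speed V y = 1 / slow y"
    using speed_near[OF V, of x] by (auto simp: eventually_at_split)
  define d where "d = min hw (pi - hw)"
  have d: "d > 0" "d \<le> hw" "d \<le> pi - hw" using hw by (auto simp: d_def)
  have el: "\<forall>\<^sub>F y in at_left x. y \<in> {x - d<..<x}" and er: "\<forall>\<^sub>F y in at_right x. y \<in> {x<..<x + d}"
    using d by (auto intro!: eventually_at_leftI[of "x - d"] eventually_at_rightI[of _ "x + d"])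
  have concl: False if L: "\<And>y. y \<in> {x - d<..<x} \<Longrightarrow> slow y = l" and R: "\<And>y. y \<in> {x<..<x + d} \<Longrightarrow> slow y = m" and lm: "l \<noteq> m" for l m
  proof -
    have "\<forall>\<^sub>F y in at_left x. speed V y = 1 / l" using near(1) el by eventually_elim (simp add: L)
    then have "speed V x = 1 / l"
      using tendsto_unique[OF _ lim(1) tendsto_eventually] by (simp add: trivial_limit_at_left_real)
    moreover have "\<forall>\<^sub>F y in at_right x. speed V y = 1 / m" using near(2) er by eventually_elim (simp add: R)
    then have "speed V x = 1 / m"
      using tendsto_unique[OF _ lim(2) tendsto_eventually] by (simp add: trivial_limit_at_right_real)
    ultimately show False using lm by simp
  qed
  obtain n :: int where "x = hw + 2 * pi * n \<or> x = - hw + 2 * pi * n" using x by (auto simp: interfaces_def)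
  then show False
  proof
    assume xn: "x = hw + 2 * pi * n"
    have "n1 y = n - 1 \<and> n2 y = n" if "y \<in> {x - d<..<x}" for y
      unfolding n1_iff n2_iff period_step using that d hw xn by auto
    moreover have "n1 y = n \<and> n2 y = n" if "y \<in> {x<..<x + d}" for y
      unfolding n1_iff n2_iff period_step using that d hw xn by auto
    ultimately show False using sqrt_pos by (intro concl[of "sqrt a" "sqrt b"]) (simp_all add: slow_def)
  next
    assume xn: "x = - hw + 2 * pi * n"
    have "n1 y = n - 1 \<and> n2 y = n - 1" if "y \<in> {x - d<..<x}" for y
      unfolding n1_iff n2_iff period_step using that d hw xn by auto
    moreover have "n1 y = n - 1 \<and> n2 y = n" if "y \<in> {x<..<x + d}" for y
      unfolding n1_iff n2_iff period_step using that d hw xn by auto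
    ultimately show False using sqrt_pos by (intro concl[of "sqrt b" "sqrt a"]) (simp_all add: slow_def)
  qed
qed

text \<open>Continuity excludes the interfaces. It also forces the right value of the potential at the points
  \<open>\<pi> + 2 \<pi> n\<close> inside the \<open>b\<close>-layers, where none is prescribed.\<close>
lemma speed_locally_constant:
  assumes V: "step_potential a b \<theta> V" and x: "x \<notin> discont (speed V)"
  shows "\<forall>\<^sub>F y in nhds x. n1 y = n1 x \<and> n2 y = n2 x \<and> speed V y = 1 / slow x"
proof -
  have ni: "x \<notin> interfaces" using speed_discontinuous_at_interface[OF V] x by blast
  note lc = layer_index_locally_constant[OF ni]
  have ev: "\<forall>\<^sub>F y in at x. speed V y = 1 / slow x"
  proof -
    have "\<forall>\<^sub>F y in at x. n1 y = n1 x \<and> n2 y = n2 x" using lc by (simp add: eventually_nhds_conv_at)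
    with speed_near[OF V, of x] show ?thesis by eventually_elim (simp add: slow_def)
  qed
  have "(speed V \<longlongrightarrow> speed V x) (at x)" using x by (simp add: discont_def isCont_def)
  moreover have "(speed V \<longlongrightarrow> 1 / slow x) (at x)" by (rule tendsto_eventually[OF ev])
  ultimately have "speed V x = 1 / slow x" by (rule tendsto_unique[rotated]) simp
  with ev have "\<forall>\<^sub>F y in nhds x. speed V y = 1 / slow x" by (simp add: eventually_nhds_conv_at)
  with lc show ?thesis by eventually_elim simp
qed

lemma coefficient_combination:
  assumes "continuous_on UNIV D" "continuous_on UNIV E"
  shows "(LINT t:{0..<T}|lborel. c * (D t - E t) * wave T k \<alpha> t)
    = c * (coef T D k \<alpha> - coef T E k \<alpha>)"
proof -
  have "(LINT t:{0..<T}|lborel. (D t + (-1) * E t) * wave T k \<alpha> t)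
      = coef T D k \<alpha> + (-1) * coef T E k \<alpha>"
    by (intro coefficient_add continuous_coefficient_integrable assms)
  moreover have "(\<lambda>t. c * (D t - E t) * wave T k \<alpha> t) = (\<lambda>t. c * ((D t + (-1) * E t) * wave T k \<alpha> t))"
    by (auto simp: algebra_simps)
  ultimately show ?thesis by simp
qed

text \<open>The sum-to-product formula for \<open>cos (A - B) - cos (A + B)\<close>; it applies to both \<open>v\<close> and \<open>Q\<close>.\<close>
lemma coefficient_symmetric_difference:
  assumes c: "continuous_on UNIV F" and per: "\<And>t. F (t + T) = F t"
  shows "(LINT t:{0..<T}|lborel. C * (F (t + d) - F (t - d)) * wave T k \<alpha> t)
     = 2 * C * sin (freq k * d) * coef T F k (\<alpha> - pi / 2)"
proof -
  have fc: "continuous_on UNIV (\<lambda>t. F (t + e))" "continuous_on UNIV (\<lambda>t. F (t - e))" for e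
    by (intro continuous_on_compose2[OF c] continuous_intros; simp)+
  note sh = wave_coefficient_shift[OF T c per, folded freq_def]
  have m: "coef T (\<lambda>t. F (t - d)) k \<alpha> = coef T F k (\<alpha> + freq k * d)"
    using sh[of "- d" k \<alpha>] by simp
  have i: "set_integrable lborel {0..<T} (\<lambda>t. F t * wave T k \<beta> t)" for \<beta>
    by (intro continuous_coefficient_integrable continuous_on_mult c wave_continuous)
  have "coef T F k (\<alpha> - freq k * d) - coef T F k (\<alpha> + freq k * d)
      = (LINT t:{0..<T}|lborel. F t * wave T k (\<alpha> - freq k * d) t - F t * wave T k (\<alpha> + freq k * d) t)"
    by (rule set_integral_diff(2)[OF i i, symmetric])
  also have "(\<lambda>t. F t * wave T k (\<alpha> - freq k * d) t - F t * wave T k (\<alpha> + freq k * d) t)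
      = (\<lambda>t. (2 * sin (freq k * d)) * (F t * wave T k (\<alpha> - pi / 2) t))"
  proof
    fix t
    have e: "freq k * t + (\<alpha> - freq k * d) = (freq k * t + \<alpha>) - freq k * d" "freq k * t + (\<alpha> + freq k * d) = (freq k * t + \<alpha>) + freq k * d"
      "freq k * t + (\<alpha> - pi / 2) = (freq k * t + \<alpha>) - pi / 2" by simp_all
    show "F t * wave T k (\<alpha> - freq k * d) t - F t * wave T k (\<alpha> + freq k * d) t = (2 * sin (freq k * d)) * (F t * wave T k (\<alpha> - pi / 2) t)"
      unfolding wave_def freq_def[symmetric] e cos_diff cos_add by (simp add: algebra_simps)
  qed
  also have "(LINT t:{0..<T}|lborel. (2 * sin (freq k * d)) * (F t * wave T k (\<alpha> - pi / 2) t))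
      = (2 * sin (freq k * d)) * coef T F k (\<alpha> - pi / 2)"
    by (rule set_integral_mult_right)
  finally show ?thesis unfolding coefficient_combination[OF fc] sh m by simp
qed

end

context boundary_data
begin

text \<open>Along the characteristic the combination \<open>v\<^sub>t + c v\<^sub>x\<close> contains the wave that depends on
  \<open>t + s x\<close> only, and this argument is constant. As \<open>c\<close> is locally constant, the right-hand side
  is zero.\<close>
lemma v_transport:
  assumes V: "step_potential a b \<theta> V" and x: "x \<notin> discont (speed V)"
  shows "((\<lambda>k. vt (x - speed V x * k, t + k) + speed V (x - speed V x * k) * vx (x - speed V x * k, t + k))
           has_real_derivative - speed V x * deriv (speed V) x * vx (x, t)) (at 0 within S)"
proof -
  note lc = speed_locally_constant[OF V x]
  have c: "speed V x = 1 / slow x" using eventually_nhds_x_imp_x[OF lc] by simp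
  have sl: "slow x > 0" by (rule slow_pos)
  have "((\<lambda>y. 1 / slow x) has_real_derivative 0) (at x)" by simp
  moreover have "\<forall>\<^sub>F y in nhds x. speed V y = 1 / slow x" using lc by eventually_elim simp
  ultimately have "(speed V has_real_derivative 0) (at x)" by (subst DERIV_cong_ev) auto
  then have d0: "deriv (speed V) x = 0" by (rule DERIV_imp_deriv)
  have lim: "filterlim (\<lambda>k. x - speed V x * k) (nhds x) (nhds 0)"
  proof -
    have "filterlim (\<lambda>k. x - speed V x * k) (nhds (x - speed V x * 0)) (nhds 0)"
      by (intro tendsto_intros filterlim_ident)
    then show ?thesis by simp
  qed
  have "\<forall>\<^sub>F k in nhds 0. n1 (x - speed V x * k) = n1 x \<and> n2 (x - speed V x * k) = n2 x \<and> speed V (x - speed V x * k) = 1 / slow x"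
    using lc lim unfolding filterlim_iff by blast
  then have "\<forall>\<^sub>F k in nhds 0. vt (x - speed V x * k, t + k) + speed V (x - speed V x * k) * vx (x - speed V x * k, t + k)
      = 2 * \<kappa> powi n1 x * Q' (t + s x)"
  proof eventually_elim
    case (elim k)
    define y where "y = x - speed V x * k"
    have n: "n1 y = n1 x" "n2 y = n2 x" and cy: "speed V y = 1 / slow x" using elim by (auto simp: y_def)
    have sy: "s y = s x - k" using s_affine_in_layer[OF n] sl by (simp add: y_def c)
    have "1 / slow x * (sqrt b * \<kappa> powi n2 x) = \<kappa> powi n1 x" using sl by (simp add: kappa_slow[symmetric])
    moreover have e: "t + k + s y = t + s x" by (simp add: sy)
    have "vx (y, t + k) = (sqrt b * \<kappa> powi n2 x) * (Q' (t + s x) + Q' (t + k - s y))"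
      by (simp only: vx_def prod.case n e)
    ultimately have "speed V y * vx (y, t + k) = \<kappa> powi n1 x * (Q' (t + s x) + Q' (t + k - s y))"
      unfolding cy by (simp only: mult.assoc[symmetric])
    moreover have "vt (y, t + k) = \<kappa> powi n1 x * (Q' (t + s x) - Q' (t + k - s y))"
      by (simp only: vt_def prod.case n e)
    ultimately show ?case unfolding y_def[symmetric] by (simp add: algebra_simps)
  qed
  moreover have "((\<lambda>k. 2 * \<kappa> powi n1 x * Q' (t + s x)) has_real_derivative 0) (at 0)" by simp
  ultimately have "((\<lambda>k. vt (x - speed V x * k, t + k) + speed V (x - speed V x * k) * vx (x - speed V x * k, t + k)) has_real_derivative 0) (at 0)"
    by (subst DERIV_cong_ev) auto
  then show ?thesis by (simp add: d0 has_field_derivative_at_within)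
qed

lemma v_solves_ivp:
  assumes V: "step_potential a b \<theta> V" and fp: "\<And>t. f (p t) = sqrt a * G (t + 2 * h)"
  shows "C1_solution_ivp V f (\<lambda>x. v (x, 0)) (\<lambda>x. vt (x, 0)) v"
  unfolding C1_solution_ivp_def Let_def
proof (rule exI[of _ vx], rule exI[of _ vt], intro conjI allI impI)
  show "C1_on ({0..} \<times> {0..}) v vx vt"
    using v_C1 unfolding C1_on_def
    by (auto intro: continuous_on_subset has_derivative_subset)
  show "((\<lambda>k. vt (x - speed V x * k, t + k) + speed V (x - speed V x * k) * vx (x - speed V x * k, t + k))
           has_real_derivative - speed V x * deriv (speed V) x * vx (x, t)) (at 0 within {k. 0 \<le> x - speed V x * k \<and> 0 \<le> t + k})"
    if "x \<notin> discont (speed V) \<union> discont (deriv (speed V))" for x t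
    by (rule v_transport[OF V]) (use that in auto)
  fix t
  have "((\<lambda>t. sqrt a * G (t + 2 * h)) has_real_derivative sqrt a * (p (t + 2 * h) * 1)) (at t)"
    by (intro DERIV_cmult DERIV_chain2[where f = G, OF G_DERIV]) (auto intro!: derivative_eq_intros)
  then show "((\<lambda>s. f (vt (0, s))) has_real_derivative vx (0, t)) (at t within {0..})"
    by (simp add: v_boundary fp has_field_derivative_at_within)
qed auto

lemma v_coefficient:
  "coef T (\<lambda>t. v (x, t)) k \<alpha>
     = - (2 * \<kappa> * sin (freq k * h)) * Udec k x * coef T G k \<alpha>"
proof -
  have per: "F (t + T) = F t" if "\<And>t. F (t + T / 2) = - F t" for F :: "real \<Rightarrow> real" and t
    using that[of t] that[of "t + T / 2"] by (simp add: algebra_simps)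
  have Gc: "continuous_on UNIV G"
    using G_DERIV DERIV_continuous_on has_field_derivative_at_within by blast
  have 1: "coef T (\<lambda>t. v (x, t)) k \<alpha>
     = 2 * \<kappa> powi n1 x * sin (freq k * s x) * coef T Q k (\<alpha> - pi / 2)"
    unfolding v_def prod.case by (rule coefficient_symmetric_difference[OF Q_continuous per[of Q, OF Q_anti]])
  have 2: "coef T Q k (\<alpha> - pi / 2)
     = 2 * (\<kappa> / 2) * sin (freq k * h) * coef T G k (\<alpha> - pi / 2 - pi / 2)"
    unfolding Q_def by (rule coefficient_symmetric_difference[OF Gc per[of G, OF G_anti]])
  have 3: "wave T k (\<alpha> - pi / 2 - pi / 2) = (\<lambda>t. - wave T k \<alpha> t)"
  proof -
    have "wave T k (\<alpha> - pi / 2 - pi / 2 + pi / 2 + pi / 2) = (\<lambda>t. - wave T k (\<alpha> - pi / 2 - pi / 2) t)"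
      by (rule wave_shift_pi)
    moreover have "\<alpha> - pi / 2 - pi / 2 + pi / 2 + pi / 2 = \<alpha>" by simp
    ultimately show ?thesis by auto
  qed
  have 4: "(LINT t:{0..<T}|lborel. G t * - wave T k \<alpha> t) = - coef T G k \<alpha>"
    by (simp add: set_lebesgue_integral_def)
  show ?thesis unfolding 1 2 3 4 Udec_def by simp
qed

text \<open>For almost every \<open>x\<close> the functions \<open>u(x, \<cdot>)\<close> and \<open>v(x, \<cdot>)\<close> have the same coefficients; only countably
  many of them are needed, so the exceptional sets may be united.\<close>
lemma u_eq_v_on_cylinder:
  assumes L2: "L2_cyl T u"
    and odd: "\<And>k \<alpha>. odd k \<Longrightarrow> AE x in lborel. x > 0 \<longrightarrow> mode T (wave T k \<alpha>) u x * sin (freq k * h)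
        = - \<kappa> * Udec k x * coef T G k \<alpha>"
    and even: "\<And>k \<alpha>. even k \<Longrightarrow> AE x in lborel. x > 0 \<longrightarrow> mode T (wave T k \<alpha>) u x = 0"
    and G0: "\<And>k \<alpha>. even k \<Longrightarrow> coef T G k \<alpha> = 0"
  shows "AE p in lborel. indicator (cyl T) p * u p = indicator (cyl T) p * v p"
proof -
  have modes: "AE x in lborel. x > 0 \<longrightarrow> mode T (wave T k \<alpha>) u x = coef T (\<lambda>t. v (x, t)) k \<alpha>" for k \<alpha>
  proof (cases "even k")
    case True
    from even[OF this, of \<alpha>] show ?thesis by eventually_elim (simp add: v_coefficient G0[OF True])
  next
    case False
    note half = freq_h_odd(2,4)[OF False]
    from odd[OF False, of \<alpha>] show ?thesis
    proof eventually_elim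
      case (elim x)
      show ?case
      proof
        assume "x > 0"
        let ?S = "sin (freq k * h)" and ?I = "LINT t:{0..<T}|lborel. G t * wave T k \<alpha> t"
        have "coef T (\<lambda>t. v (x, t)) k \<alpha> * ?S = - \<kappa> * Udec k x * ?I * (2 * ?S\<^sup>2)"
          unfolding v_coefficient by (simp add: power2_eq_square)
        also have "\<dots> = mode T (wave T k \<alpha>) u x * ?S" using elim \<open>x > 0\<close> half(2) by simp
        finally show "mode T (wave T k \<alpha>) u x = coef T (\<lambda>t. v (x, t)) k \<alpha>"
          using half(1) by simp
      qed
    qed
  qed
  \<comment> \<open>The phases \<open>0\<close> and \<open>- (pi / 2)\<close> give the cosine and the sine coefficients.\<close>
  have "AE x in lborel. \<forall>k. x > 0 \<longrightarrow> mode T (wave T k 0) u x = coef T (\<lambda>t. v (x, t)) k 0"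
    "AE x in lborel. \<forall>k. x > 0 \<longrightarrow> mode T (wave T k (- (pi / 2))) u x = coef T (\<lambda>t. v (x, t)) k (- (pi / 2))"
    unfolding AE_all_countable using modes by blast+
  moreover have "AE x in lborel. x \<noteq> (0::real)" by (rule AE_lborel_singleton)
  ultimately have slices: "AE x in lborel. AE t in lborel. indicator (cyl T) (x, t) * u (x, t) = indicator (cyl T) (x, t) * v (x, t)"
    using L2_cyl_slice[OF L2]
  proof eventually_elim
    case (elim x)
    show ?case
    proof (cases "x > 0")
      case False
      then have "x < 0" using elim(3) by simp
      then have "indicator (cyl T) (x, t) = (0::real)" for t by (simp add: cyl_def)
      then show ?thesis by simp
    next
      case True
      have iu: "set_integrable lborel {0..<T} (\<lambda>t. u (x, t))"
        by (rule square_integrable_on_interval(1)[OF T]) (use elim(4) True in simp_all)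
      have vc: "continuous_on UNIV (\<lambda>t. v (x, t))"
        by (rule DERIV_continuous_on) (rule has_field_derivative_at_within[OF v_DERIV_t])
      note iv = continuous_coefficient_integrable[OF vc]
      have "AE t in lborel. t \<in> {0<..<T} \<longrightarrow> u (x, t) + (-1) * v (x, t) = 0"
      proof (rule Fourier_uniqueness[OF T])
        show "set_integrable lborel {0..<T} (\<lambda>t. u (x, t) + (-1) * v (x, t))"
          by (intro set_integral_add set_integrable_mult_right impI iu iv)
        fix k :: int
        have z: "(LINT t:{0..<T}|lborel. (u (x, t) + (-1) * v (x, t)) * wave T k \<alpha> t) = 0" if "\<alpha> = 0 \<or> \<alpha> = - (pi / 2)" for \<alpha>
        proof -
          have "mode T (wave T k \<alpha>) u x = coef T (\<lambda>t. v (x, t)) k \<alpha>" using spec[OF elim(1), of k] spec[OF elim(2), of k] True that by fastforce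
          then show ?thesis unfolding coefficient_add[OF iu iv] by (simp add: mode_def)
        qed
        show "(LINT t:{0..<T}|lborel. (u (x, t) + (-1) * v (x, t)) * cos (of_int k * (2 * pi / T) * t)) = 0"
          using z[of 0] by (simp add: wave_def)
        have "cos (y + - (pi / 2)) = sin y" for y :: real by (simp add: cos_diff)
        then show "(LINT t:{0..<T}|lborel. (u (x, t) + (-1) * v (x, t)) * sin (of_int k * (2 * pi / T) * t)) = 0"
          using z[of "- (pi / 2)"] by (simp only: wave_def) blast
      qed
      moreover have "AE t in lborel. t \<noteq> (0::real)" by (rule AE_lborel_singleton)
      ultimately show ?thesis
        by eventually_elim (auto simp: cyl_def indicator_def)
    qed
  qed
  have mu: "(\<lambda>p. indicator (cyl T) p * u p) \<in> borel_measurable (lborel \<Otimes>\<^sub>M lborel)" by (rule L2_cyl_measurable[OF L2])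
  have mv: "(\<lambda>p. indicator (cyl T) p * v p) \<in> borel_measurable (lborel \<Otimes>\<^sub>M lborel)"
  proof -
    have half: "({0..} \<times> UNIV :: (real \<times> real) set) \<in> sets borel"
      by (intro borel_closed closed_Times) auto
    have "continuous_on ({0..} \<times> UNIV) v"
      using v_C1 unfolding C1_on_def
      by (meson continuous_on_eq_continuous_within has_derivative_continuous)
    then have "(\<lambda>p. indicator ({0..} \<times> UNIV) p *\<^sub>R v p) \<in> borel_measurable borel"
      by (rule borel_measurable_continuous_on_indicator[OF half])
    then have "(\<lambda>p. indicator (cyl T) p * (indicator ({0..} \<times> UNIV) p *\<^sub>R v p)) \<in> borel_measurable borel"
      using cyl_borel by simp
    moreover have "(\<lambda>p. indicator (cyl T) p * (indicator ({0..} \<times> UNIV) p *\<^sub>R v p)) = (\<lambda>p. indicator (cyl T) p * v p)"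
      by (auto simp: indicator_def cyl_def)
    ultimately have "(\<lambda>p. indicator (cyl T) p * v p) \<in> borel_measurable borel" by (simp only:)
    then show ?thesis by (simp add: lborel_prod)
  qed
  have "AE p in lborel \<Otimes>\<^sub>M lborel. indicator (cyl T) p * u p = indicator (cyl T) p * v p"
  proof (rule lborel_pair.AE_pair_measure)
    show "{p \<in> space (lborel \<Otimes>\<^sub>M lborel). indicator (cyl T) p * u p = indicator (cyl T) p * v p} \<in> sets (lborel \<Otimes>\<^sub>M lborel)"
    proof -
      note [measurable] = mu mv
      show ?thesis by measurable
    qed
  qed (rule slices)
  then show ?thesis unfolding lborel_prod .
qed

end

theorem theorem7p3:
  fixes T \<omega> r a b \<theta> \<rho> :: real
    and f V :: "real \<Rightarrow> real"
    and u :: "real \<times> real \<Rightarrow> real"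
  assumes "T > 0" and "\<omega> = 2 * pi / T"
    and "strict_mono f" and "\<forall>y. f (- y) = - f y"
    and "homeomorphism UNIV UNIV f (inv f)"
    and "0 < r" and "r < 1" and "holder_on r UNIV (inv f)"
    and "0 < a" and "a < b" and "0 < \<theta>" and "\<theta> < 1"
    and "step_potential a b \<theta> V"
    and "\<exists>m::nat. 4 * sqrt a * \<theta> * \<omega> = 2 * real m + 1"
    and "\<exists>m::nat. 4 * sqrt b * (1 - \<theta>) * \<omega> = 2 * real m + 1"
    and "\<rho> = (ln b - ln a) / (4 * pi)"
    and "weak_solution T V f u"
  shows "\<exists>v vx vt.
      (AE p in lborel. fst p \<ge> 0 \<longrightarrow> u p = v p) \<and>
      (\<forall>x\<ge>0. \<forall>t. v (x, t + T / 2) = - v (x, t)) \<and>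
      C1_holder_cyl T r v vx vt \<and>
      C1_solution_ivp V f (\<lambda>x. v (x, 0)) (\<lambda>x. vt (x, 0)) v \<and>
      (\<exists>C>0. \<forall>x\<ge>0. \<forall>t. \<bar>v (x, t)\<bar> \<le> C * exp (- \<rho> * x))"
proof -
  obtain ma mb :: nat where res: "4 * sqrt a * \<theta> * \<omega> = 2 * real ma + 1" "4 * sqrt b * (1 - \<theta>) * \<omega> = 2 * real mb + 1"
    using assms(14,15) by blast
  interpret layered_medium T a b \<theta> ma mb
    by unfold_locales (use assms res in auto)
  note V = \<open>step_potential a b \<theta> V\<close>
  obtain ux ut g g' where H1: "H1_cyl T u ux ut" and tr: "has_trace T u ux ut g" and W: "W11_circle T g g'"
    and fi: "set_integrable lborel {0..<T} (\<lambda>t. f (g' t))"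
    and weak: "\<forall>\<phi>\<in>test_fun T. (LINT p:cyl T|lborel. - V (fst p) * ut p * pdt \<phi> p + ux p * pdx \<phi> p)
           - (LINT t:{0..<T}|lborel. f (g' t) * pdt \<phi> (0, t)) = 0"
    using \<open>weak_solution T V f u\<close> unfolding weak_solution_def by blast
  have f_odd: "f (- y) = - f y" for y using assms(4) by blast
  obtain G p where G: "\<And>t. (G has_real_derivative p t) (at t)" "continuous_on UNIV p"
    "\<And>t. G (t + T / 2) = - G t" "\<And>t. f (p t) = sqrt a * G (t + 2 * h)"
    "\<And>k \<alpha>. coef T g k \<alpha> = coef T G k \<alpha>"
    by (rule boundary_function[OF f_odd assms(5) V H1 tr W fi weak]) blast
  obtain Mp where Mp: "\<And>t. \<bar>p t\<bar> \<le> Mp"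
    by (rule bounded_if_antiperiodic[OF G(2) antiperiodic_derivative[OF G(1,3)]]) blast
  have G_Lip: "\<bar>G t - G t'\<bar> \<le> Mp * \<bar>t - t'\<bar>" for t t'
  proof -
    have "norm (G t - G t') \<le> Mp * norm (t - t')"
      by (rule field_differentiable_bound[of UNIV G p]) (use Mp G(1) in auto)
    then show ?thesis by simp
  qed
  obtain L where L: "\<And>y z. \<bar>inv f y - inv f z\<bar> \<le> L * dist y z powr r"
    using assms(8) by (auto simp: holder_on_def)
  define Lp where "Lp = \<bar>L\<bar> * (sqrt a * Mp) powr r"
  have p_inv: "p t = inv f (sqrt a * G (t + 2 * h))" for t
    using assms(5) G(4)[of t] by (metis UNIV_I homeomorphism_def)
  have p_holder: "\<bar>p t - p t'\<bar> \<le> Lp * \<bar>t - t'\<bar> powr r" for t t'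
  proof -
    have Mp0: "0 \<le> Mp" using Mp[of 0] by linarith
    have d: "dist (sqrt a * G (t + 2 * h)) (sqrt a * G (t' + 2 * h)) \<le> sqrt a * Mp * \<bar>t - t'\<bar>"
    proof -
      have "dist (sqrt a * G (t + 2 * h)) (sqrt a * G (t' + 2 * h)) = sqrt a * \<bar>G (t + 2 * h) - G (t' + 2 * h)\<bar>"
        using sqrt_pos by (simp add: dist_real_def abs_mult flip: right_diff_distrib)
      also have "\<dots> \<le> sqrt a * (Mp * \<bar>t - t'\<bar>)"
        using G_Lip[of "t + 2 * h" "t' + 2 * h"] sqrt_pos by (intro mult_left_mono) auto
      finally show ?thesis by simp
    qed
    have "\<bar>p t - p t'\<bar> \<le> L * dist (sqrt a * G (t + 2 * h)) (sqrt a * G (t' + 2 * h)) powr r"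
      unfolding p_inv by (rule L)
    also have "\<dots> \<le> \<bar>L\<bar> * (sqrt a * Mp * \<bar>t - t'\<bar>) powr r"
      using d assms(6) by (intro mult_mono powr_mono2) auto
    also have "(sqrt a * Mp * \<bar>t - t'\<bar>) powr r = (sqrt a * Mp) powr r * \<bar>t - t'\<bar> powr r"
      by (rule powr_mult)
    finally show ?thesis by (simp add: Lp_def)
  qed
  interpret boundary_data T a b \<theta> ma mb G p r Lp
    by unfold_locales (use G assms p_holder in auto)
  note bc = boundary_coefficients[OF V H1 tr weak, unfolded G(5)]
  have L2: "L2_cyl T u" using H1 by (simp add: H1_cyl_def)
  have "AE p in lborel. indicator (cyl T) p * u p = indicator (cyl T) p * v p"
    by (rule u_eq_v_on_cylinder[OF L2 bc(4) bc(5) bc(2)])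
  moreover have "cyl_periodic T u" using L2 by (simp add: L2_cyl_def)
  moreover have "cyl_periodic T v" using v_C1_holder by (simp add: C1_holder_cyl_def Let_def)
  ultimately have "AE p in lborel. fst p \<ge> 0 \<longrightarrow> u p = v p"
    using AE_half_plane_if_AE_cylinder[OF T] by blast
  then show ?thesis
    using v_anti v_C1_holder v_solves_ivp[OF V G(4)] v_decay[OF assms(16)] by blast
qed

end
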